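(* Let $T\in\bar{\mathbb Q}[z]$ be a non-zero polynomial and $R=\bar{\mathbb Q}[z,\frac1{T(z)}]$. Let $y=\sum a_mz^m\in\bar{\mathbb Q}[[z]]$ be a solution of a linear differential equation $\phi(y)=y^{(n)}+b_{n-1}y^{(n-1)}+\cdots+b_0y=0$ of order $n$ with coefficients $b_i\in R$, where $y^{(i)}=\frac{d^iy}{dz^i}$. Assume that $\bar{\mathbb Q}(z)$ is algebraically closed in $\bar{\mathbb Q}(z,y,\ldots,y^{(n-1)})$. Let $\xi\in\bar{\mathbb Q}^\ast$ be in the domain of convergence of $y$, and not a zero of $T$. Assume that the transcendence degree (resp. homogeneous transcendence degree) of $\bar{\mathbb Q}[y(\xi),\ldots,y^{(n-1)}(\xi)]$ over $\bar{\mathbb Q}$ equals the transcendence degree (resp. homogeneous transcendence degree) of $\bar{\mathbb Q}(z)[y,\ldots,y^{(n-1)}]$ over $\bar{\mathbb Q}(z)$. Then any polynomial relation (resp. homogeneous polynomial relation) with coefficients in $\bar{\mathbb Q}$ between $y(\xi),\ldots,y^{(n-1)}(\xi)$ is the specialization at $z=\xi$ of a polynomial relation (resp. homogeneous polynomial relation of the same degree) with coefficients in $R$ between $y,\ldots,y^{(n-1)}$. In particular (in either case), if the functions $y,\ldots,y^{(n-1)}$ are linearly independent over $\bar{\mathbb Q}(z)$, then their values $y(\xi),\ldots,y^{(n-1)}(\xi)$ are linearly independent over $\bar{\mathbb Q}$.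
   Context: $\bar{\mathbb Q}$ is the algebraic closure of $\mathbb Q$ in $\mathbb C$. A polynomial relation with coefficients in a ring $A$ between $f_0,\ldots,f_{n-1}$ is a polynomial $P\in A[X_0,\ldots,X_{n-1}]$ with $P(f_0,\ldots,f_{n-1})=0$; specialization at $\xi$ means applying the evaluation $R\to\bar{\mathbb Q}$, $z\mapsto\xi$, to the coefficients. For a field $k$ and elements $f_0,\ldots,f_{n-1}$ of an extension field of $k$, the homogeneous transcendence degree of $k[f_0,\ldots,f_{n-1}]$ over $k$ (with respect to the generators $f_i$) is the maximal number of elements among the $f_i$ which satisfy no non-trivial homogeneous polynomial relation over $k$; equivalently, it is the Krull dimension of the quotient of $k[X_0,\ldots,X_{n-1}]$ by the ideal generated by the homogeneous polynomial relations over $k$ between the $f_i$. *)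

theory Defs
  imports "HOL-Complex_Analysis.Complex_Analysis" "HOL-Library.Poly_Mapping"
begin

section \<open>Polynomials in several variables over a subring\<close>

text \<open>
  A polynomial with variables indexed by \<open>'v\<close> and coefficients in \<open>'a\<close> is an element of
  \<open>('v \<Rightarrow>\<^sub>0 nat) \<Rightarrow>\<^sub>0 'a\<close>: it sends a monomial, given by its exponents, to its coefficient.
  Below, \<open>A\<close> and \<open>k\<close> stand for (the carrier of) a subring, respectively a subfield, of \<open>'a\<close>.
\<close>

type_synonym ('v, 'a) mpoly = "('v \<Rightarrow>\<^sub>0 nat) \<Rightarrow>\<^sub>0 'a"

definition mpoly_ring :: "'a::zero set \<Rightarrow> 'v set \<Rightarrow> ('v, 'a) mpoly set" where
  "mpoly_ring A I = {P. (\<forall>m. Poly_Mapping.lookup P m \<in> A) \<and>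
     (\<forall>m\<in>Poly_Mapping.keys P. Poly_Mapping.keys m \<subseteq> I)}"

definition mpoly_eval :: "('v \<Rightarrow> 'a) \<Rightarrow> ('v, 'a) mpoly \<Rightarrow> 'a::comm_ring_1" where
  "mpoly_eval f P =
     (\<Sum>m\<in>Poly_Mapping.keys P. Poly_Mapping.lookup P m *
       (\<Prod>i\<in>Poly_Mapping.keys m. f i ^ Poly_Mapping.lookup m i))"

text \<open>The zero polynomial is homogeneous of every degree.\<close>

definition homogeneous :: "nat \<Rightarrow> ('v, 'a::zero) mpoly \<Rightarrow> bool" where
  "homogeneous d P \<longleftrightarrow>
     (\<forall>m\<in>Poly_Mapping.keys P. (\<Sum>i\<in>Poly_Mapping.keys m. Poly_Mapping.lookup m i) = d)"

definition poly_relations :: "'a set \<Rightarrow> 'v set \<Rightarrow> ('v \<Rightarrow> 'a) \<Rightarrow> ('v, 'a::comm_ring_1) mpoly set" where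
  "poly_relations A I f = {P \<in> mpoly_ring A I. mpoly_eval f P = 0}"

definition adjoin_ring :: "'a::comm_ring_1 set \<Rightarrow> 'v set \<Rightarrow> ('v \<Rightarrow> 'a) \<Rightarrow> 'a set" where
  "adjoin_ring A I f = mpoly_eval f ` mpoly_ring A I"

definition adjoin_field :: "'a::field set \<Rightarrow> 'v set \<Rightarrow> ('v \<Rightarrow> 'a) \<Rightarrow> 'a set" where
  "adjoin_field k I f = {a / b |a b. a \<in> adjoin_ring k I f \<and> b \<in> adjoin_ring k I f \<and> b \<noteq> 0}"


section \<open>Transcendence degrees, linear independence, relative algebraic closedness\<close>

definition alg_indep :: "'a set \<Rightarrow> 'v set \<Rightarrow> ('v \<Rightarrow> 'a::field) \<Rightarrow> bool" where
  "alg_indep k I f \<longleftrightarrow> (\<forall>P\<in>poly_relations k I f. P = 0)"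

definition hom_alg_indep :: "'a set \<Rightarrow> 'v set \<Rightarrow> ('v \<Rightarrow> 'a::field) \<Rightarrow> bool" where
  "hom_alg_indep k I f \<longleftrightarrow> (\<forall>d. \<forall>P\<in>poly_relations k I f. homogeneous d P \<longrightarrow> P = 0)"

text \<open>
  The elements of a subset \<open>S\<close> of the ring \<open>B\<close> serve as their own indices, so algebraic independence
  of \<open>S\<close> is that of the family \<open>\<lambda>x. x\<close> indexed by \<open>S\<close>.
\<close>

definition trdeg :: "'a set \<Rightarrow> 'a::field set \<Rightarrow> enat" where
  "trdeg k B = (SUP S\<in>{S. finite S \<and> S \<subseteq> B \<and> alg_indep k S (\<lambda>x. x)}. enat (card S))"

text \<open>
  Unlike the transcendence degree, the homogeneous one depends on the generators \<open>f\<close> of the ring.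
  The set below contains \<open>0\<close> (take \<open>J = {}\<close>) and is bounded by \<open>n\<close>.
\<close>

definition hom_trdeg :: "'a set \<Rightarrow> nat \<Rightarrow> (nat \<Rightarrow> 'a::field) \<Rightarrow> nat" where
  "hom_trdeg k n f = Max {card J |J. J \<subseteq> {..<n} \<and> hom_alg_indep k J f}"

definition lin_indep :: "'a set \<Rightarrow> nat \<Rightarrow> (nat \<Rightarrow> 'a::field) \<Rightarrow> bool" where
  "lin_indep k n f \<longleftrightarrow>
     (\<forall>c. (\<forall>i<n. c i \<in> k) \<and> (\<Sum>i<n. c i * f i) = 0 \<longrightarrow> (\<forall>i<n. c i = 0))"

definition algebraically_closed_in :: "'a set \<Rightarrow> 'a::field set \<Rightarrow> bool" where
  "algebraically_closed_in k L \<longleftrightarrow>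
     (\<forall>x\<in>L. (\<exists>p. p \<noteq> 0 \<and> (\<forall>i. coeff p i \<in> k) \<and> poly p x = 0) \<longrightarrow> x \<in> k)"


section \<open>Algebraic numbers and rational functions inside the Laurent series\<close>

text \<open>
  All functions live in the field of formal Laurent series at \<open>0\<close>; it contains the
  power series solution as well as the coefficients of the equation, which may have a pole at \<open>0\<close>.
\<close>

definition Qbar :: "complex set" where
  "Qbar = {x. algebraic x}"

definition Qbar_poly :: "complex poly set" where
  "Qbar_poly = {p. \<forall>i. coeff p i \<in> Qbar}"

definition fls_of_poly :: "complex poly \<Rightarrow> complex fls" where
  "fls_of_poly p = fps_to_fls (fps_of_poly p)"

definition Qbar_ratfun :: "complex fls set" where
  "Qbar_ratfun = {fls_of_poly p / fls_of_poly q |p q. p \<in> Qbar_poly \<and> q \<in> Qbar_poly \<and> q \<noteq> 0}"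

definition Qbar_poly_inv :: "complex poly \<Rightarrow> complex fls set" where
  "Qbar_poly_inv T = {fls_of_poly p / fls_of_poly T ^ j |p j. p \<in> Qbar_poly}"

text \<open>
  The value at \<open>\<xi>\<close> of a rational function without pole at \<open>\<xi>\<close>. It cannot be obtained by summing
  the Laurent series, since \<open>\<xi>\<close> may be farther from \<open>0\<close> than some poles of the function.
\<close>

definition ratfun_eval :: "complex \<Rightarrow> complex fls \<Rightarrow> complex" where
  "ratfun_eval \<xi> r =
     (THE c. \<exists>p q. poly q \<xi> \<noteq> 0 \<and> r = fls_of_poly p / fls_of_poly q \<and> c = poly p \<xi> / poly q \<xi>)"

lemma fls_of_poly_mult: "fls_of_poly (p * q) = fls_of_poly p * fls_of_poly q"
  by (simp add: fls_of_poly_def fps_of_poly_mult fls_times_fps_to_fls)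

lemma fls_of_poly_power: "fls_of_poly (p ^ j) = fls_of_poly p ^ j"
  by (simp add: fls_of_poly_def fps_of_poly_power fps_to_fls_power)

lemma fls_of_poly_eq_iff: "fls_of_poly p = fls_of_poly q \<longleftrightarrow> p = q"
  by (simp add: fls_of_poly_def fps_to_fls_eq_iff fps_of_poly_eq_iff)

lemma fls_of_poly_eq_0_iff: "fls_of_poly p = 0 \<longleftrightarrow> p = 0"
  using fls_of_poly_eq_iff[of p 0] by (simp add: fls_of_poly_def)

lemma ratfun_eval_divide:
  assumes "poly q \<xi> \<noteq> 0"
  shows "ratfun_eval \<xi> (fls_of_poly p / fls_of_poly q) = poly p \<xi> / poly q \<xi>"
  unfolding ratfun_eval_def
proof (rule the_equality)
  fix c
  assume "\<exists>p' q'. poly q' \<xi> \<noteq> 0 \<and>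
    fls_of_poly p / fls_of_poly q = fls_of_poly p' / fls_of_poly q' \<and> c = poly p' \<xi> / poly q' \<xi>"
  then obtain p' q' where *: "poly q' \<xi> \<noteq> 0" "c = poly p' \<xi> / poly q' \<xi>"
    "fls_of_poly p / fls_of_poly q = fls_of_poly p' / fls_of_poly q'"
    by blast
  have "q \<noteq> 0" "q' \<noteq> 0"
    using assms * by auto
  then have "fls_of_poly (p * q') = fls_of_poly (p' * q)"
    using *(3) by (simp add: fls_of_poly_mult fls_of_poly_eq_0_iff frac_eq_eq)
  then have "p * q' = p' * q"
    by (simp only: fls_of_poly_eq_iff)
  then have "poly p \<xi> * poly q' \<xi> = poly p' \<xi> * poly q \<xi>"
    by (metis poly_mult)
  then show "c = poly p \<xi> / poly q \<xi>"
    using assms * by (simp add: frac_eq_eq)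
qed (use assms in blast)

lemma ratfun_eval_Qbar_poly_inv:
  assumes "poly T \<xi> \<noteq> 0"
  shows "ratfun_eval \<xi> (fls_of_poly p / fls_of_poly T ^ j) = poly p \<xi> / poly T \<xi> ^ j"
  using ratfun_eval_divide[of "T ^ j" \<xi> p] assms
  by (simp add: fls_of_poly_power poly_power)

definition mpoly_specialize :: "complex \<Rightarrow> ('v, complex fls) mpoly \<Rightarrow> ('v, complex) mpoly" where
  "mpoly_specialize \<xi> P = Poly_Mapping.map (ratfun_eval \<xi>) P"

lemma lookup_mpoly_specialize:
  "Poly_Mapping.lookup (mpoly_specialize \<xi> P) m = ratfun_eval \<xi> (Poly_Mapping.lookup P m)"
  using ratfun_eval_divide[of 1 \<xi> 0]
  by (simp add: mpoly_specialize_def Poly_Mapping.map.rep_eq when_def fls_of_poly_def)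


section \<open>Derivatives of a power series and their values\<close>

definition deriv_fls :: "complex fps \<Rightarrow> nat \<Rightarrow> complex fls" where
  "deriv_fls y i = fps_to_fls (fps_nth_deriv i y)"

definition deriv_value :: "complex fps \<Rightarrow> complex \<Rightarrow> nat \<Rightarrow> complex" where
  "deriv_value y \<xi> i = eval_fps (fps_nth_deriv i y) \<xi>"

end

theory Submission
  imports Defs
begin

text \<open>
  Write \<open>k\<close> for the field of algebraic numbers, \<open>K = k(z)\<close>, \<open>f\<^sub>i = y\<^sup>(\<^sup>i\<^sup>)\<close> for \<open>i < n\<close>,
  \<open>c\<^sub>i = f\<^sub>i(\<xi>)\<close> and \<open>t = z - \<xi>\<close>. The proof takes place in the Laurent series in \<open>t\<close> with complex
  coefficients. They contain \<open>K\<close>, the Taylor series of the \<open>f\<^sub>i\<close> at \<open>\<xi>\<close>, hence \<open>L = K(f)\<close>, and the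
  fraction field \<open>F\<close> of \<open>k[[t]]\<close>.

  The coefficients of the equation have no pole at \<open>\<xi>\<close>, so a formal fundamental matrix with
  coefficients in \<open>k\<close> gives \<open>c = \<zeta> f\<close> with \<open>\<zeta>\<close> over \<open>k[[t]]\<close> and \<open>\<zeta>(\<xi>) = 1\<close>
  (\<open>initial_values_as_combinations\<close>). Therefore a relation \<open>Q(c) = 0\<close> over \<open>k\<close> becomes a relation
  \<open>Q(\<zeta> f) = 0\<close> between the functions, with coefficients in \<open>k[[t]]\<close> that reduce to those of \<open>Q\<close> at
  \<open>t = 0\<close>, and with monomials of the same degrees (\<open>relation_of_initial_values\<close>). It remains to
  replace \<open>k[[t]]\<close> by \<open>k[z]\<close>.

  This is possible if \<open>L\<close> and \<open>F\<close> are linearly disjoint over \<open>K\<close>: then the relation is a combination,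
  with coefficients in \<open>F\<close>, of relations over \<open>K\<close>, and truncating these coefficients changes it only
  by multiples of \<open>t\<close> (\<open>truncated_relation\<close>).

  Linear disjointness (\<open>linearly_disjoint_criterion\<close>) is where the hypotheses on algebraic
  closedness and on transcendence degrees enter. Let \<open>x\<close> be a transcendence basis of \<open>L\<close> over \<open>K\<close>
  among the \<open>f\<^sub>i\<close>. Elements of \<open>k[c]\<close> that are algebraically independent over \<open>k\<close> remain so over \<open>F\<close>,
  and they lie in \<open>F(f)\<close>, which is algebraic over \<open>F(x)\<close>. If there are at least as many of them as
  elements of \<open>x\<close>, then \<open>x\<close> is algebraically independent over \<open>F\<close>, and there are derivations that
  vanish on \<open>F\<close> and are dual to \<open>x\<close>. These preserve \<open>L\<close>, and their common constants in \<open>L\<close> are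
  algebraic over \<open>K\<close>, hence lie in \<open>K\<close>. Applied to a shortest \<open>L\<close>-linear relation between elements
  of \<open>F\<close>, normalised to have a coefficient \<open>1\<close>, they give a shorter one; so the coefficients are
  constants, that is, the relation has coefficients in \<open>K\<close>.

  In the homogeneous case the same argument applies to the quotients \<open>f\<^sub>i / f\<^sub>a\<close> and \<open>c\<^sub>i / c\<^sub>b\<close>, since
  homogeneous independence is algebraic independence of quotients
  (\<open>hom_alg_indep_iff_quotients\<close>). The lifts preserve degrees, so linear relations lift to linear
  relations in both cases.

  Algebraic independence is handled through derivations throughout: over a field of characteristic
  zero, an element is algebraic iff every derivation that vanishes on the field kills it
  (\<open>transcendental_derivation\<close>), and a finite family is algebraically independent iff it has a dual
  family of derivations (\<open>alg_indep_iff_dual_derivations\<close>). Exchange is then linear algebra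
  (\<open>dual_derivations_exchange\<close>).
\<close>

section \<open>Subfields and derivations\<close>

definition is_subfield :: "'a::field set \<Rightarrow> bool" where
  "is_subfield M \<longleftrightarrow> 1 \<in> M \<and> (\<forall>x\<in>M. \<forall>y\<in>M. x - y \<in> M \<and> x * y \<in> M) \<and> (\<forall>x\<in>M. inverse x \<in> M)"

lemma is_subfieldI:
  assumes "1 \<in> M" "\<And>x y. x \<in> M \<Longrightarrow> y \<in> M \<Longrightarrow> x - y \<in> M"
    "\<And>x y. x \<in> M \<Longrightarrow> y \<in> M \<Longrightarrow> x * y \<in> M" "\<And>x. x \<in> M \<Longrightarrow> inverse x \<in> M"
  shows "is_subfield M"
  using assms by (auto simp: is_subfield_def)

context
  fixes M :: "'a::field set"
  assumes M: "is_subfield M"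
begin

lemma subfield_one: "1 \<in> M"
  using M by (simp add: is_subfield_def)

lemma subfield_diff: "x \<in> M \<Longrightarrow> y \<in> M \<Longrightarrow> x - y \<in> M"
  using M by (simp add: is_subfield_def)

lemma subfield_mult: "x \<in> M \<Longrightarrow> y \<in> M \<Longrightarrow> x * y \<in> M"
  using M by (simp add: is_subfield_def)

lemma subfield_inverse: "x \<in> M \<Longrightarrow> inverse x \<in> M"
  using M by (simp add: is_subfield_def)

lemma subfield_zero: "0 \<in> M"
  using subfield_diff[OF subfield_one subfield_one] by simp

lemma subfield_uminus: "x \<in> M \<Longrightarrow> - x \<in> M"
  using subfield_diff[OF subfield_zero, of x] by simp

lemma subfield_add: "x \<in> M \<Longrightarrow> y \<in> M \<Longrightarrow> x + y \<in> M"
  using subfield_diff[OF _ subfield_uminus, of x y] by simp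

lemma subfield_divide: "x \<in> M \<Longrightarrow> y \<in> M \<Longrightarrow> x / y \<in> M"
  by (simp add: divide_inverse subfield_mult subfield_inverse)

lemma subfield_of_nat: "of_nat j \<in> M"
  by (induction j) (auto intro: subfield_zero subfield_add subfield_one)

lemma subfield_power: "x \<in> M \<Longrightarrow> x ^ j \<in> M"
  by (induction j) (auto intro: subfield_one subfield_mult)

lemma subfield_sum: "(\<And>i. i \<in> A \<Longrightarrow> g i \<in> M) \<Longrightarrow> sum g A \<in> M"
  by (induction A rule: infinite_finite_induct) (auto intro: subfield_zero subfield_add)

lemma subfield_prod: "(\<And>i. i \<in> A \<Longrightarrow> g i \<in> M) \<Longrightarrow> prod g A \<in> M"
  by (induction A rule: infinite_finite_induct) (auto intro: subfield_one subfield_mult)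

lemma subfield_poly: "(\<And>i. coeff p i \<in> M) \<Longrightarrow> x \<in> M \<Longrightarrow> poly p x \<in> M"
  by (auto simp: poly_altdef intro!: subfield_sum subfield_mult subfield_power)

lemmas subfield_intros = subfield_one subfield_zero subfield_diff subfield_mult subfield_inverse
  subfield_uminus subfield_add subfield_divide subfield_of_nat subfield_power subfield_sum
  subfield_prod

end

lemma is_subfield_Inter: "(\<And>M. M \<in> \<M> \<Longrightarrow> is_subfield M) \<Longrightarrow> is_subfield (\<Inter>\<M>)"
  by (auto simp: is_subfield_def)

lemma is_subfield_hull: "is_subfield (is_subfield hull S)"
  by (rule hull_in) (auto intro: is_subfield_Inter)

text \<open>
  Rational functions, quotients of convergent power series and the like all arise as fractions of the
  image of a ring \<open>A\<close>, under an embedding \<open>\<phi>\<close> into a field.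
\<close>

context
  fixes \<phi> :: "'b::idom \<Rightarrow> 'a::field" and A :: "'b set"
  assumes mult: "\<And>x y. \<phi> (x * y) = \<phi> x * \<phi> y" and zero: "\<And>x. \<phi> x = 0 \<longleftrightarrow> x = 0"
    and A_one: "1 \<in> A" and A_mult: "\<And>x y. x \<in> A \<Longrightarrow> y \<in> A \<Longrightarrow> x * y \<in> A"
begin

lemma is_subfield_fractions:
  assumes one: "\<phi> 1 = 1" and diff: "\<And>x y. \<phi> (x - y) = \<phi> x - \<phi> y"
    and A_diff: "\<And>x y. x \<in> A \<Longrightarrow> y \<in> A \<Longrightarrow> x - y \<in> A"
  shows "is_subfield {\<phi> a / \<phi> b |a b. a \<in> A \<and> b \<in> A \<and> b \<noteq> 0}" (is "is_subfield ?Q")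
proof -
  have fracI: "\<phi> a / \<phi> b \<in> ?Q" if "a \<in> A" "b \<in> A" "b \<noteq> 0" for a b
    using that by blast
  show ?thesis
  proof (rule is_subfieldI)
    show "1 \<in> ?Q"
      using fracI[OF A_one A_one] one by simp
    fix x y
    assume x: "x \<in> ?Q" and y: "y \<in> ?Q"
    from x obtain a b where *: "a \<in> A" "b \<in> A" "b \<noteq> 0" "x = \<phi> a / \<phi> b"
      by blast
    from y obtain c d where **: "c \<in> A" "d \<in> A" "d \<noteq> 0" "y = \<phi> c / \<phi> d"
      by blast
    have "x - y = \<phi> (a * d - c * b) / \<phi> (b * d)"
      using * ** by (simp add: diff_frac_eq mult diff zero)
    also have "\<dots> \<in> ?Q"
      using * ** by (intro fracI A_diff A_mult) auto
    finally show "x - y \<in> ?Q" .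
    have "x * y = \<phi> (a * c) / \<phi> (b * d)"
      using * ** by (simp add: mult)
    also have "\<dots> \<in> ?Q"
      using * ** by (intro fracI A_mult) auto
    finally show "x * y \<in> ?Q" .
    show "inverse x \<in> ?Q"
    proof (cases "a = 0")
      case True
      then have "inverse x = x"
        using * zero[of a] by simp
      then show ?thesis
        using x by (simp only:)
    next
      case False
      then show ?thesis
        using fracI[OF *(2,1)] * by simp
    qed
  qed
qed

lemma common_denominator:
  assumes "finite S" "S \<subseteq> {\<phi> a / \<phi> b |a b. a \<in> A \<and> b \<in> A \<and> b \<noteq> 0}"
  shows "\<exists>d\<in>A. d \<noteq> 0 \<and> (\<forall>s\<in>S. \<exists>a\<in>A. \<phi> d * s = \<phi> a)"
  using assms
proof (induction S rule: finite_induct)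
  case empty
  then show ?case
    using A_one by (intro bexI[of _ 1]) auto
next
  case (insert s S)
  obtain d where d: "d \<in> A" "d \<noteq> 0" "\<forall>s\<in>S. \<exists>a\<in>A. \<phi> d * s = \<phi> a"
    using insert by auto
  obtain a b where ab: "a \<in> A" "b \<in> A" "b \<noteq> 0" "s = \<phi> a / \<phi> b"
    using insert.prems by blast
  have "\<exists>e\<in>A. \<phi> (d * b) * t = \<phi> e" if t: "t \<in> insert s S" for t
  proof (cases "t = s")
    case True
    then have "\<phi> (d * b) * t = \<phi> (d * a)"
      using ab zero[of b] by (simp add: mult)
    then show ?thesis
      using A_mult[OF d(1) ab(1)] by blast
  next
    case False
    then obtain e where e: "e \<in> A" "\<phi> d * t = \<phi> e"
      using d(3) t by blast
    then have "\<phi> (d * b) * t = \<phi> (e * b)"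
      by (simp add: mult mult_ac flip: e(2))
    then show ?thesis
      using A_mult[OF e(1) ab(2)] by blast
  qed
  then show ?case
    using d ab A_mult[OF d(1) ab(2)] by (intro bexI[of _ "d * b"]) auto
qed

end

definition derivation :: "('a::field \<Rightarrow> 'a) \<Rightarrow> bool" where
  "derivation D \<longleftrightarrow> (\<forall>x y. D (x + y) = D x + D y \<and> D (x * y) = D x * y + x * D y)"

context
  fixes D :: "'a::field \<Rightarrow> 'a"
  assumes D: "derivation D"
begin

lemma derivation_add: "D (x + y) = D x + D y"
  using D by (simp add: derivation_def)

lemma derivation_mult: "D (x * y) = D x * y + x * D y"
  using D by (simp add: derivation_def)

lemma derivation_zero [simp]: "D 0 = 0"
proof -
  have "D 0 = D 0 + D 0"
    using derivation_add[of 0 0] by (simp only: add_0_left)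
  then show ?thesis
    by (metis add_cancel_right_right)
qed

lemma derivation_one [simp]: "D 1 = 0"
proof -
  have "D 1 = D 1 + D 1"
    using derivation_mult[of 1 1] by (simp only: mult_1_left mult_1_right)
  then show ?thesis
    by (metis add_cancel_right_right)
qed

lemma derivation_uminus: "D (- x) = - D x"
  using derivation_add[of x "- x"] by (simp add: eq_neg_iff_add_eq_0 add.commute)

lemma derivation_diff: "D (x - y) = D x - D y"
  using derivation_add[of x "- y"] by (simp add: derivation_uminus)

lemma derivation_sum: "D (sum g A) = (\<Sum>i\<in>A. D (g i))"
  by (induction A rule: infinite_finite_induct) (auto simp: derivation_add)

lemma derivation_inverse: "D (inverse x) = - D x * inverse x ^ 2"
proof (cases "x = 0")
  case False
  have "D (x * inverse x) = 0"
    using False by simp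
  then have "D x * inverse x + x * D (inverse x) = 0"
    by (simp add: derivation_mult)
  then have "x * D (inverse x) = - (D x * inverse x)"
    by (simp add: eq_neg_iff_add_eq_0 add.commute)
  then show ?thesis
    using False by (simp add: field_simps power2_eq_square)
qed simp

lemma subfield_of_constants: "is_subfield {x. D x = 0}"
  by (rule is_subfieldI) (auto simp: derivation_diff derivation_mult derivation_inverse)

lemma subfield_stable:
  assumes "is_subfield L"
  shows "is_subfield {x\<in>L. D x \<in> L}"
  by (rule is_subfieldI)
    (auto simp: derivation_diff derivation_mult derivation_inverse intro!: subfield_intros[OF assms])

lemma derivation_poly:
  "D (poly p x) = poly (map_poly D p) x + poly (pderiv p) x * D x"
  by (induction p) (auto simp: derivation_add derivation_mult map_poly_pCons pderiv_pCons algebra_simps)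

end

text \<open>
  This is the notion of algebraicity that underlies \<^const>\<open>algebraically_closed_in\<close>.
\<close>

definition alg_over :: "'a::field set \<Rightarrow> 'a \<Rightarrow> bool" where
  "alg_over M x \<longleftrightarrow> (\<exists>p. p \<noteq> 0 \<and> (\<forall>i. coeff p i \<in> M) \<and> poly p x = 0)"

lemma alg_over_self:
  assumes "is_subfield M" "x \<in> M"
  shows "alg_over M x"
  unfolding alg_over_def
  by (rule exI[of _ "[:- x, 1:]"])
    (auto simp: coeff_pCons intro: subfield_intros[OF assms(1)] assms(2) split: nat.split)

text \<open>
  At a root of a polynomial of least degree the derivative, which has smaller degree and is nonzero in
  characteristic zero, does not vanish.
\<close>

lemma alg_over_minimal:
  fixes x :: "'a::field_char_0"
  assumes "is_subfield M" "alg_over M x"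
  obtains m where "m \<noteq> 0" "\<forall>i. coeff m i \<in> M" "poly m x = 0" "poly (pderiv m) x \<noteq> 0"
    "\<And>p. \<forall>i. coeff p i \<in> M \<Longrightarrow> poly p x = 0 \<Longrightarrow> p \<noteq> 0 \<Longrightarrow> degree m \<le> degree p"
proof -
  let ?P = "\<lambda>p. p \<noteq> 0 \<and> (\<forall>i. coeff p i \<in> M) \<and> poly p x = 0"
  obtain m where m: "?P m" "\<And>p. ?P p \<Longrightarrow> degree m \<le> degree p"
    using assms(2) ex_has_least_nat[of ?P _ degree] unfolding alg_over_def by metis
  have deg: "degree m \<noteq> 0"
  proof
    assume "degree m = 0"
    then obtain a where a: "m = [:a:]"
      by (metis degree_eq_zeroE)
    then have "a = 0"
      using m(1) by simp
    then show False
      using m(1) a by simp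
  qed
  have "poly (pderiv m) x \<noteq> 0"
  proof
    assume "poly (pderiv m) x = 0"
    moreover have "pderiv m \<noteq> 0"
      using deg by (simp add: pderiv_eq_0_iff)
    moreover have "\<forall>i. coeff (pderiv m) i \<in> M"
      using m(1) subfield_mult[OF assms(1) subfield_of_nat[OF assms(1)]]
      by (auto simp: coeff_pderiv simp del: of_nat_Suc)
    ultimately have "degree m \<le> degree (pderiv m)"
      by (intro m(2)) auto
    then show False
      using deg by (simp add: degree_pderiv)
  qed
  then show ?thesis
    using m that by blast
qed

text \<open>
  Applying \<open>D\<close> to \<open>m(x) = 0\<close> for the minimal polynomial \<open>m\<close> expresses \<open>D x\<close> by \<open>x\<close> and the
  derivatives of the coefficients.
\<close>

lemma derivation_algebraic_mem:
  fixes x :: "'a::field_char_0"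
  assumes D: "derivation D" and M: "is_subfield M" and L: "is_subfield L" "M \<subseteq> L"
    and DM: "\<And>a. a \<in> M \<Longrightarrow> D a \<in> L" and x: "x \<in> L" "alg_over M x"
  shows "D x \<in> L"
proof -
  obtain m where m: "\<forall>i. coeff m i \<in> M" "poly m x = 0" "poly (pderiv m) x \<noteq> 0"
    using alg_over_minimal[OF M x(2)] by metis
  have "poly (map_poly D m) x + poly (pderiv m) x * D x = 0"
    using derivation_poly[OF D, of m x] m(2) derivation_zero[OF D] by simp
  then have "D x = - poly (map_poly D m) x / poly (pderiv m) x"
    using m(3) by (simp add: field_simps eq_neg_iff_add_eq_0)
  moreover have "poly (map_poly D m) x \<in> L"
    using m(1) DM x(1) by (intro subfield_poly[OF L(1)]) (auto simp: coeff_map_poly derivation_zero[OF D])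
  moreover have "poly (pderiv m) x \<in> L"
    using m(1) L(2) x(1)
    by (intro subfield_poly[OF L(1)]) (auto simp: coeff_pderiv simp del: of_nat_Suc
        intro!: subfield_mult[OF L(1)] subfield_of_nat[OF L(1)])
  ultimately show ?thesis
    by (simp add: subfield_divide[OF L(1)] subfield_uminus[OF L(1)])
qed

lemma derivation_algebraic_zero:
  fixes x :: "'a::field_char_0"
  assumes D: "derivation D" and M: "is_subfield M" and DM: "\<And>a. a \<in> M \<Longrightarrow> D a = 0"
    and x: "alg_over M x"
  shows "D x = 0"
proof -
  obtain m where m: "\<forall>i. coeff m i \<in> M" "poly m x = 0" "poly (pderiv m) x \<noteq> 0"
    using alg_over_minimal[OF M x] by metis
  have "map_poly D m = 0"
    using m(1) DM by (intro poly_eqI) (auto simp: coeff_map_poly derivation_zero[OF D])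
  then show ?thesis
    using derivation_poly[OF D, of m x] m(2,3) derivation_zero[OF D] by simp
qed

subsection \<open>Extension of derivations\<close>

text \<open>
  A derivation defined on a subfield is given by its graph, and a set of pairs is such a graph iff
  it is a subfield of the ring of dual numbers that contains no \<open>(0, a)\<close> with \<open>a \<noteq> 0\<close>. In this form
  Zorn's lemma applies to set inclusion.
\<close>

definition derivation_graph :: "('a::field \<times> 'a) set \<Rightarrow> bool" where
  "derivation_graph G \<longleftrightarrow> (1, 0) \<in> G \<and>
     (\<forall>x a y b. (x, a) \<in> G \<longrightarrow> (y, b) \<in> G \<longrightarrow> (x - y, a - b) \<in> G \<and> (x * y, a * y + x * b) \<in> G) \<and>
     (\<forall>x a. (x, a) \<in> G \<longrightarrow> (inverse x, - a * inverse x ^ 2) \<in> G) \<and>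
     (\<forall>a. (0, a) \<in> G \<longrightarrow> a = 0)"

context
  fixes G :: "('a::field \<times> 'a) set"
  assumes G: "derivation_graph G"
begin

lemma derivation_graph_one: "(1, 0) \<in> G"
  using G by (simp add: derivation_graph_def)

lemma derivation_graph_diff: "(x, a) \<in> G \<Longrightarrow> (y, b) \<in> G \<Longrightarrow> (x - y, a - b) \<in> G"
  using G by (simp add: derivation_graph_def)

lemma derivation_graph_mult: "(x, a) \<in> G \<Longrightarrow> (y, b) \<in> G \<Longrightarrow> (x * y, a * y + x * b) \<in> G"
  using G by (simp add: derivation_graph_def)

lemma derivation_graph_inverse: "(x, a) \<in> G \<Longrightarrow> (inverse x, - a * inverse x ^ 2) \<in> G"
  using G unfolding derivation_graph_def by blast

lemma derivation_graph_zero: "(0, 0) \<in> G"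
  using derivation_graph_diff[OF derivation_graph_one derivation_graph_one] by simp

lemma derivation_graph_add: "(x, a) \<in> G \<Longrightarrow> (y, b) \<in> G \<Longrightarrow> (x + y, a + b) \<in> G"
  using derivation_graph_diff[OF _ derivation_graph_diff[OF derivation_graph_zero]] by fastforce

lemma derivation_graph_unique: "(x, a) \<in> G \<Longrightarrow> (x, b) \<in> G \<Longrightarrow> a = b"
proof -
  assume "(x, a) \<in> G" "(x, b) \<in> G"
  then have "(0, a - b) \<in> G"
    using derivation_graph_diff by fastforce
  then have "a - b = 0"
    using G unfolding derivation_graph_def by blast
  then show "a = b"
    by simp
qed

lemma derivation_graph_domain: "is_subfield (fst ` G)"
proof (rule is_subfieldI)
  show "1 \<in> fst ` G"
    using derivation_graph_one by force
  show "x - y \<in> fst ` G" "x * y \<in> fst ` G" if "x \<in> fst ` G" "y \<in> fst ` G" for x y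
  proof -
    obtain a b where "(x, a) \<in> G" "(y, b) \<in> G"
      using \<open>x \<in> fst ` G\<close> \<open>y \<in> fst ` G\<close> by auto
    from derivation_graph_diff[OF this] derivation_graph_mult[OF this]
    show "x - y \<in> fst ` G" "x * y \<in> fst ` G"
      by (auto simp: rev_image_eqI)
  qed
  show "inverse x \<in> fst ` G" if "x \<in> fst ` G" for x
  proof -
    obtain a where "(x, a) \<in> G"
      using \<open>x \<in> fst ` G\<close> by auto
    from derivation_graph_inverse[OF this] show ?thesis
      by (auto simp: rev_image_eqI)
  qed
qed

end

text \<open>
  An extension to \<open>M(\<theta>)\<close> is determined by the value \<open>\<tau>\<close> at \<open>\<theta>\<close>; it sends \<open>p(\<theta>)\<close> to
  \<open>p\<^sup>D(\<theta>) + \<tau> p'(\<theta>)\<close>, and the only condition is that this vanishes whenever \<open>p(\<theta>)\<close> does.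
\<close>

lemma derivation_graph_extend:
  fixes G :: "('a::field \<times> 'a) set"
  assumes G: "derivation_graph G"
    and DG: "\<And>x. x \<in> fst ` G \<Longrightarrow> (x, D x) \<in> G"
    and \<tau>: "\<And>p. \<forall>i. coeff p i \<in> fst ` G \<Longrightarrow> poly p \<theta> = 0 \<Longrightarrow>
          poly (map_poly D p) \<theta> + poly (pderiv p) \<theta> * \<tau> = 0"
  obtains G' where "derivation_graph G'" "G \<subseteq> G'" "(\<theta>, \<tau>) \<in> G'"
proof -
  let ?M = "fst ` G"
  note M = derivation_graph_domain[OF G]
  have D: "D x = a" if "(x, a) \<in> G" for x a
    using derivation_graph_unique[OF G that DG] that by force
  have D0: "D 0 = 0"
    by (rule D[OF derivation_graph_zero[OF G]])
  have D1: "D 1 = 0"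
    by (rule D[OF derivation_graph_one[OF G]])
  have Ddiff: "D (x - y) = D x - D y" and Dadd: "D (x + y) = D x + D y"
    and Dmult: "D (x * y) = D x * y + x * D y"
    if "x \<in> ?M" "y \<in> ?M" for x y
    using DG[OF that(1)] DG[OF that(2)]
    by (auto intro!: D derivation_graph_diff[OF G] derivation_graph_add[OF G] derivation_graph_mult[OF G])
  have Dsum: "D (sum g A) = (\<Sum>i\<in>A. D (g i))" if "\<And>i. i \<in> A \<Longrightarrow> g i \<in> ?M" for g :: "nat \<Rightarrow> 'a" and A
    using that
    by (induction A rule: infinite_finite_induct) (auto simp: D0 Dadd subfield_sum[OF M])
  define E where "E p = poly (map_poly D p) \<theta> + poly (pderiv p) \<theta> * \<tau>" for p
  define A where "A = {p. \<forall>i. coeff p i \<in> ?M}"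
  have A_diff: "p - q \<in> A" and E_diff: "E (p - q) = E p - E q" if "p \<in> A" "q \<in> A" for p q
  proof -
    show "p - q \<in> A"
      using that by (auto simp: A_def intro: subfield_diff[OF M])
    have "map_poly D (p - q) = map_poly D p - map_poly D q"
      using that by (intro poly_eqI) (auto simp: coeff_map_poly D0 Ddiff A_def)
    then show "E (p - q) = E p - E q"
      unfolding E_def by (simp only: pderiv_diff poly_diff) (simp add: algebra_simps)
  qed
  have A_mult: "p * q \<in> A" and E_mult: "E (p * q) = E p * poly q \<theta> + poly p \<theta> * E q"
    if "p \<in> A" "q \<in> A" for p q
  proof -
    show "p * q \<in> A"
      using that by (auto simp: A_def coeff_mult intro!: subfield_sum[OF M] subfield_mult[OF M])
    have "map_poly D (p * q) = map_poly D p * q + p * map_poly D q"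
    proof (rule poly_eqI)
      fix i
      have "coeff (map_poly D (p * q)) i = D (\<Sum>j\<le>i. coeff p j * coeff q (i - j))"
        by (simp add: coeff_map_poly D0 coeff_mult)
      also have "\<dots> = (\<Sum>j\<le>i. D (coeff p j * coeff q (i - j)))"
        using that by (intro Dsum subfield_mult[OF M]) (auto simp: A_def)
      also have "\<dots> = (\<Sum>j\<le>i. D (coeff p j) * coeff q (i - j) + coeff p j * D (coeff q (i - j)))"
        using that by (intro sum.cong Dmult) (auto simp: A_def)
      also have "\<dots> = coeff (map_poly D p * q + p * map_poly D q) i"
        by (simp add: coeff_mult coeff_map_poly D0 sum.distrib)
      finally show "coeff (map_poly D (p * q)) i = coeff (map_poly D p * q + p * map_poly D q) i" .
    qed
    then show "E (p * q) = E p * poly q \<theta> + poly p \<theta> * E q"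
      by (simp add: E_def pderiv_mult algebra_simps)
  qed
  have A_const: "[:x:] \<in> A" and E_const: "E [:x:] = D x" if "x \<in> ?M" for x
    using that subfield_zero[OF M]
    by (auto simp: A_def E_def coeff_pCons map_poly_pCons pderiv_pCons D0 split: nat.split)
  have E0: "E p = 0" if "p \<in> A" "poly p \<theta> = 0" for p
    using that \<tau>[of p] by (simp add: A_def E_def)
  define f where "f p q = (poly p \<theta> / poly q \<theta>, (E p * poly q \<theta> - poly p \<theta> * E q) / poly q \<theta> ^ 2)" for p q
  define G' where "G' = {f p q |p q. p \<in> A \<and> q \<in> A \<and> poly q \<theta> \<noteq> 0}"
  have one_A: "1 \<in> A" "E 1 = 0"
    using A_const[OF subfield_one[OF M]] E_const[OF subfield_one[OF M]] D1 by (simp_all add: one_pCons)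
  have G'I: "f p q \<in> G'" if "p \<in> A" "q \<in> A" "poly q \<theta> \<noteq> 0" for p q
    using that unfolding G'_def by blast
  have "derivation_graph G'"
    unfolding derivation_graph_def
  proof (intro conjI allI impI)
    show "(1, 0) \<in> G'"
      using G'I[OF one_A(1) one_A(1)] one_A(2) by (simp add: f_def)
  next
    fix x a y b
    assume "(x, a) \<in> G'" "(y, b) \<in> G'"
    then obtain p q r s where
      pq: "p \<in> A" "q \<in> A" "poly q \<theta> \<noteq> 0" "(x, a) = f p q" and
      rs: "r \<in> A" "s \<in> A" "poly s \<theta> \<noteq> 0" "(y, b) = f r s"
      unfolding G'_def by blast
    have xa: "x = poly p \<theta> / poly q \<theta>" "a = (E p * poly q \<theta> - poly p \<theta> * E q) / poly q \<theta> ^ 2"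
      and yb: "y = poly r \<theta> / poly s \<theta>" "b = (E r * poly s \<theta> - poly r \<theta> * E s) / poly s \<theta> ^ 2"
      using pq(4) rs(4) by (simp_all add: f_def)
    have "f (p * s - r * q) (q * s) = (x - y, a - b)"
      using pq(1-3) rs(1-3) unfolding xa yb
      by (simp add: f_def E_diff E_mult A_mult field_simps power2_eq_square)
    moreover have "f (p * s - r * q) (q * s) \<in> G'"
      using pq rs by (intro G'I A_diff A_mult) auto
    ultimately show "(x - y, a - b) \<in> G'"
      by simp
    have "f (p * r) (q * s) = (x * y, a * y + x * b)"
      using pq(1-3) rs(1-3) unfolding xa yb
      by (simp add: f_def E_mult A_mult field_simps power2_eq_square)
    moreover have "f (p * r) (q * s) \<in> G'"
      using pq rs by (intro G'I A_mult) auto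
    ultimately show "(x * y, a * y + x * b) \<in> G'"
      by simp
  next
    fix x a
    assume "(x, a) \<in> G'"
    then obtain p q where pq: "p \<in> A" "q \<in> A" "poly q \<theta> \<noteq> 0" "(x, a) = f p q"
      unfolding G'_def by blast
    show "(inverse x, - a * (inverse x)\<^sup>2) \<in> G'"
    proof (cases "poly p \<theta> = 0")
      case True
      then have "(inverse x, - a * (inverse x)\<^sup>2) = (x, a)"
        using pq E0[OF pq(1)] by (simp add: f_def)
      then show ?thesis
        using \<open>(x, a) \<in> G'\<close> by (simp only:)
    next
      case False
      have xa: "x = poly p \<theta> / poly q \<theta>" "a = (E p * poly q \<theta> - poly p \<theta> * E q) / poly q \<theta> ^ 2"
        using pq(4) by (simp_all add: f_def)
      have "f q p = (inverse x, - a * (inverse x)\<^sup>2)"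
        using pq(1-3) False unfolding xa by (simp add: f_def field_simps power2_eq_square)
      then show ?thesis
        using G'I[OF pq(2,1) False] by simp
    qed
  next
    fix a
    assume "(0, a) \<in> G'"
    then obtain p q where pq: "p \<in> A" "q \<in> A" "poly q \<theta> \<noteq> 0" "(0, a) = f p q"
      unfolding G'_def by blast
    then show "a = 0"
      using E0[of p] by (auto simp: f_def)
  qed
  moreover have "G \<subseteq> G'"
  proof
    fix z
    assume "z \<in> G"
    then obtain x a where z: "z = (x, a)" "(x, a) \<in> G"
      by (cases z) auto
    then have "x \<in> ?M" "D x = a"
      using D by force+
    then have "f [:x:] 1 = z"
      using z one_A(2) E_const by (simp add: f_def)
    then show "z \<in> G'"
      using G'I[OF A_const[OF \<open>x \<in> ?M\<close>] one_A(1)] by simp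
  qed
  moreover have "(\<theta>, \<tau>) \<in> G'"
  proof -
    have "E [:0, 1:] = \<tau>"
      by (simp add: E_def map_poly_pCons D0 D1 pderiv_pCons)
    moreover have "[:0, 1:] \<in> A"
      by (auto simp: A_def coeff_pCons intro: subfield_zero[OF M] subfield_one[OF M] split: nat.split)
    ultimately show ?thesis
      using G'I[OF _ one_A(1), of "[:0, 1:]"] one_A(2) by (simp add: f_def)
  qed
  ultimately show ?thesis
    using that by blast
qed

text \<open>
  At an algebraic element the value is forced by the minimal polynomial, at a transcendental one it
  is free.
\<close>

lemma derivation_graph_extend_one:
  fixes G :: "('a::field_char_0 \<times> 'a) set"
  assumes G: "derivation_graph G"
  obtains G' where "derivation_graph G'" "G \<subseteq> G'" "\<theta> \<in> fst ` G'"
    "\<not> alg_over (fst ` G) \<theta> \<longrightarrow> (\<theta>, 1) \<in> G'"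
proof -
  let ?M = "fst ` G"
  note M = derivation_graph_domain[OF G]
  have "\<exists>a. (x, a) \<in> G" if "x \<in> ?M" for x
    using that by force
  then obtain D where DG: "\<And>x. x \<in> ?M \<Longrightarrow> (x, D x) \<in> G"
    by metis
  have D: "D x = a" if "(x, a) \<in> G" for x a
    using derivation_graph_unique[OF G that DG] that by force
  have D0: "D 0 = 0"
    by (rule D[OF derivation_graph_zero[OF G]])
  have Ddiff: "D (x - y) = D x - D y" and Dmult: "D (x * y) = D x * y + x * D y"
    if "x \<in> ?M" "y \<in> ?M" for x y
    using DG[OF that(1)] DG[OF that(2)]
    by (auto intro!: D derivation_graph_diff[OF G] derivation_graph_mult[OF G])
  show ?thesis
  proof (cases "alg_over ?M \<theta>")
    case False
    have "poly (map_poly D p) \<theta> + poly (pderiv p) \<theta> * 1 = 0"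
      if "\<forall>i. coeff p i \<in> ?M" "poly p \<theta> = 0" for p
    proof -
      have "p = 0"
        using that False unfolding alg_over_def by blast
      then show ?thesis
        by simp
    qed
    then show ?thesis
      using derivation_graph_extend[OF G DG, of \<theta> 1] that by (metis fst_conv image_eqI)
  next
    case True
    obtain m where m: "m \<noteq> 0" "\<forall>i. coeff m i \<in> ?M" "poly m \<theta> = 0" "poly (pderiv m) \<theta> \<noteq> 0"
      "\<And>p. \<forall>i. coeff p i \<in> ?M \<Longrightarrow> poly p \<theta> = 0 \<Longrightarrow> p \<noteq> 0 \<Longrightarrow> degree m \<le> degree p"
      using alg_over_minimal[OF M True] by metis
    define \<tau> where "\<tau> = - poly (map_poly D m) \<theta> / poly (pderiv m) \<theta>"
    have E_m: "poly (map_poly D m) \<theta> + poly (pderiv m) \<theta> * \<tau> = 0"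
      using m(4) by (simp add: \<tau>_def)
    \<comment> \<open>Division with remainder by \<open>m\<close>, one leading term at a time.\<close>
    have "poly (map_poly D p) \<theta> + poly (pderiv p) \<theta> * \<tau> = 0"
      if "\<forall>i. coeff p i \<in> ?M" "poly p \<theta> = 0" for p
      using that
    proof (induction "degree p" arbitrary: p rule: less_induct)
      case less
      show ?case
      proof (cases "p = 0")
        case False
        then have deg: "degree m \<le> degree p"
          using m(5) less.prems by blast
        define c where "c = lead_coeff p / lead_coeff m"
        define q where "q = monom c (degree p - degree m)"
        define r where "r = p - q * m"
        have c: "c \<in> ?M"
          unfolding c_def using less.prems(1) m(2) subfield_divide[OF M] by blast
        have q: "coeff q i \<in> ?M" for i
          using c subfield_zero[OF M] by (simp add: q_def)
        have qm: "coeff (q * m) i \<in> ?M" for i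
          using q m(2) by (auto simp: coeff_mult intro!: subfield_sum[OF M] subfield_mult[OF M])
        have r: "\<forall>i. coeff r i \<in> ?M"
          using less.prems(1) qm by (auto simp: r_def intro: subfield_diff[OF M])
        have lc: "lead_coeff m \<noteq> 0" "c \<noteq> 0"
          using m(1) False by (auto simp: c_def)
        have r_root: "poly r \<theta> = 0"
          using less.prems(2) m(3) by (simp add: r_def)
        have E_r: "poly (map_poly D r) \<theta> + poly (pderiv r) \<theta> * \<tau> = 0"
        proof (cases "degree p = 0")
          case True
          then have "p = [:coeff p 0:]"
            by (metis degree_eq_zeroE coeff_pCons_0)
          then have "poly p \<theta> = coeff p 0" "coeff p 0 \<noteq> 0"
            using False by (metis mult_zero_right add_0_right poly_0 poly_pCons, metis pCons_0_0)
          then show ?thesis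
            using less.prems(2) by simp
        next
          case nz: False
          have "degree (q * m) = degree p"
            using lc deg m(1) by (simp add: q_def degree_mult_eq degree_monom_eq)
          moreover have "lead_coeff (q * m) = lead_coeff p"
            using lc by (simp add: lead_coeff_mult q_def c_def del: coeff_monom)
          ultimately have "coeff r (degree p) = 0" "degree r \<le> degree p"
            unfolding r_def by (simp_all add: degree_diff_le)
          then have "r = 0 \<or> degree r < degree p"
            by (rule eq_zero_or_degree_less[rotated])
          then show ?thesis
          proof
            assume "degree r < degree p"
            then show ?thesis
              by (rule less.hyps[OF _ r r_root])
          qed simp
        qed
        have "map_poly D p = map_poly D r + map_poly D (q * m)"
          using r qm less.prems(1)
          by (intro poly_eqI)
            (simp add: coeff_map_poly D0 r_def Ddiff)
        moreover have "map_poly D (q * m) = map_poly D q * m + q * map_poly D m"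
        proof (rule poly_eqI)
          fix i
          have *: "coeff (q * m) i = (if i < degree p - degree m then 0 else c * coeff m (i - (degree p - degree m)))"
            by (simp add: q_def coeff_monom_mult)
          have "map_poly D q = monom (D c) (degree p - degree m)"
            by (simp add: q_def map_poly_monom D0)
          then show "coeff (map_poly D (q * m)) i = coeff (map_poly D q * m + q * map_poly D m) i"
            using * c m(2) by (simp add: coeff_map_poly D0 coeff_monom_mult q_def Dmult)
        qed
        moreover have "pderiv p = pderiv r + pderiv (q * m)"
          by (simp add: r_def pderiv_diff)
        ultimately have "poly (map_poly D p) \<theta> + poly (pderiv p) \<theta> * \<tau>
          = (poly (map_poly D r) \<theta> + poly (pderiv r) \<theta> * \<tau>)
            + poly q \<theta> * (poly (map_poly D m) \<theta> + poly (pderiv m) \<theta> * \<tau>)"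
          using m(3) by (simp add: pderiv_mult algebra_simps)
        then show ?thesis
          using E_r E_m by simp
      qed simp
    qed
    then obtain G' where "derivation_graph G'" "G \<subseteq> G'" "(\<theta>, \<tau>) \<in> G'"
      using derivation_graph_extend[OF G DG, of \<theta> \<tau>] by metis
    then show ?thesis
      using that True by force
  qed
qed

text \<open>
  Start with the derivation that vanishes on \<open>M\<close>, prescribe the value \<open>1\<close> at \<open>x\<close>, and take a maximal
  extension; its domain is everything, since one more element can always be added. Together with
  \<open>derivation_algebraic_zero\<close> this says that the common constants of the derivations over \<open>M\<close> form
  the relative algebraic closure of \<open>M\<close>.
\<close>

theorem transcendental_derivation:
  fixes x :: "'a::field_char_0"
  assumes M: "is_subfield M" and x: "\<not> alg_over M x"
  obtains D where "derivation D" "\<And>a. a \<in> M \<Longrightarrow> D a = 0" "D x = 1"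
proof -
  \<comment> \<open>the graph of the zero derivation on \<open>M\<close>\<close>
  define G0 where "G0 = M \<times> {0::'a}"
  have G0: "derivation_graph G0"
    using subfield_one[OF M] subfield_diff[OF M] subfield_mult[OF M] subfield_inverse[OF M]
    unfolding derivation_graph_def G0_def by simp
  have "fst ` G0 = M"
    by (simp add: G0_def)
  with x obtain G1 where G1: "derivation_graph G1" "G0 \<subseteq> G1" "(x, 1) \<in> G1"
    by (rule_tac derivation_graph_extend_one[OF G0, of x]) blast
  let ?\<A> = "{G. derivation_graph G \<and> G1 \<subseteq> G}"
  have "\<exists>G\<in>?\<A>. \<forall>H\<in>?\<A>. G \<subseteq> H \<longrightarrow> H = G"
  proof (rule subset_Zorn_nonempty)
    show "?\<A> \<noteq> {}"
      using G1(1) by blast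
  next
    fix \<C>
    assume ne: "\<C> \<noteq> {}" and chain: "subset.chain ?\<A> \<C>"
    have graph: "derivation_graph G" "G1 \<subseteq> G" if "G \<in> \<C>" for G
      using chain that by (auto simp: subset.chain_def)
    have common: "\<exists>G\<in>\<C>. z \<in> G \<and> w \<in> G" if "z \<in> \<Union>\<C>" "w \<in> \<Union>\<C>" for z w
      using chain that unfolding subset.chain_def by blast
    have "derivation_graph (\<Union>\<C>)"
      unfolding derivation_graph_def
    proof (intro conjI allI impI)
      show "(1, 0) \<in> \<Union>\<C>"
        using ne graph derivation_graph_one by blast
    next
      fix x a y b
      assume "(x, a) \<in> \<Union>\<C>" "(y, b) \<in> \<Union>\<C>"
      then obtain G where "G \<in> \<C>" "(x, a) \<in> G" "(y, b) \<in> G"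
        using common by blast
      then show "(x - y, a - b) \<in> \<Union>\<C>" "(x * y, a * y + x * b) \<in> \<Union>\<C>"
        using derivation_graph_diff derivation_graph_mult graph by blast+
    next
      fix x a
      assume "(x, a) \<in> \<Union>\<C>"
      then show "(inverse x, - a * (inverse x)\<^sup>2) \<in> \<Union>\<C>"
        using derivation_graph_inverse graph by blast
    next
      fix a
      assume "(0, a) \<in> \<Union>\<C>"
      then show "a = 0"
        using derivation_graph_unique derivation_graph_zero graph by blast
    qed
    then show "\<Union>\<C> \<in> ?\<A>"
      using ne graph by blast
  qed
  then obtain G where "G \<in> ?\<A>" and max: "\<forall>H\<in>?\<A>. G \<subseteq> H \<longrightarrow> H = G"
    by (rule bexE)
  then have G: "derivation_graph G" "G1 \<subseteq> G"
    by simp_all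
  have "\<exists>a. (z, a) \<in> G" for z
  proof -
    obtain H where H: "derivation_graph H" "G \<subseteq> H" "z \<in> fst ` H"
      by (rule derivation_graph_extend_one[OF G(1)])
    then have "H = G"
      using max G(2) by blast
    then show ?thesis
      using H(3) by force
  qed
  then obtain D where DG: "\<And>z. (z, D z) \<in> G"
    by metis
  have D: "D z = a" if "(z, a) \<in> G" for z a
    using derivation_graph_unique[OF G(1)] that DG by blast
  show ?thesis
  proof
    show "derivation D"
      unfolding derivation_def
      by (auto intro!: D derivation_graph_add[OF G(1)] derivation_graph_mult[OF G(1)] DG)
    show "D a = 0" if "a \<in> M" for a
      using that G1(2) G(2) by (auto intro!: D simp: G0_def)
    show "D x = 1"
      using G1(3) G(2) by (auto intro!: D)
  qed
qed

section \<open>Linear algebra over a subfield\<close>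

definition lin_indep_over :: "'a::field set \<Rightarrow> 'i set \<Rightarrow> ('i \<Rightarrow> 'a) \<Rightarrow> bool" where
  "lin_indep_over k A v \<longleftrightarrow>
     (\<forall>B c. finite B \<longrightarrow> B \<subseteq> A \<longrightarrow> (\<forall>i\<in>B. c i \<in> k) \<longrightarrow> (\<Sum>i\<in>B. c i * v i) = 0 \<longrightarrow> (\<forall>i\<in>B. c i = 0))"

lemma lin_indep_overD:
  assumes "lin_indep_over k A v" "finite B" "B \<subseteq> A" "\<And>i. i \<in> B \<Longrightarrow> c i \<in> k"
    "(\<Sum>i\<in>B. c i * v i) = 0" "i \<in> B"
  shows "c i = 0"
  using assms unfolding lin_indep_over_def by blast

lemma lin_indep_over_finite:
  assumes "finite A" "0 \<in> k"
  shows "lin_indep_over k A v \<longleftrightarrow>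
    (\<forall>c. (\<forall>i\<in>A. c i \<in> k) \<longrightarrow> (\<Sum>i\<in>A. c i * v i) = 0 \<longrightarrow> (\<forall>i\<in>A. c i = 0))"
proof
  assume R: "\<forall>c. (\<forall>i\<in>A. c i \<in> k) \<longrightarrow> (\<Sum>i\<in>A. c i * v i) = 0 \<longrightarrow> (\<forall>i\<in>A. c i = 0)"
  show "lin_indep_over k A v"
    unfolding lin_indep_over_def
  proof (intro allI impI ballI)
    fix B c i
    assume B: "finite B" "B \<subseteq> A" and c: "\<forall>i\<in>B. c i \<in> k" "(\<Sum>i\<in>B. c i * v i) = 0" and i: "i \<in> B"
    define d where "d j = (if j \<in> B then c j else 0)" for j
    have "(\<Sum>j\<in>A. d j * v j) = (\<Sum>j\<in>B. d j * v j)"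
      using assms(1) B by (intro sum.mono_neutral_right) (auto simp: d_def)
    also have "\<dots> = 0"
      using c(2) by (simp add: d_def)
    finally have "(\<Sum>j\<in>A. d j * v j) = 0" .
    moreover have "\<forall>j\<in>A. d j \<in> k"
      using c(1) assms(2) by (simp add: d_def)
    ultimately have "\<forall>j\<in>A. d j = 0"
      using R by blast
    then show "c i = 0"
      using i B(2) by (force simp: d_def)
  qed
qed (use assms(1) in \<open>unfold lin_indep_over_def, blast\<close>)

lemma subfield_spanning_subset:
  assumes K: "is_subfield K" and A: "finite A"
  obtains J where "J \<subseteq> A" "lin_indep_over K J g"
    "\<And>m. m \<in> A \<Longrightarrow> \<exists>w. (\<forall>j\<in>J. w j \<in> K) \<and> g m = (\<Sum>j\<in>J. w j * g j)"
proof -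
  note zero = subfield_zero[OF K] and one = subfield_one[OF K]
  let ?S = "{J. J \<subseteq> A \<and> lin_indep_over K J g}"
  have "finite ?S"
    using A by simp
  moreover have "{} \<in> ?S"
    by (simp add: lin_indep_over_def)
  ultimately obtain J where J: "J \<in> ?S" and max: "\<forall>H\<in>?S. J \<subseteq> H \<longrightarrow> J = H"
    using finite_has_maximal[of ?S] by blast
  have fin: "finite J"
    using J A finite_subset by blast
  have "\<exists>w. (\<forall>j\<in>J. w j \<in> K) \<and> g m = (\<Sum>j\<in>J. w j * g j)" if m: "m \<in> A" for m
  proof (cases "m \<in> J")
    case True
    then have "g m = (\<Sum>j\<in>J. (if j = m then 1 else 0) * g j)"
      using fin by (simp add: if_distrib[of "\<lambda>x. x * _"] cong: if_cong)
    then show ?thesis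
      using zero one by (intro exI[of _ "\<lambda>j. if j = m then 1 else 0"]) auto
  next
    case False
    then have "\<not> lin_indep_over K (insert m J) g"
      using max J m by blast
    then obtain c where c: "\<forall>i\<in>insert m J. c i \<in> K" "(\<Sum>i\<in>insert m J. c i * g i) = 0"
      "\<exists>i\<in>insert m J. c i \<noteq> 0"
      using lin_indep_over_finite[of "insert m J" K g] fin zero by auto
    have rel: "c m * g m + (\<Sum>i\<in>J. c i * g i) = 0"
      using c(2) False fin by simp
    have "c m \<noteq> 0"
    proof
      assume "c m = 0"
      then have "(\<Sum>i\<in>J. c i * g i) = 0"
        using rel by simp
      then have "\<forall>i\<in>J. c i = 0"
        using J c(1) fin lin_indep_overD[of K J g J c] by blast
      then show False
        using c(3) \<open>c m = 0\<close> by blast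
    qed
    then have "g m = (\<Sum>j\<in>J. - c j / c m * g j)"
    proof -
      have "(\<Sum>j\<in>J. - c j / c m * g j) = - (\<Sum>j\<in>J. c j * g j) / c m"
        by (simp add: sum_divide_distrib sum_negf flip: sum_negf)
      also have "\<dots> = g m"
        using eq_neg_iff_add_eq_0[THEN iffD2, OF rel] \<open>c m \<noteq> 0\<close> by (simp add: field_simps)
      finally show ?thesis ..
    qed
    moreover have "\<forall>j\<in>J. - c j / c m \<in> K"
      using c(1) subfield_divide[OF K] subfield_uminus[OF K] by simp
    ultimately show ?thesis
      by (intro exI[of _ "\<lambda>j. - c j / c m"]) blast
  qed
  then show ?thesis
    using that J by blast
qed

lemma homogeneous_system_solvable:
  fixes N :: "'z \<Rightarrow> 'x \<Rightarrow> 'a::field"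
  assumes "finite X" "finite Z" "card X < card Z"
  shows "\<exists>a. (\<exists>z\<in>Z. a z \<noteq> 0) \<and> (\<forall>x\<in>X. (\<Sum>z\<in>Z. a z * N z x) = 0)"
  using assms
proof (induction X arbitrary: Z N rule: finite_induct)
  case empty
  then obtain z where "z \<in> Z"
    by fastforce
  then show ?case
    by (intro exI[of _ "\<lambda>_. 1"]) auto
next
  case (insert x X)
  show ?case
  proof (cases "\<forall>z\<in>Z. N z x = 0")
    case True
    obtain a where "\<exists>z\<in>Z. a z \<noteq> 0" "\<forall>y\<in>X. (\<Sum>z\<in>Z. a z * N z y) = 0"
      using insert.IH[of Z N] insert.prems insert.hyps by auto
    then show ?thesis
      using True by (intro exI[of _ a]) simp
  next
    case False
    then obtain z0 where z0: "z0 \<in> Z" "N z0 x \<noteq> 0"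
      by blast
    let ?Z = "Z - {z0}"
    have "card X < card ?Z"
      using insert.prems insert.hyps z0 by simp
    then obtain a where a: "\<exists>z\<in>?Z. a z \<noteq> 0"
      "\<forall>y\<in>X. (\<Sum>z\<in>?Z. a z * (N z y - N z x / N z0 x * N z0 y)) = 0"
      using insert.IH[of ?Z "\<lambda>z y. N z y - N z x / N z0 x * N z0 y"] insert.prems(1) by auto
    \<comment> \<open>the value of the unknown that was eliminated with the equation \<open>x\<close>\<close>
    define s where "s = - (\<Sum>z\<in>?Z. a z * N z x) / N z0 x"
    define b where "b z = (if z = z0 then s else a z)" for z
    have split: "(\<Sum>z\<in>Z. b z * N z y) = s * N z0 y + (\<Sum>z\<in>?Z. a z * N z y)" for y
      using insert.prems(1) z0(1) by (simp add: sum.remove[of Z z0] b_def)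
    have "(\<Sum>z\<in>Z. b z * N z x) = 0"
      using z0(2) by (simp add: split s_def)
    moreover have "(\<Sum>z\<in>Z. b z * N z y) = 0" if "y \<in> X" for y
    proof -
      have "s * N z0 y = - (\<Sum>z\<in>?Z. a z * (N z x / N z0 x * N z0 y))"
        by (simp add: s_def sum_distrib_left sum_distrib_right sum_divide_distrib mult_ac)
      then have "(\<Sum>z\<in>Z. b z * N z y) = (\<Sum>z\<in>?Z. a z * (N z y - N z x / N z0 x * N z0 y))"
        by (simp add: split right_diff_distrib sum_subtractf)
      then show ?thesis
        using a(2) that by simp
    qed
    ultimately show ?thesis
      using a(1) by (intro exI[of _ b]) (auto simp: b_def)
  qed
qed

section \<open>Linear disjointness\<close>

subsection \<open>Dual families of derivations\<close>

lemma derivation_scale: "derivation D \<Longrightarrow> derivation (\<lambda>w. a * D w)"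
  by (simp add: derivation_def algebra_simps)

lemma derivation_minus: "derivation D \<Longrightarrow> derivation D' \<Longrightarrow> derivation (\<lambda>w. D w - D' w)"
  by (simp add: derivation_def algebra_simps)

lemma derivation_combination:
  assumes "\<And>i. i \<in> I \<Longrightarrow> derivation (E i)"
  shows "derivation (\<lambda>w. \<Sum>i\<in>I. a i * E i w)"
  using assms
proof (induction I rule: infinite_finite_induct)
  case (insert i I)
  then have "derivation (\<lambda>w. a i * E i w)" "derivation (\<lambda>w. \<Sum>i\<in>I. a i * E i w)"
    by (simp_all add: derivation_scale)
  then show ?case
    using insert.hyps by (simp add: derivation_def algebra_simps)
qed (simp_all add: derivation_def)

definition dual_derivations :: "'a::field set \<Rightarrow> 'i set \<Rightarrow> ('i \<Rightarrow> 'a) \<Rightarrow> ('i \<Rightarrow> 'a \<Rightarrow> 'a) \<Rightarrow> bool" where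
  "dual_derivations F I x E \<longleftrightarrow> (\<forall>i\<in>I. derivation (E i) \<and> (\<forall>a\<in>F. E i a = 0) \<and>
     (\<forall>j\<in>I. E i (x j) = (if i = j then 1 else 0)))"

text \<open>
  The step of an orthogonalisation: normalise \<open>D\<close> at the new element and subtract multiples of it
  from the old derivations.
\<close>

lemma dual_derivations_insert:
  assumes E: "dual_derivations F I x E" and D: "derivation D" "\<And>a. a \<in> F \<Longrightarrow> D a = 0"
    "\<And>j. j \<in> I \<Longrightarrow> D (x j) = 0" "D (x i) \<noteq> 0"
  shows "\<exists>E. dual_derivations F (insert i I) x E"
proof -
  define D' where "D' w = inverse (D (x i)) * D w" for w
  have D': "derivation D'" "\<And>a. a \<in> F \<Longrightarrow> D' a = 0" "\<And>j. j \<in> I \<Longrightarrow> D' (x j) = 0" "D' (x i) = 1"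
    using D derivation_scale[OF D(1)] by (simp_all add: D'_def[abs_def])
  define E' where "E' j = (if j = i then D' else (\<lambda>w. E j w - E j (x i) * D' w))" for j
  have "derivation (E' j)" if "j \<in> insert i I" for j
    using that D'(1) E derivation_minus[OF _ derivation_scale[OF D'(1)]]
    by (auto simp: E'_def dual_derivations_def)
  moreover have "E' j a = 0" if "j \<in> insert i I" "a \<in> F" for j a
    using that D'(2) E by (auto simp: E'_def dual_derivations_def)
  moreover have "E' j (x l) = (if j = l then 1 else 0)" if "j \<in> insert i I" "l \<in> insert i I" for j l
    using that D'(3,4) D(3,4) E by (auto simp: E'_def dual_derivations_def)
  ultimately have "dual_derivations F (insert i I) x E'"
    unfolding dual_derivations_def by blast
  then show ?thesis
    by blast
qed

text \<open>
  This is Steinitz exchange: the derivations dual to \<open>z\<close> span a space of dimension \<open>card J\<close>, and a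
  combination of them that kills \<open>x\<close> also kills \<open>z\<close>, hence is trivial.
\<close>

lemma dual_derivations_exchange:
  assumes fin: "finite I" "finite J" and card: "card I \<le> card J"
    and E: "dual_derivations F J z E"
    and det: "\<And>D j. derivation D \<Longrightarrow> \<forall>a\<in>F. D a = 0 \<Longrightarrow> \<forall>i\<in>I. D (x i) = 0 \<Longrightarrow> j \<in> J \<Longrightarrow> D (z j) = 0"
  shows "\<exists>E. dual_derivations F I x E"
proof -
  let ?S = "{H. H \<subseteq> I \<and> (\<exists>E. dual_derivations F H x E)}"
  have "finite ?S"
    using fin by simp
  moreover have "{} \<in> ?S"
    by (simp add: dual_derivations_def)
  ultimately obtain H where H: "H \<in> ?S" and max: "\<forall>H'\<in>?S. H \<subseteq> H' \<longrightarrow> H = H'"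
    using finite_has_maximal[of ?S] by blast
  then obtain E' where E': "dual_derivations F H x E'"
    by blast
  have "H = I"
  proof (rule ccontr)
    assume "H \<noteq> I"
    then have "card H < card J"
      using H fin(1) card psubset_card_mono[of I H] by (auto simp: psubset_eq)
    moreover have "finite H"
      using H fin(1) finite_subset by blast
    ultimately have "\<exists>a. (\<exists>j\<in>J. a j \<noteq> 0) \<and> (\<forall>i\<in>H. (\<Sum>j\<in>J. a j * E j (x i)) = 0)"
      by (intro homogeneous_system_solvable fin(2))
    then obtain a where a: "\<exists>j\<in>J. a j \<noteq> 0" "\<forall>i\<in>H. (\<Sum>j\<in>J. a j * E j (x i)) = 0"
      by (elim exE conjE)
    define D where "D w = (\<Sum>j\<in>J. a j * E j w)" for w
    have D: "derivation D" "\<forall>b\<in>F. D b = 0"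
      using E derivation_combination[of J E a] by (auto simp: D_def[abs_def] dual_derivations_def)
    have DH: "D (x i) = 0" if "i \<in> H" for i
      using that a(2) by (simp add: D_def)
    have "D (x i) = 0" if "i \<in> I" for i
    proof (rule ccontr)
      assume nz: "D (x i) \<noteq> 0"
      then have "i \<notin> H"
        using DH by blast
      moreover have "insert i H \<in> ?S"
        using dual_derivations_insert[OF E' D(1) _ DH nz] D(2) H that by blast
      ultimately show False
        using max by blast
    qed
    then have "D (z j) = 0" if "j \<in> J" for j
      using det D that by blast
    moreover have "D (z j) = a j" if "j \<in> J" for j
    proof -
      have "D (z j) = (\<Sum>l\<in>J. if l = j then a l else 0)"
        unfolding D_def using E that by (intro sum.cong) (auto simp: dual_derivations_def)
      then show ?thesis
        using fin(2) that by simp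
    qed
    ultimately show False
      using a(1) by auto
  qed
  then show ?thesis
    using E' by blast
qed

subsection \<open>The criterion\<close>

text \<open>
  The derivations \<open>E\<close> kill \<open>F\<close>, map \<open>L\<close> to itself because \<open>L\<close> is algebraic over \<open>K(x)\<close>, and have
  constants \<open>K\<close> in \<open>L\<close>: a derivation \<open>D\<close> over \<open>K\<close> with \<open>D u = 1\<close> agrees on \<open>L\<close> with
  \<open>\<Sum> D(x\<^sub>i) E\<^sub>i\<close>, so an element \<open>u\<close> of \<open>L\<close> killed by all \<open>E\<^sub>i\<close> is algebraic over \<open>K\<close>. Applied to a
  shortest relation \<open>\<Sum> c\<^sub>j e\<^sub>j = 0\<close> normalised by \<open>c\<^sub>b = 1\<close>, the \<open>E\<^sub>i\<close> produce a shorter one, so all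
  \<open>c\<^sub>j\<close> are constants.
\<close>

theorem linearly_disjoint_criterion:
  fixes K F L :: "'a::field_char_0 set"
  assumes K: "is_subfield K" and KF: "K \<subseteq> F"
    and L: "L = is_subfield hull (K \<union> Y)" and M: "M = is_subfield hull (K \<union> x ` I)"
    and xL: "x ` I \<subseteq> L" and alg: "\<And>y. y \<in> Y \<Longrightarrow> alg_over M y"
    and fin: "finite I" and E: "dual_derivations F I x E"
    and closed: "\<And>u. u \<in> L \<Longrightarrow> alg_over K u \<Longrightarrow> u \<in> K"
    and e: "e ` A \<subseteq> F" "lin_indep_over K A e"
  shows "lin_indep_over L A e"
proof -
  have sL: "is_subfield L" and sM: "is_subfield M"
    by (auto simp: L M is_subfield_hull)
  have KL: "K \<subseteq> L" "Y \<subseteq> L"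
    using hull_subset[of "K \<union> Y" is_subfield] by (auto simp: L)
  have KM: "K \<subseteq> M"
    using hull_subset[of "K \<union> x ` I" is_subfield] by (auto simp: M)
  have M_sub_L: "M \<subseteq> L"
    unfolding M using xL KL(1) sL by (intro hull_minimal) auto
  have dE: "derivation (E i)" "\<And>a. a \<in> F \<Longrightarrow> E i a = 0" "\<And>j. j \<in> I \<Longrightarrow> E i (x j) = (if i = j then 1 else 0)"
    if "i \<in> I" for i
    using E that by (auto simp: dual_derivations_def)
  have stable: "E i u \<in> L" if i: "i \<in> I" and u: "u \<in> L" for i u
  proof -
    let ?S = "{u\<in>L. E i u \<in> L}"
    have sS: "is_subfield ?S"
      by (rule subfield_stable[OF dE(1)[OF i] sL])
    have K_S: "K \<subseteq> ?S"
      using KL(1) KF dE(2)[OF i] subfield_zero[OF sL] by auto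
    have "x ` I \<subseteq> ?S"
      using xL dE(3)[OF i] subfield_zero[OF sL] subfield_one[OF sL] by auto
    then have "M \<subseteq> ?S"
      unfolding M using K_S sS by (intro hull_minimal) auto
    then have "Y \<subseteq> ?S"
      using derivation_algebraic_mem[OF dE(1)[OF i] sM sL M_sub_L] KL(2) alg by blast
    then have "L \<subseteq> ?S"
      using K_S sS hull_minimal[of "K \<union> Y" ?S is_subfield] by (simp add: L)
    then show ?thesis
      using u by blast
  qed
  have const: "u \<in> K" if u: "u \<in> L" and Eu: "\<And>i. i \<in> I \<Longrightarrow> E i u = 0" for u
  proof (rule ccontr)
    assume "u \<notin> K"
    then have "\<not> alg_over K u"
      using closed u by blast
    then obtain D where D: "derivation D" "\<And>a. a \<in> K \<Longrightarrow> D a = 0" "D u = 1"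
      using transcendental_derivation[OF K] by metis
    define D' where "D' w = D w - (\<Sum>i\<in>I. D (x i) * E i w)" for w
    have D': "derivation D'"
      unfolding D'_def[abs_def] using dE(1) by (intro derivation_minus derivation_combination D(1)) auto
    note constants = subfield_of_constants[OF D']
    have D'K: "D' a = 0" if "a \<in> K" for a
    proof -
      have "(\<Sum>i\<in>I. D (x i) * E i a) = 0"
        using that KF dE(2) by (intro sum.neutral) auto
      then show ?thesis
        using D(2)[OF that] by (simp add: D'_def)
    qed
    have "D' (x j) = 0" if "j \<in> I" for j
    proof -
      have "(\<Sum>i\<in>I. D (x i) * E i (x j)) = (\<Sum>i\<in>I. if i = j then D (x i) else 0)"
        using that dE(3) by (intro sum.cong) auto
      then show ?thesis
        using fin that by (simp add: D'_def)
    qed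
    then have "M \<subseteq> {w. D' w = 0}"
      unfolding M using D'K constants by (intro hull_minimal) auto
    then have "D' y = 0" if "y \<in> Y" for y
      using derivation_algebraic_zero[OF D' sM _ alg[OF that]] by blast
    then have "L \<subseteq> {w. D' w = 0}"
      unfolding L using D'K constants by (intro hull_minimal) auto
    then have "D' u = 0"
      using u by blast
    then show False
      using D(3) Eu by (simp add: D'_def)
  qed
  have "\<forall>i\<in>B. c i = 0"
    if "finite B" "B \<subseteq> A" "\<forall>i\<in>B. c i \<in> L" "(\<Sum>i\<in>B. c i * e i) = 0" for B c
    using that
  proof (induction "card B" arbitrary: B c rule: less_induct)
    case less
    show ?case
    proof (rule ccontr)
      assume "\<not> (\<forall>i\<in>B. c i = 0)"
      then obtain b where b: "b \<in> B" "c b \<noteq> 0"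
        by blast
      define d where "d j = c j / c b" for j
      have dL: "d j \<in> L" if "j \<in> B" for j
        using less.prems(3) that b(1) subfield_divide[OF sL] by (simp add: d_def)
      have rel: "(\<Sum>j\<in>B. d j * e j) = 0"
        using less.prems(4) by (simp add: d_def sum_divide_distrib[symmetric])
      have "E i (d j) = 0" if i: "i \<in> I" and j: "j \<in> B" for i j
      proof -
        have "E i (d b) = 0"
          using b(2) derivation_one[OF dE(1)[OF i]] by (simp add: d_def)
        have "0 = E i (\<Sum>j\<in>B. d j * e j)"
          using rel derivation_zero[OF dE(1)[OF i]] by simp
        also have "\<dots> = (\<Sum>j\<in>B. E i (d j) * e j)"
          unfolding derivation_sum[OF dE(1)[OF i]]
        proof (rule sum.cong)
          fix j
          assume "j \<in> B"
          then have "E i (e j) = 0"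
            using less.prems(2) e(1) dE(2)[OF i] by blast
          then show "E i (d j * e j) = E i (d j) * e j"
            by (simp add: derivation_mult[OF dE(1)[OF i]])
        qed simp
        also have "\<dots> = (\<Sum>j\<in>B - {b}. E i (d j) * e j)"
          using less.prems(1) b(1) \<open>E i (d b) = 0\<close> by (simp add: sum.remove[of B b])
        finally have "\<forall>j\<in>B - {b}. E i (d j) = 0"
          using less.prems(1,2) b(1) dL stable[OF i] card_Diff1_less[of B b]
          by (intro less.hyps) auto
        then show ?thesis
          using j \<open>E i (d b) = 0\<close> by blast
      qed
      then have "\<forall>j\<in>B. d j \<in> K"
        using const dL by blast
      then have "d b = 0"
        using lin_indep_overD[OF e(2) less.prems(1,2) _ rel b(1)] by blast
      then show False
        using b(2) by (simp add: d_def)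
    qed
  qed
  then show ?thesis
    unfolding lin_indep_over_def by blast
qed

text \<open>
  Expanding the coefficients of an \<open>F\<close>-linear relation in a \<open>K\<close>-basis splits it into \<open>K\<close>-linear
  relations.
\<close>

lemma relation_descent:
  assumes K: "is_subfield K" and A: "finite A"
    and disj: "\<And>J. J \<subseteq> A \<Longrightarrow> lin_indep_over K J g \<Longrightarrow> lin_indep_over L J g"
    and L: "is_subfield L" "K \<subseteq> L" and v: "\<And>m. m \<in> A \<Longrightarrow> v m \<in> L"
    and rel: "(\<Sum>m\<in>A. g m * v m) = 0"
  obtains J w where "J \<subseteq> A" "\<And>j m. j \<in> J \<Longrightarrow> m \<in> A \<Longrightarrow> w j m \<in> K"
    "\<And>m. m \<in> A \<Longrightarrow> g m = (\<Sum>j\<in>J. g j * w j m)"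
    "\<And>j. j \<in> J \<Longrightarrow> (\<Sum>m\<in>A. w j m * v m) = 0"
proof -
  obtain J where J: "J \<subseteq> A" "lin_indep_over K J g"
    "\<And>m. m \<in> A \<Longrightarrow> \<exists>w. (\<forall>j\<in>J. w j \<in> K) \<and> g m = (\<Sum>j\<in>J. w j * g j)"
    by (rule subfield_spanning_subset[OF K A, of g]) (rule that)
  then obtain w where w: "\<And>m. m \<in> A \<Longrightarrow> (\<forall>j\<in>J. w m j \<in> K) \<and> g m = (\<Sum>j\<in>J. w m j * g j)"
    by metis
  have "(\<Sum>j\<in>J. (\<Sum>m\<in>A. w m j * v m) * g j) = (\<Sum>j\<in>J. \<Sum>m\<in>A. w m j * g j * v m)"
    by (simp add: sum_distrib_right sum_distrib_left mult_ac)
  also have "\<dots> = (\<Sum>m\<in>A. (\<Sum>j\<in>J. w m j * g j) * v m)"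
    by (subst sum.swap) (simp add: sum_distrib_right)
  also have "\<dots> = 0"
    using rel w by simp
  finally have "(\<Sum>m\<in>A. w m j * v m) = 0" if "j \<in> J" for j
    using lin_indep_overD[OF disj[OF J(1,2)], of J "\<lambda>j. \<Sum>m\<in>A. w m j * v m" j]
      that finite_subset[OF J(1) A] w v L
    by (auto intro!: subfield_sum subfield_mult)
  then show ?thesis
    using that[of J "\<lambda>j m. w m j"] J(1) w by (auto simp: mult.commute)
qed

section \<open>Algebraic independence and derivations\<close>

subsection \<open>Monomials\<close>

abbreviation "keys \<equiv> Poly_Mapping.keys"
abbreviation "lookup \<equiv> Poly_Mapping.lookup"
abbreviation "single \<equiv> Poly_Mapping.single"

definition mon :: "('v \<Rightarrow> 'a::comm_ring_1) \<Rightarrow> ('v \<Rightarrow>\<^sub>0 nat) \<Rightarrow> 'a" where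
  "mon f m = (\<Prod>i\<in>keys m. f i ^ lookup m i)"

definition mdeg :: "('v \<Rightarrow>\<^sub>0 nat) \<Rightarrow> nat" where
  "mdeg m = (\<Sum>i\<in>keys m. lookup m i)"

lemma mon_superset:
  "finite A \<Longrightarrow> keys m \<subseteq> A \<Longrightarrow> mon f m = (\<Prod>i\<in>A. f i ^ lookup m i)"
  unfolding mon_def by (rule prod.mono_neutral_left) (auto simp: in_keys_iff)

lemma mdeg_superset:
  "finite A \<Longrightarrow> keys m \<subseteq> A \<Longrightarrow> mdeg m = (\<Sum>i\<in>A. lookup m i)"
  unfolding mdeg_def by (rule sum.mono_neutral_left) (auto simp: in_keys_iff)

lemma mon_zero [simp]: "mon f 0 = 1"
  by (simp add: mon_def)

lemma mdeg_zero [simp]: "mdeg 0 = 0"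
  by (simp add: mdeg_def)

lemma mon_single [simp]: "mon f (single i e) = f i ^ e"
  by (simp add: mon_def)

lemma mdeg_single [simp]: "mdeg (single i e) = e"
  by (simp add: mdeg_def)

lemma mon_add: "mon f (m + m') = mon f m * mon f m'"
proof -
  let ?A = "keys m \<union> keys m'"
  show ?thesis
    using keys_add[of m m']
    by (simp add: mon_superset[of ?A] lookup_add power_add prod.distrib)
qed

lemma mdeg_add: "mdeg (m + m') = mdeg m + mdeg m'"
proof -
  let ?A = "keys m \<union> keys m'"
  show ?thesis
    using keys_add[of m m']
    by (simp add: mdeg_superset[of ?A] lookup_add sum.distrib)
qed

lemma mon_scale: "mon (\<lambda>i. f i / u) m = mon f m / u ^ mdeg m" for u :: "'a::field"
  by (simp add: mon_def mdeg_def power_divide prod_dividef power_sum)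

lemma mpoly_eval_mon: "mpoly_eval f P = (\<Sum>m\<in>keys P. lookup P m * mon f m)"
  by (simp add: mpoly_eval_def mon_def)

lemma homogeneous_mdeg: "homogeneous d P \<longleftrightarrow> (\<forall>m\<in>keys P. mdeg m = d)"
  by (simp add: homogeneous_def mdeg_def)

definition mpoly_of :: "('v \<Rightarrow>\<^sub>0 nat) set \<Rightarrow> (('v \<Rightarrow>\<^sub>0 nat) \<Rightarrow> 'a) \<Rightarrow> ('v, 'a::zero) mpoly" where
  "mpoly_of A c = Abs_poly_mapping (\<lambda>m. if m \<in> A then c m else 0)"

lemma lookup_mpoly_of:
  assumes "finite A"
  shows "lookup (mpoly_of A c) m = (if m \<in> A then c m else 0)"
proof -
  have "finite {m. (if m \<in> A then c m else 0) \<noteq> 0}"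
    by (rule finite_subset[OF _ assms]) auto
  then show ?thesis
    by (simp add: mpoly_of_def)
qed

lemma keys_mpoly_of: "finite A \<Longrightarrow> keys (mpoly_of A c) \<subseteq> A"
  by (auto simp: in_keys_iff lookup_mpoly_of split: if_splits)

lemma mpoly_eval_superset:
  assumes "finite A" "keys P \<subseteq> A"
  shows "mpoly_eval f P = (\<Sum>m\<in>A. lookup P m * mon f m)"
  unfolding mpoly_eval_mon using assms by (intro sum.mono_neutral_left) (auto simp: in_keys_iff)

lemma mpoly_eval_mpoly_of:
  assumes "finite A"
  shows "mpoly_eval f (mpoly_of A c) = (\<Sum>m\<in>A. c m * mon f m)"
  using assms by (simp add: mpoly_eval_superset[OF assms keys_mpoly_of[OF assms]] lookup_mpoly_of)

lemma mpoly_of_in_mpoly_ring: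
  assumes "finite A" "\<And>m. m \<in> A \<Longrightarrow> keys m \<subseteq> I" "\<And>m. m \<in> A \<Longrightarrow> c m \<in> k" "0 \<in> k"
  shows "mpoly_of A c \<in> mpoly_ring k I"
  using assms keys_mpoly_of[OF assms(1), of c] by (auto simp: mpoly_ring_def lookup_mpoly_of)

lemma lin_indep_over_mon_iff:
  assumes "0 \<in> k"
  shows "lin_indep_over k {m. keys m \<subseteq> I \<and> S m} (mon f) \<longleftrightarrow>
    (\<forall>P\<in>poly_relations k I f. (\<forall>m\<in>keys P. S m) \<longrightarrow> P = 0)"
proof
  assume L: "lin_indep_over k {m. keys m \<subseteq> I \<and> S m} (mon f)"
  show "\<forall>P\<in>poly_relations k I f. (\<forall>m\<in>keys P. S m) \<longrightarrow> P = 0"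
  proof (intro ballI impI)
    fix P
    assume P: "P \<in> poly_relations k I f" "\<forall>m\<in>keys P. S m"
    have "lookup P m = 0" if "m \<in> keys P" for m
      using P that
      by (intro lin_indep_overD[OF L, of "keys P" "lookup P"])
        (auto simp: poly_relations_def mpoly_ring_def mpoly_eval_mon)
    then show "P = 0"
      by (intro poly_mapping_eqI) (metis in_keys_iff lookup_zero)
  qed
next
  assume R: "\<forall>P\<in>poly_relations k I f. (\<forall>m\<in>keys P. S m) \<longrightarrow> P = 0"
  show "lin_indep_over k {m. keys m \<subseteq> I \<and> S m} (mon f)"
    unfolding lin_indep_over_def
  proof (intro allI impI ballI)
    fix B c m
    assume B: "finite B" "B \<subseteq> {m. keys m \<subseteq> I \<and> S m}"
      and c: "\<forall>m\<in>B. c m \<in> k" "(\<Sum>m\<in>B. c m * mon f m) = 0" and m: "m \<in> B"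
    have "mpoly_of B c \<in> poly_relations k I f"
      using B c assms by (auto simp: poly_relations_def mpoly_eval_mpoly_of intro!: mpoly_of_in_mpoly_ring)
    moreover have "\<forall>m\<in>keys (mpoly_of B c). S m"
      using B keys_mpoly_of[OF B(1), of c] by blast
    ultimately have "mpoly_of B c = 0"
      using R by blast
    then show "c m = 0"
      using lookup_mpoly_of[OF B(1), of c m] m by simp
  qed
qed

lemma alg_indep_iff:
  assumes "0 \<in> k"
  shows "alg_indep k I f \<longleftrightarrow> lin_indep_over k {m. keys m \<subseteq> I} (mon f)"
  using lin_indep_over_mon_iff[OF assms, of I "\<lambda>_. True" f] by (simp add: alg_indep_def)

lemma hom_alg_indep_iff:
  assumes "0 \<in> k"
  shows "hom_alg_indep k I f \<longleftrightarrow>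
    (\<forall>d. lin_indep_over k {m. keys m \<subseteq> I \<and> mdeg m = d} (mon f))"
  unfolding hom_alg_indep_def homogeneous_mdeg
  using lin_indep_over_mon_iff[OF assms, of I "\<lambda>m. mdeg m = _" f] by blast

lemma lin_indep_over_reindex:
  assumes L: "lin_indep_over k A v" and S: "finite S" "inj_on \<phi> S" "\<phi> ` S \<subseteq> A"
    and c: "\<And>s. s \<in> S \<Longrightarrow> c s \<in> k" "(\<Sum>s\<in>S. c s * v (\<phi> s)) = 0" and s: "s \<in> S"
  shows "c s = 0"
proof -
  define d where "d m = c (the_inv_into S \<phi> m)" for m
  have d: "d (\<phi> s) = c s" if "s \<in> S" for s
    using that S(2) by (simp add: d_def the_inv_into_f_f)
  have "(\<Sum>m\<in>\<phi> ` S. d m * v m) = 0"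
    using S(2) c(2) d by (simp add: sum.reindex)
  then have "d (\<phi> s) = 0"
    using S s c(1) d by (intro lin_indep_overD[OF L, of "\<phi> ` S" d]) auto
  then show ?thesis
    using d s by simp
qed

subsection \<open>Rings and fields generated by a family\<close>

context
  fixes k :: "'a::field set" and I :: "'v set" and f :: "'v \<Rightarrow> 'a"
  assumes k: "is_subfield k"
begin

lemma adjoin_ringI:
  assumes "finite A" "\<And>m. m \<in> A \<Longrightarrow> keys m \<subseteq> I" "\<And>m. m \<in> A \<Longrightarrow> c m \<in> k"
  shows "(\<Sum>m\<in>A. c m * mon f m) \<in> adjoin_ring k I f"
  unfolding adjoin_ring_def
  by (rule image_eqI[where x = "mpoly_of A c"])
    (simp_all add: mpoly_eval_mpoly_of mpoly_of_in_mpoly_ring assms subfield_zero[OF k])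

lemma adjoin_ringE:
  assumes "x \<in> adjoin_ring k I f"
  obtains A c where "finite A" "\<And>m. m \<in> A \<Longrightarrow> keys m \<subseteq> I" "\<And>m. c m \<in> k"
    "x = (\<Sum>m\<in>A. c m * mon f m)"
proof -
  obtain P where "P \<in> mpoly_ring k I" "x = mpoly_eval f P"
    using assms by (auto simp: adjoin_ring_def)
  then show ?thesis
    using that[of "keys P" "lookup P"]
    by (auto simp: mpoly_ring_def mpoly_eval_mon)
qed

lemma adjoin_ring_mon:
  assumes "keys m \<subseteq> I" "a \<in> k"
  shows "a * mon f m \<in> adjoin_ring k I f"
  using adjoin_ringI[of "{m}" "\<lambda>_. a"] assms by simp

lemma adjoin_ring_coeff: "a \<in> k \<Longrightarrow> a \<in> adjoin_ring k I f"
  using adjoin_ring_mon[of 0 a] by simp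

lemma adjoin_ring_gen: "i \<in> I \<Longrightarrow> f i \<in> adjoin_ring k I f"
  using adjoin_ring_mon[of "single i 1" 1] subfield_one[OF k] by simp

lemma adjoin_ring_add:
  assumes "x \<in> adjoin_ring k I f" "y \<in> adjoin_ring k I f"
  shows "x + y \<in> adjoin_ring k I f"
proof -
  obtain P Q where P: "P \<in> mpoly_ring k I" "x = mpoly_eval f P" and Q: "Q \<in> mpoly_ring k I" "y = mpoly_eval f Q"
    using assms by (auto simp: adjoin_ring_def)
  let ?A = "keys P \<union> keys Q"
  have "x + y = (\<Sum>m\<in>?A. (lookup P m + lookup Q m) * mon f m)"
    by (simp add: P Q mpoly_eval_superset[of ?A] ring_distribs sum.distrib)
  also have "\<dots> \<in> adjoin_ring k I f"
    using P Q by (intro adjoin_ringI) (auto simp: mpoly_ring_def intro: subfield_add[OF k])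
  finally show ?thesis .
qed

lemma adjoin_ring_sum: "(\<And>i. i \<in> B \<Longrightarrow> g i \<in> adjoin_ring k I f) \<Longrightarrow> sum g B \<in> adjoin_ring k I f"
  by (induction B rule: infinite_finite_induct)
    (auto intro: adjoin_ring_add adjoin_ring_coeff subfield_zero[OF k])

lemma adjoin_ring_mult:
  assumes "x \<in> adjoin_ring k I f" "y \<in> adjoin_ring k I f"
  shows "x * y \<in> adjoin_ring k I f"
proof -
  obtain A c where A: "\<And>m. m \<in> A \<Longrightarrow> keys m \<subseteq> I" "\<And>m. c m \<in> k" "x = (\<Sum>m\<in>A. c m * mon f m)"
    using adjoin_ringE[OF assms(1)] by metis
  obtain B d where B: "\<And>m. m \<in> B \<Longrightarrow> keys m \<subseteq> I" "\<And>m. d m \<in> k" "y = (\<Sum>m\<in>B. d m * mon f m)"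
    using adjoin_ringE[OF assms(2)] by metis
  have "x * y = (\<Sum>m\<in>A. \<Sum>m'\<in>B. c m * d m' * mon f (m + m'))"
    by (simp add: A(3) B(3) sum_product mon_add mult_ac)
  moreover have "c m * d m' * mon f (m + m') \<in> adjoin_ring k I f" if "m \<in> A" "m' \<in> B" for m m'
    using that A(1,2) B(1,2) keys_add[of m m'] by (intro adjoin_ring_mon subfield_mult[OF k]) blast
  ultimately show ?thesis
    by (auto intro!: adjoin_ring_sum)
qed

lemma is_subfield_adjoin_field: "is_subfield (adjoin_field k I f)"
  unfolding adjoin_field_def
proof (rule is_subfield_fractions)
  show "x - y \<in> adjoin_ring k I f" if "x \<in> adjoin_ring k I f" "y \<in> adjoin_ring k I f" for x y
  proof -
    have "- 1 \<in> adjoin_ring k I f"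
      by (intro adjoin_ring_coeff subfield_uminus[OF k] subfield_one[OF k])
    then show ?thesis
      using adjoin_ring_add[OF that(1) adjoin_ring_mult[OF _ that(2)]] by fastforce
  qed
qed (auto intro: adjoin_ring_coeff subfield_one[OF k] adjoin_ring_mult)

lemma adjoin_field_eq_hull: "adjoin_field k I f = is_subfield hull (k \<union> f ` I)"
proof
  let ?H = "is_subfield hull (k \<union> f ` I)"
  have H: "is_subfield ?H" and sub: "k \<union> f ` I \<subseteq> ?H"
    by (rule is_subfield_hull, rule hull_subset)
  have "x \<in> ?H" if x: "x \<in> adjoin_ring k I f" for x
  proof -
    obtain A c where A: "\<And>m. m \<in> A \<Longrightarrow> keys m \<subseteq> I" "\<And>m. c m \<in> k" "x = (\<Sum>m\<in>A. c m * mon f m)"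
      using adjoin_ringE[OF x] by metis
    have "mon f m \<in> ?H" if "m \<in> A" for m
      unfolding mon_def using A(1)[OF that] sub by (intro subfield_prod[OF H] subfield_power[OF H]) auto
    moreover have "c m \<in> ?H" for m
      using A(2) sub by blast
    ultimately show ?thesis
      unfolding A(3) by (intro subfield_sum[OF H] subfield_mult[OF H])
  qed
  then show "adjoin_field k I f \<subseteq> ?H"
    by (auto simp: adjoin_field_def intro!: subfield_divide[OF H])
next
  have "x \<in> adjoin_field k I f" if "x \<in> adjoin_ring k I f" for x
    using that adjoin_ring_coeff[OF subfield_one[OF k]] unfolding adjoin_field_def by force
  then have "k \<union> f ` I \<subseteq> adjoin_field k I f"
    using adjoin_ring_coeff adjoin_ring_gen by blast
  then show "is_subfield hull (k \<union> f ` I) \<subseteq> adjoin_field k I f"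
    using is_subfield_adjoin_field by (rule hull_minimal)
qed

end

subsection \<open>Algebraic independence in terms of algebraic elements\<close>

lemma keys_diff_single:
  "keys (m - single i (lookup m i)) = keys m - {i}"
  for m :: "'v \<Rightarrow>\<^sub>0 nat"
  by (auto simp: in_keys_iff lookup_minus lookup_single when_def split: if_splits)

lemma split_variable:
  "m = (m - single i (lookup m i)) + single i (lookup m i)"
  for m :: "'v \<Rightarrow>\<^sub>0 nat"
  by (rule poly_mapping_eqI) (simp add: lookup_add lookup_minus lookup_single when_def)

text \<open>
  Clearing denominators in an equation for \<open>f\<^sub>i\<close> gives coefficients that are polynomials in the other
  members; the monomials of these, multiplied by the powers of \<open>f\<^sub>i\<close>, are pairwise distinct, so the
  equation is a nontrivial polynomial relation.
\<close>

lemma alg_indep_insert_imp_transcendental: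
  fixes f :: "'v \<Rightarrow> 'a::field"
  assumes k: "is_subfield k" and ind: "alg_indep k (insert i I) f" and i: "i \<notin> I"
  shows "\<not> alg_over (is_subfield hull (k \<union> f ` I)) (f i)"
proof
  assume "alg_over (is_subfield hull (k \<union> f ` I)) (f i)"
  then obtain p where p: "p \<noteq> 0" "\<And>e. coeff p e \<in> adjoin_field k I f" "poly p (f i) = 0"
    unfolding alg_over_def adjoin_field_eq_hull[OF k, of I f, symmetric] by blast
  let ?R = "adjoin_ring k I f"
  have "\<exists>d\<in>?R. d \<noteq> 0 \<and> (\<forall>s\<in>coeff p ` {..degree p}. \<exists>a\<in>?R. d * s = a)"
    using p(2) by (intro common_denominator)
      (auto simp: adjoin_field_def intro: adjoin_ring_coeff adjoin_ring_mult subfield_one k)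
  then obtain d where d: "d \<noteq> 0" "\<And>s. s \<in> coeff p ` {..degree p} \<Longrightarrow> d * s \<in> ?R"
    by blast
  have "\<exists>Q\<in>mpoly_ring k I. d * coeff p e = mpoly_eval f Q" if "e \<le> degree p" for e
    using d(2) that by (auto simp: adjoin_ring_def)
  then obtain Q where Q: "\<And>e. e \<le> degree p \<Longrightarrow> Q e \<in> mpoly_ring k I"
    "\<And>e. e \<le> degree p \<Longrightarrow> d * coeff p e = mpoly_eval f (Q e)"
    by metis
  define S where "S = Sigma {..degree p} (\<lambda>e. keys (Q e))"
  define \<phi> where "\<phi> = (\<lambda>(e :: nat, m). m + single i e)"
  have mI: "keys m \<subseteq> I" if "(e, m) \<in> S" for e m
    using that Q(1) by (auto simp: S_def mpoly_ring_def)
  have inj: "inj_on \<phi> S"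
  proof (rule inj_onI)
    fix s t
    assume st: "s \<in> S" "t \<in> S" "\<phi> s = \<phi> t"
    obtain e m where s: "s = (e, m)"
      by (cases s)
    obtain e' m' where t: "t = (e', m')"
      by (cases t)
    have eq: "m + single i e = m' + single i e'"
      using st(3) by (simp add: \<phi>_def s t)
    have "lookup m i = 0" "lookup m' i = 0"
      using mI[of e m] mI[of e' m'] st i by (auto simp: s t in_keys_iff)
    then have "e = e'"
      using arg_cong[OF eq, of "\<lambda>x. lookup x i"] by (simp add: lookup_add)
    then show "s = t"
      using eq by (simp add: s t)
  qed
  have "(\<Sum>s\<in>S. lookup (Q (fst s)) (snd s) * mon f (\<phi> s))
      = (\<Sum>e\<le>degree p. \<Sum>m\<in>keys (Q e). lookup (Q e) m * mon f m * f i ^ e)"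
    by (simp add: S_def \<phi>_def sum.Sigma case_prod_unfold mon_add mult_ac)
  also have "\<dots> = (\<Sum>e\<le>degree p. d * coeff p e * f i ^ e)"
    using Q(2) by (intro sum.cong) (simp_all add: mpoly_eval_mon sum_distrib_right)
  also have "\<dots> = d * poly p (f i)"
    by (simp add: poly_altdef sum_distrib_left mult_ac)
  finally have rel: "(\<Sum>s\<in>S. lookup (Q (fst s)) (snd s) * mon f (\<phi> s)) = 0"
    using p(3) by simp
  have zero: "lookup (Q (fst s)) (snd s) = 0" if "s \<in> S" for s
  proof (rule lin_indep_over_reindex[OF _ _ inj _ _ rel that])
    show "lin_indep_over k {m. keys m \<subseteq> insert i I} (mon f)"
      using ind by (simp add: alg_indep_iff subfield_zero[OF k])
    show "finite S"
      by (simp add: S_def)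
    show "\<phi> ` S \<subseteq> {m. keys m \<subseteq> insert i I}"
    proof safe
      fix e m x
      assume "(e, m) \<in> S" "x \<in> keys (\<phi> (e, m))" "x \<notin> I"
      then show "x = i"
        using mI[of e m] keys_add[of m "single i e"]
        by (auto simp: \<phi>_def split: if_splits)
    qed
    show "\<And>s. s \<in> S \<Longrightarrow> lookup (Q (fst s)) (snd s) \<in> k"
      using Q(1) by (auto simp: S_def mpoly_ring_def)
  qed
  have "keys (Q (degree p)) = {}"
  proof (rule equals0I)
    fix m
    assume m: "m \<in> keys (Q (degree p))"
    then have "(degree p, m) \<in> S"
      by (simp add: S_def)
    from zero[OF this] m show False
      by (simp add: in_keys_iff)
  qed
  then have "d * lead_coeff p = 0"
    using Q(2)[of "degree p"] by (simp add: mpoly_eval_mon)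
  then show False
    using d(1) p(1) by simp
qed

text \<open>
  Sort a polynomial relation by the powers of \<open>f\<^sub>i\<close>; a coefficient that is nonzero as a polynomial in
  the other members is nonzero as an element, by their independence.
\<close>

lemma not_alg_indep_insert_imp_algebraic:
  fixes f :: "'v \<Rightarrow> 'a::field"
  assumes k: "is_subfield k" and ind: "alg_indep k I f" and dep: "\<not> alg_indep k (insert i I) f"
  shows "alg_over (is_subfield hull (k \<union> f ` I)) (f i)"
proof -
  let ?H = "is_subfield hull (k \<union> f ` I)"
  note zero = subfield_zero[OF k]
  have H: "is_subfield ?H" and kH: "k \<subseteq> ?H" "f ` I \<subseteq> ?H"
    using is_subfield_hull hull_subset[of "k \<union> f ` I" is_subfield] by auto
  obtain B c m0 where B: "finite B" "\<And>m. m \<in> B \<Longrightarrow> keys m \<subseteq> insert i I"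
    and c: "\<And>m. m \<in> B \<Longrightarrow> c m \<in> k" "(\<Sum>m\<in>B. c m * mon f m) = 0" and m0: "m0 \<in> B" "c m0 \<noteq> 0"
    using dep unfolding alg_indep_iff[OF zero] lin_indep_over_def by blast
  define s where "s m = m - single i (lookup m i)" for m :: "'v \<Rightarrow>\<^sub>0 nat"
  have keys_s: "keys (s m) \<subseteq> I" if "m \<in> B" for m
    using B(2)[OF that] by (auto simp: s_def keys_diff_single)
  have mon_s: "mon f m = mon f (s m) * f i ^ lookup m i" for m
    by (subst split_variable[of m i]) (simp only: mon_add s_def mon_single)
  define p where "p = (\<Sum>m\<in>B. monom (c m * mon f (s m)) (lookup m i))"
  have coeff_p: "coeff p e = (\<Sum>m\<in>{m\<in>B. lookup m i = e}. c m * mon f (s m))" for e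
    using B(1) by (simp add: p_def coeff_sum sum.If_cases Int_def)
  have "poly p (f i) = 0"
    using c(2) by (simp add: p_def poly_sum poly_monom mult.assoc flip: mon_s)
  moreover have "coeff p e \<in> ?H" for e
  proof -
    have "mon f (s m) \<in> ?H" if "m \<in> B" for m
      unfolding mon_def using keys_s[OF that] kH
      by (intro subfield_prod[OF H] subfield_power[OF H]) auto
    then show ?thesis
      unfolding coeff_p using c(1) kH by (intro subfield_sum[OF H] subfield_mult[OF H]) auto
  qed
  moreover have "p \<noteq> 0"
  proof
    assume "p = 0"
    let ?B = "{m\<in>B. lookup m i = lookup m0 i}"
    have rel: "(\<Sum>m\<in>?B. c m * mon f (s m)) = 0"
      using coeff_p[of "lookup m0 i"] \<open>p = 0\<close> by simp
    have "c m0 = 0"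
    proof (rule lin_indep_over_reindex[where c = c and v = "mon f" and \<phi> = s and S = ?B])
      show "(\<Sum>m\<in>?B. c m * mon f (s m)) = 0"
        by (rule rel)
      show "lin_indep_over k {m. keys m \<subseteq> I} (mon f)"
        using ind by (simp add: alg_indep_iff[OF zero])
      show "inj_on s ?B"
      proof (rule inj_onI)
        fix m m'
        assume "m \<in> ?B" "m' \<in> ?B" "s m = s m'"
        then show "m = m'"
          by (metis (mono_tags, lifting) mem_Collect_eq s_def split_variable)
      qed
    qed (use B(1) keys_s c(1) m0 in auto)
    then show False
      using m0(2) by simp
  qed
  ultimately show ?thesis
    unfolding alg_over_def by blast
qed

lemma alg_indep_empty:
  assumes "is_subfield k"
  shows "alg_indep k {} f"
proof -
  have "{m :: 'v \<Rightarrow>\<^sub>0 nat. keys m \<subseteq> {}} = {0}"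
    by auto
  moreover have "lin_indep_over k {0} (mon f)"
    by (subst lin_indep_over_finite) (auto simp: subfield_zero[OF assms])
  ultimately show ?thesis
    by (simp add: alg_indep_iff[OF subfield_zero[OF assms]])
qed

lemma transcendence_basis_exists:
  assumes k: "is_subfield k" and "finite N"
  obtains J where "J \<subseteq> N" "alg_indep k J f"
    "\<And>i. i \<in> N \<Longrightarrow> alg_over (is_subfield hull (k \<union> f ` J)) (f i)"
proof -
  let ?S = "{J. J \<subseteq> N \<and> alg_indep k J f}"
  have "finite ?S" "{} \<in> ?S"
    using assms(2) alg_indep_empty[OF k] by auto
  then obtain J where J: "J \<in> ?S" and max: "\<forall>H\<in>?S. J \<subseteq> H \<longrightarrow> J = H"
    using finite_has_maximal[of ?S] by blast
  have "alg_over (is_subfield hull (k \<union> f ` J)) (f i)" if "i \<in> N" for i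
  proof (cases "i \<in> J")
    case True
    then show ?thesis
      using hull_subset[of "k \<union> f ` J" is_subfield] by (intro alg_over_self is_subfield_hull) blast
  next
    case False
    then have "\<not> alg_indep k (insert i J) f"
      using J max that by blast
    then show ?thesis
      using not_alg_indep_insert_imp_algebraic[OF k, of J f i] J by blast
  qed
  then show ?thesis
    using that J by blast
qed

text \<open>
  The Jacobian criterion. Each member of an independent family is transcendental over the field
  generated by the others, which yields its dual derivation. Conversely, a member that is algebraic
  over a part of the family is killed by every derivation that kills this part.
\<close>

theorem alg_indep_iff_dual_derivations:
  fixes f :: "'v \<Rightarrow> 'a::field_char_0"
  assumes k: "is_subfield k" and fin: "finite I"
  shows "alg_indep k I f \<longleftrightarrow> (\<exists>E. dual_derivations k I f E)"
proof
  assume ind: "alg_indep k I f"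
  have "\<exists>D. derivation D \<and> (\<forall>a\<in>k. D a = 0) \<and> (\<forall>j\<in>I. D (f j) = (if i = j then 1 else 0))"
    if i: "i \<in> I" for i
  proof -
    let ?H = "is_subfield hull (k \<union> f ` (I - {i}))"
    have "\<not> alg_over ?H (f i)"
      using alg_indep_insert_imp_transcendental[OF k, of i "I - {i}" f] ind i by (simp add: insert_absorb)
    then obtain D where D: "derivation D" "\<And>a. a \<in> ?H \<Longrightarrow> D a = 0" "D (f i) = 1"
      using transcendental_derivation[OF is_subfield_hull] by metis
    have "k \<union> f ` (I - {i}) \<subseteq> ?H"
      by (rule hull_subset)
    then show ?thesis
      using D by (intro exI[of _ D]) auto
  qed
  then obtain E where "\<And>i. i \<in> I \<Longrightarrow> derivation (E i) \<and> (\<forall>a\<in>k. E i a = 0) \<and>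
      (\<forall>j\<in>I. E i (f j) = (if i = j then 1 else 0))"
    by metis
  then show "\<exists>E. dual_derivations k I f E"
    unfolding dual_derivations_def by blast
next
  assume "\<exists>E. dual_derivations k I f E"
  then obtain E where E: "dual_derivations k I f E" ..
  obtain J where J: "J \<subseteq> I" "alg_indep k J f"
    "\<And>i. i \<in> I \<Longrightarrow> alg_over (is_subfield hull (k \<union> f ` J)) (f i)"
    by (rule transcendence_basis_exists[OF k fin, of f]) (rule that)
  have "J = I"
  proof (rule ccontr)
    assume "J \<noteq> I"
    then obtain i where i: "i \<in> I" "i \<notin> J"
      using J(1) by blast
    then have D: "derivation (E i)" and "k \<union> f ` J \<subseteq> {x. E i x = 0}"
      using E J(1) by (auto simp: dual_derivations_def)
    then have "is_subfield hull (k \<union> f ` J) \<subseteq> {x. E i x = 0}"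
      using subfield_of_constants by (intro hull_minimal)
    then have "E i (f i) = 0"
      using derivation_algebraic_zero[OF D is_subfield_hull _ J(3)[OF i(1)]] by blast
    then show False
      using E i(1) by (simp add: dual_derivations_def)
  qed
  then show "alg_indep k I f"
    using J(2) by simp
qed

text \<open>
  The transcendence degree refers to sets of elements instead of families. Dual derivations make the
  passage immediate, since they do not see the indexing.
\<close>

lemma alg_indep_image:
  fixes f :: "'v \<Rightarrow> 'a::field_char_0"
  assumes k: "is_subfield k" and fin: "finite J" and ind: "alg_indep k J f"
  shows "alg_indep k (f ` J) (\<lambda>x. x)" "inj_on f J"
proof -
  obtain E where E: "dual_derivations k J f E"
    using ind alg_indep_iff_dual_derivations[OF k fin] by blast
  show inj: "inj_on f J"
  proof (rule inj_onI)
    fix i j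
    assume ij: "i \<in> J" "j \<in> J" "f i = f j"
    have dual: "E i (f l) = (if i = l then 1 else 0)" if "l \<in> J" for l
      using E ij(1) that by (simp add: dual_derivations_def)
    show "i = j"
      using dual[OF ij(1)] dual[OF ij(2)] ij(3) by (simp split: if_splits)
  qed
  have "dual_derivations k (f ` J) (\<lambda>x. x) (\<lambda>x. E (the_inv_into J f x))"
    using E inj by (auto simp: dual_derivations_def the_inv_into_f_f inj_on_eq_iff)
  then show "alg_indep k (f ` J) (\<lambda>x. x)"
    using alg_indep_iff_dual_derivations[OF k, of "f ` J"] fin by blast
qed

text \<open>
  Dehomogenisation: a homogeneous relation of degree \<open>d\<close> divided by \<open>f\<^sub>b\<^sup>d\<close> is a relation between the
  quotients, and multiplying the monomials of a relation between the quotients by suitable powers of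
  \<open>f\<^sub>b\<close> makes it homogeneous. Both operations are injective on the monomials involved.
\<close>

lemma hom_alg_indep_iff_quotients:
  fixes f :: "'v \<Rightarrow> 'a::field"
  assumes k: "0 \<in> k" and b: "b \<in> J" "f b \<noteq> 0"
  shows "hom_alg_indep k J f \<longleftrightarrow> alg_indep k (J - {b}) (\<lambda>j. f j / f b)"
proof
  assume hom: "hom_alg_indep k J f"
  show "alg_indep k (J - {b}) (\<lambda>j. f j / f b)"
    unfolding alg_indep_iff[OF k] lin_indep_over_def
  proof (intro allI impI ballI)
    fix B c m
    assume B: "finite B" "B \<subseteq> {m. keys m \<subseteq> J - {b}}"
      and c: "\<forall>m\<in>B. c m \<in> k" "(\<Sum>m\<in>B. c m * mon (\<lambda>j. f j / f b) m) = 0" and m: "m \<in> B"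
    define d where "d = Max (mdeg ` B)"
    have d: "mdeg m \<le> d" if "m \<in> B" for m
      using B(1) that by (simp add: d_def)
    define \<phi> where "\<phi> m = m + single b (d - mdeg m)" for m
    have "mon f (\<phi> m) = f b ^ d * mon (\<lambda>j. f j / f b) m" if "m \<in> B" for m
      using b(2) d[OF that] by (simp add: \<phi>_def mon_add mon_scale power_diff)
    then have "(\<Sum>m\<in>B. c m * mon f (\<phi> m)) = f b ^ d * (\<Sum>m\<in>B. c m * mon (\<lambda>j. f j / f b) m)"
      by (simp add: sum_distrib_left mult_ac)
    then have rel: "(\<Sum>m\<in>B. c m * mon f (\<phi> m)) = 0"
      using c(2) by simp
    have keys_b: "lookup m b = 0" if "m \<in> B" for m
    proof -
      have "b \<notin> keys m"
        using B(2) that by blast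
      then show ?thesis
        by (simp add: in_keys_iff)
    qed
    have "inj_on \<phi> B"
    proof (rule inj_onI, rule poly_mapping_eqI)
      fix m m' j
      assume *: "m \<in> B" "m' \<in> B" "\<phi> m = \<phi> m'"
      then show "lookup m j = lookup m' j"
        using keys_b[OF *(1)] keys_b[OF *(2)] arg_cong[OF *(3), of "\<lambda>x. lookup x j"]
        unfolding \<phi>_def lookup_add lookup_single when_def by (cases "j = b") simp_all
    qed
    moreover have "\<phi> ` B \<subseteq> {m. keys m \<subseteq> J \<and> mdeg m = d}"
    proof safe
      fix m
      assume m: "m \<in> B"
      show "mdeg (\<phi> m) = d"
        using d[OF m] by (simp add: \<phi>_def mdeg_add)
      fix j
      assume "j \<in> keys (\<phi> m)"
      then show "j \<in> J"
        using B(2) m b(1) keys_add[of m "single b (d - mdeg m)"]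
        by (auto simp: \<phi>_def split: if_splits)
    qed
    moreover have "lin_indep_over k {m. keys m \<subseteq> J \<and> mdeg m = d} (mon f)"
      using hom by (simp add: hom_alg_indep_iff[OF k])
    ultimately show "c m = 0"
      using lin_indep_over_reindex[where v = "mon f" and \<phi> = \<phi> and S = B and c = c] rel m B(1) c(1) by blast
  qed
next
  assume ind: "alg_indep k (J - {b}) (\<lambda>j. f j / f b)"
  show "hom_alg_indep k J f"
    unfolding hom_alg_indep_iff[OF k] lin_indep_over_def
  proof (intro allI impI ballI)
    fix d B c m
    assume B: "finite B" "B \<subseteq> {m. keys m \<subseteq> J \<and> mdeg m = d}"
      and c: "\<forall>m\<in>B. c m \<in> k" "(\<Sum>m\<in>B. c m * mon f m) = 0" and m: "m \<in> B"
    define s where "s m = m - single b (lookup m b)" for m :: "'v \<Rightarrow>\<^sub>0 nat"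
    have mon_s: "mon g m = mon g (s m) * g b ^ lookup m b" for g :: "'v \<Rightarrow> 'a" and m
      by (subst split_variable[of m b]) (simp only: mon_add s_def mon_single)
    have mdeg_s: "mdeg m = mdeg (s m) + lookup m b" for m
      by (subst split_variable[of m b]) (simp only: mdeg_add s_def mdeg_single)
    have "mon f m = f b ^ d * mon (\<lambda>j. f j / f b) (s m)" if "m \<in> B" for m
    proof -
      have "mdeg m = d"
        using B(2) that by blast
      then show ?thesis
        using b(2) mon_s[of f m] mdeg_s[of m] by (auto simp: mon_scale power_add)
    qed
    then have "(\<Sum>m\<in>B. c m * mon f m) = f b ^ d * (\<Sum>m\<in>B. c m * mon (\<lambda>j. f j / f b) (s m))"
      by (simp add: sum_distrib_left mult_ac)
    then have rel: "(\<Sum>m\<in>B. c m * mon (\<lambda>j. f j / f b) (s m)) = 0"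
      using c(2) b(2) by simp
    have "inj_on s B"
    proof (rule inj_onI)
      fix m m'
      assume *: "m \<in> B" "m' \<in> B" "s m = s m'"
      then have "mdeg m = mdeg m'"
        using B(2) by blast
      then have "lookup m b = lookup m' b"
        using mdeg_s[of m] mdeg_s[of m'] *(3) by simp
      then show "m = m'"
        using *(3) by (metis s_def split_variable)
    qed
    moreover have "s ` B \<subseteq> {m. keys m \<subseteq> J - {b}}"
      using B(2) unfolding image_subset_iff mem_Collect_eq s_def keys_diff_single by blast
    moreover have "lin_indep_over k {m. keys m \<subseteq> J - {b}} (mon (\<lambda>j. f j / f b))"
      using ind by (simp add: alg_indep_iff[OF k])
    ultimately show "c m = 0"
      using lin_indep_over_reindex[where v = "mon (\<lambda>j. f j / f b)" and \<phi> = s and S = B and c = c] rel m B(1) c(1)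
      by blast
  qed
qed

section \<open>Homomorphisms of fields\<close>

definition field_hom_on :: "'a::field set \<Rightarrow> ('a \<Rightarrow> 'b::field) \<Rightarrow> bool" where
  "field_hom_on M \<psi> \<longleftrightarrow> \<psi> 1 = 1 \<and>
     (\<forall>x\<in>M. \<forall>y\<in>M. \<psi> (x + y) = \<psi> x + \<psi> y \<and> \<psi> (x * y) = \<psi> x * \<psi> y)"

context
  fixes M :: "'a::field set" and \<psi> :: "'a \<Rightarrow> 'b::field"
  assumes M: "is_subfield M" and \<psi>: "field_hom_on M \<psi>"
begin

lemma field_hom_one: "\<psi> 1 = 1"
  using \<psi> by (simp add: field_hom_on_def)

lemma field_hom_add: "x \<in> M \<Longrightarrow> y \<in> M \<Longrightarrow> \<psi> (x + y) = \<psi> x + \<psi> y"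
  using \<psi> by (simp add: field_hom_on_def)

lemma field_hom_mult: "x \<in> M \<Longrightarrow> y \<in> M \<Longrightarrow> \<psi> (x * y) = \<psi> x * \<psi> y"
  using \<psi> by (simp add: field_hom_on_def)

lemma field_hom_zero: "\<psi> 0 = 0"
  using field_hom_add[of 0 0] subfield_zero[OF M] by (metis add_cancel_right_right)

lemma field_hom_eq_0_iff:
  assumes "x \<in> M"
  shows "\<psi> x = 0 \<longleftrightarrow> x = 0"
proof
  assume "\<psi> x = 0"
  show "x = 0"
  proof (rule ccontr)
    assume "x \<noteq> 0"
    then have "1 = \<psi> (x * inverse x)"
      by (simp add: field_hom_one)
    also have "\<dots> = 0"
      using \<open>\<psi> x = 0\<close> assms by (simp add: field_hom_mult subfield_inverse[OF M])
    finally show False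
      by simp
  qed
qed (simp add: field_hom_zero)

lemma field_hom_diff: "x \<in> M \<Longrightarrow> y \<in> M \<Longrightarrow> \<psi> (x - y) = \<psi> x - \<psi> y"
  using field_hom_add[of "x - y" y] subfield_diff[OF M, of x y] by (simp add: algebra_simps)

lemma field_hom_inverse:
  assumes "x \<in> M"
  shows "\<psi> (inverse x) = inverse (\<psi> x)"
proof (cases "x = 0")
  case False
  then have "\<psi> x * \<psi> (inverse x) = 1"
    using field_hom_mult[of x "inverse x"] assms subfield_inverse[OF M assms] by (simp add: field_hom_one)
  then show ?thesis
    by (simp add: inverse_unique)
qed (simp add: field_hom_zero)

lemma field_hom_sum: "(\<And>i. i \<in> A \<Longrightarrow> g i \<in> M) \<Longrightarrow> \<psi> (sum g A) = (\<Sum>i\<in>A. \<psi> (g i))"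
  by (induction A rule: infinite_finite_induct) (auto simp: field_hom_zero field_hom_add subfield_sum[OF M])

lemma field_hom_power: "x \<in> M \<Longrightarrow> \<psi> (x ^ j) = \<psi> x ^ j"
  by (induction j) (auto simp: field_hom_one field_hom_mult subfield_power[OF M])

lemma field_hom_prod: "(\<And>i. i \<in> A \<Longrightarrow> g i \<in> M) \<Longrightarrow> \<psi> (prod g A) = (\<Prod>i\<in>A. \<psi> (g i))"
  by (induction A rule: infinite_finite_induct) (auto simp: field_hom_one field_hom_mult subfield_prod[OF M])

lemma field_hom_mon:
  assumes "\<And>i. i \<in> I \<Longrightarrow> f i \<in> M" "keys m \<subseteq> I"
  shows "\<psi> (mon f m) = mon (\<lambda>i. \<psi> (f i)) m" "mon f m \<in> M"
proof -
  have "f i ^ lookup m i \<in> M" if "i \<in> keys m" for i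
    using assms that by (intro subfield_power[OF M]) blast
  then show "mon f m \<in> M"
    unfolding mon_def by (intro subfield_prod[OF M])
  show "\<psi> (mon f m) = mon (\<lambda>i. \<psi> (f i)) m"
    unfolding mon_def using assms by (subst field_hom_prod) (auto intro!: prod.cong subfield_power[OF M] field_hom_power)
qed

lemma field_hom_image_subfield:
  assumes "is_subfield N" "N \<subseteq> M"
  shows "is_subfield (\<psi> ` N)"
proof (rule is_subfieldI)
  show "1 \<in> \<psi> ` N"
    using subfield_one[OF assms(1)] field_hom_one by (metis imageI)
  fix x y
  assume "x \<in> \<psi> ` N" "y \<in> \<psi> ` N"
  then obtain u v where *: "u \<in> N" "v \<in> N" "x = \<psi> u" "y = \<psi> v"
    by blast
  then have "u \<in> M" "v \<in> M"
    using assms(2) by blast+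
  then show "x - y \<in> \<psi> ` N" "x * y \<in> \<psi> ` N" "inverse x \<in> \<psi> ` N"
    using * subfield_diff[OF assms(1)] subfield_mult[OF assms(1)] subfield_inverse[OF assms(1)]
      field_hom_diff[of u v] field_hom_mult[of u v] field_hom_inverse[of u] by (metis imageI)+
qed

lemma field_hom_relation:
  assumes "\<And>i. i \<in> I \<Longrightarrow> f i \<in> M" "\<And>m. m \<in> B \<Longrightarrow> keys m \<subseteq> I" "\<And>m. m \<in> B \<Longrightarrow> c m \<in> M"
  shows "(\<Sum>m\<in>B. \<psi> (c m) * mon (\<lambda>i. \<psi> (f i)) m) = 0 \<longleftrightarrow> (\<Sum>m\<in>B. c m * mon f m) = 0"
proof -
  have mem: "c m * mon f m \<in> M" and im: "\<psi> (c m * mon f m) = \<psi> (c m) * mon (\<lambda>i. \<psi> (f i)) m" if "m \<in> B" for m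
    using field_hom_mon[of I f m] assms that by (auto simp: field_hom_mult intro!: subfield_mult[OF M])
  have "(\<Sum>m\<in>B. \<psi> (c m) * mon (\<lambda>i. \<psi> (f i)) m) = \<psi> (\<Sum>m\<in>B. c m * mon f m)"
    by (subst field_hom_sum) (auto simp: mem im)
  also have "\<dots> = 0 \<longleftrightarrow> (\<Sum>m\<in>B. c m * mon f m) = 0"
    using mem by (intro field_hom_eq_0_iff subfield_sum[OF M])
  finally show ?thesis .
qed

lemma field_hom_lin_indep_over_mon:
  assumes f: "\<And>i. i \<in> I \<Longrightarrow> f i \<in> M" and k: "k \<subseteq> M" and A: "A \<subseteq> {m. keys m \<subseteq> I}"
  shows "lin_indep_over (\<psi> ` k) A (mon (\<lambda>i. \<psi> (f i))) \<longleftrightarrow> lin_indep_over k A (mon f)"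
proof
  assume L: "lin_indep_over (\<psi> ` k) A (mon (\<lambda>i. \<psi> (f i)))"
  show "lin_indep_over k A (mon f)"
    unfolding lin_indep_over_def
  proof (intro allI impI ballI)
    fix B c m
    assume B: "finite B" "B \<subseteq> A" "\<forall>m\<in>B. c m \<in> k" "(\<Sum>m\<in>B. c m * mon f m) = 0" "m \<in> B"
    then have "(\<Sum>m\<in>B. \<psi> (c m) * mon (\<lambda>i. \<psi> (f i)) m) = 0"
      using A k by (subst field_hom_relation[OF f]) auto
    then have "\<psi> (c m) = 0"
      using B by (intro lin_indep_overD[OF L, of B "\<lambda>m. \<psi> (c m)"]) auto
    then show "c m = 0"
      using field_hom_eq_0_iff[of "c m"] B k by blast
  qed
next
  assume L: "lin_indep_over k A (mon f)"
  show "lin_indep_over (\<psi> ` k) A (mon (\<lambda>i. \<psi> (f i)))"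
    unfolding lin_indep_over_def
  proof (intro allI impI ballI)
    fix B d m
    assume B: "finite B" "B \<subseteq> A" "\<forall>m\<in>B. d m \<in> \<psi> ` k" "(\<Sum>m\<in>B. d m * mon (\<lambda>i. \<psi> (f i)) m) = 0" "m \<in> B"
    have "\<forall>m\<in>B. \<exists>x. x \<in> k \<and> d m = \<psi> x"
      using B(3) by blast
    then obtain c where "\<forall>m\<in>B. c m \<in> k \<and> d m = \<psi> (c m)"
      by (rule bchoice[THEN exE])
    then have c: "\<And>m. m \<in> B \<Longrightarrow> c m \<in> k \<and> d m = \<psi> (c m)"
      by blast
    have "(\<Sum>m\<in>B. \<psi> (c m) * mon (\<lambda>i. \<psi> (f i)) m) = 0"
      using B(4) c by simp
    then have "(\<Sum>m\<in>B. c m * mon f m) = 0"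
      using A k c B(2) by (subst (asm) field_hom_relation[OF f]) auto
    then have "c m = 0"
      using B c by (intro lin_indep_overD[OF L, of B c]) auto
    then show "d m = 0"
      using c[OF B(5)] field_hom_zero by simp
  qed
qed

lemma field_hom_alg_closed:
  assumes k: "k \<subseteq> L" "0 \<in> k" and L: "L \<subseteq> M" and closed: "algebraically_closed_in k L"
    and u: "u \<in> \<psi> ` L" "alg_over (\<psi> ` k) u"
  shows "u \<in> \<psi> ` k"
proof -
  obtain x where x: "x \<in> L" "u = \<psi> x"
    using u(1) by blast
  obtain p where p: "p \<noteq> 0" "\<forall>i. coeff p i \<in> \<psi> ` k" "poly p u = 0"
    using u(2) unfolding alg_over_def by blast
  have "\<forall>i. \<exists>x. x \<in> k \<and> coeff p i = \<psi> x"
    using p(2) by blast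
  then obtain c where "\<forall>i. c i \<in> k \<and> coeff p i = \<psi> (c i)"
    by (rule choice[THEN exE])
  then have c: "\<And>i. c i \<in> k \<and> coeff p i = \<psi> (c i)"
    by blast
  define q where "q = Poly (map c [0..<Suc (degree p)])"
  have coeff_q: "coeff q i = (if i \<le> degree p then c i else 0)" for i
    by (simp add: q_def nth_default_def del: upt_Suc)
  have "c (degree p) \<noteq> 0"
    using c p(1) field_hom_zero by (metis leading_coeff_0_iff)
  then have "q \<noteq> 0"
    using coeff_q[of "degree p"] by auto
  have cM: "c i \<in> M" "x \<in> M" for i
    using c k(1) L x(1) by blast+
  have deg_q: "degree q = degree p"
  proof (rule antisym)
    show "degree q \<le> degree p"
      by (rule degree_le) (simp add: coeff_q)
    show "degree p \<le> degree q"
      by (rule le_degree) (simp add: coeff_q \<open>c (degree p) \<noteq> 0\<close>)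
  qed
  have "poly q x = (\<Sum>i\<le>degree p. c i * x ^ i)"
    by (simp add: poly_altdef deg_q coeff_q)
  moreover have "\<psi> (\<Sum>i\<le>degree p. c i * x ^ i) = (\<Sum>i\<le>degree p. \<psi> (c i) * u ^ i)"
    by (subst field_hom_sum)
      (simp_all add: cM field_hom_mult field_hom_power subfield_mult[OF M] subfield_power[OF M] x(2))
  moreover have "\<dots> = 0"
    using p(3) c by (simp add: poly_altdef)
  moreover have "(\<Sum>i\<le>degree p. c i * x ^ i) \<in> M"
    by (intro subfield_sum[OF M] subfield_mult[OF M] subfield_power[OF M] cM)
  ultimately have "poly q x = 0"
    using field_hom_eq_0_iff by simp
  moreover have "\<forall>i. coeff q i \<in> k"
    using c k(2) by (simp add: coeff_q)
  ultimately have "x \<in> k"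
    using closed x(1) \<open>q \<noteq> 0\<close> unfolding algebraically_closed_in_def by blast
  then show ?thesis
    using x(2) by blast
qed

end

section \<open>Power series with coefficients in a subfield\<close>

definition fps_over :: "'a::field set \<Rightarrow> 'a fps set" where
  "fps_over k = {a. \<forall>i. fps_nth a i \<in> k}"

definition laurent_over :: "'a::field set \<Rightarrow> 'a fls set" where
  "laurent_over k = {fps_to_fls a / fps_to_fls b |a b. a \<in> fps_over k \<and> b \<in> fps_over k \<and> b \<noteq> 0}"

lemma fps_to_fls_sum: "fps_to_fls (sum g A) = (\<Sum>i\<in>A. fps_to_fls (g i))"
  by (induction A rule: infinite_finite_induct) auto

lemma is_subfield_UNIV: "is_subfield UNIV"
  by (simp add: is_subfield_def)

lemma field_hom_fls_const: "field_hom_on UNIV fls_const"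
  by (simp add: field_hom_on_def fls_plus_const)

lemma mon_fls_const: fixes c :: "'v \<Rightarrow> 'a::field" shows "mon (\<lambda>i. fls_const (c i)) m = fls_const (mon c m)"
  using field_hom_mon(1)[OF is_subfield_UNIV field_hom_fls_const, of UNIV c m] by simp

context
  fixes k :: "'a::field set"
  assumes k: "is_subfield k"
begin

lemma fps_over_one: "1 \<in> fps_over k" and fps_over_zero: "0 \<in> fps_over k"
  by (auto simp: fps_over_def intro: subfield_one[OF k] subfield_zero[OF k])

lemma fps_over_const: "c \<in> k \<Longrightarrow> fps_const c \<in> fps_over k"
  by (auto simp: fps_over_def intro: subfield_zero[OF k])

lemma fps_over_add: "a \<in> fps_over k \<Longrightarrow> b \<in> fps_over k \<Longrightarrow> a + b \<in> fps_over k"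
  by (simp add: fps_over_def subfield_add[OF k])

lemma fps_over_uminus: "a \<in> fps_over k \<Longrightarrow> - a \<in> fps_over k"
  by (simp add: fps_over_def subfield_uminus[OF k])

lemma fps_over_diff: "a \<in> fps_over k \<Longrightarrow> b \<in> fps_over k \<Longrightarrow> a - b \<in> fps_over k"
  by (simp add: fps_over_def subfield_diff[OF k])

lemma fps_over_mult: "a \<in> fps_over k \<Longrightarrow> b \<in> fps_over k \<Longrightarrow> a * b \<in> fps_over k"
  by (auto simp: fps_over_def fps_mult_nth intro!: subfield_sum[OF k] subfield_mult[OF k])

lemma fps_over_sum: "(\<And>i. i \<in> A \<Longrightarrow> g i \<in> fps_over k) \<Longrightarrow> sum g A \<in> fps_over k"
  by (induction A rule: infinite_finite_induct) (auto intro: fps_over_zero fps_over_add)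

lemma fps_over_power: "a \<in> fps_over k \<Longrightarrow> a ^ j \<in> fps_over k"
  by (induction j) (auto intro: fps_over_one fps_over_mult)

lemma fps_over_inverse:
  assumes "a \<in> fps_over k" "fps_nth a 0 \<noteq> 0"
  shows "inverse a \<in> fps_over k"
proof -
  have "fps_nth (inverse a) i \<in> k" for i
  proof (induction i rule: less_induct)
    case (less i)
    show ?case
    proof (cases i)
      case 0
      then show ?thesis
        using assms(1) by (simp add: fps_over_def subfield_inverse[OF k])
    next
      case (Suc j)
      have "a * inverse a = 1"
        using inverse_mult_eq_1[OF assms(2)] by (simp add: mult.commute)
      then have "(\<Sum>l=0..i. fps_nth a l * fps_nth (inverse a) (i - l)) = 0"
        using Suc by (metis fps_mult_nth fps_one_nth nat.distinct(1))
      then have "fps_nth a 0 * fps_nth (inverse a) i = - (\<Sum>l=1..i. fps_nth a l * fps_nth (inverse a) (i - l))"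
        by (simp add: sum.atLeast_Suc_atMost eq_neg_iff_add_eq_0)
      then have "fps_nth (inverse a) i = - (\<Sum>l=1..i. fps_nth a l * fps_nth (inverse a) (i - l)) / fps_nth a 0"
        using assms(2) by (simp add: field_simps)
      also have "\<dots> \<in> k"
        using assms(1) less
        by (intro subfield_divide[OF k] subfield_uminus[OF k] subfield_sum[OF k] subfield_mult[OF k])
          (auto simp: fps_over_def)
      finally show ?thesis .
    qed
  qed
  then show ?thesis
    by (simp add: fps_over_def)
qed

lemma is_subfield_laurent_over: "is_subfield (laurent_over k)"
  unfolding laurent_over_def
  by (rule is_subfield_fractions)
    (auto simp: fls_times_fps_to_fls intro: fps_over_one fps_over_mult fps_over_diff)

lemma fps_over_imp_laurent_over: "a \<in> fps_over k \<Longrightarrow> fps_to_fls a \<in> laurent_over k"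
  unfolding laurent_over_def using fps_over_one by (intro CollectI exI[of _ a] exI[of _ 1]) simp

text \<open>
  After clearing denominators, a relation over the power series is a relation over \<open>k\<close> for each power
  of the variable.
\<close>

lemma alg_indep_constants:
  assumes "alg_indep k I c"
  shows "alg_indep (laurent_over k) I (\<lambda>i. fls_const (c i))"
  unfolding alg_indep_iff[OF subfield_zero[OF is_subfield_laurent_over]] lin_indep_over_def
proof (intro allI impI ballI)
  fix B g m
  assume B: "finite B" "B \<subseteq> {m. keys m \<subseteq> I}"
    and g: "\<forall>m\<in>B. g m \<in> laurent_over k" "(\<Sum>m\<in>B. g m * mon (\<lambda>i. fls_const (c i)) m) = 0" and m: "m \<in> B"
  have mon_const: "mon (\<lambda>i. fls_const (c i)) m = fps_to_fls (fps_const (mon c m))" for m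
    by (simp add: mon_fls_const)
  have "\<exists>d\<in>fps_over k. d \<noteq> 0 \<and> (\<forall>s\<in>g ` B. \<exists>a\<in>fps_over k. fps_to_fls d * s = fps_to_fls a)"
    using B(1) g(1) by (intro common_denominator)
      (auto simp: fls_times_fps_to_fls laurent_over_def intro: fps_over_one fps_over_mult)
  then obtain d where d: "d \<noteq> 0" "\<And>s. s \<in> g ` B \<Longrightarrow> \<exists>a\<in>fps_over k. fps_to_fls d * s = fps_to_fls a"
    by blast
  have "\<exists>a. a \<in> fps_over k \<and> fps_to_fls d * g m = fps_to_fls a" if "m \<in> B" for m
    using d(2)[of "g m"] that by blast
  then obtain a where a: "\<And>m. m \<in> B \<Longrightarrow> a m \<in> fps_over k" "\<And>m. m \<in> B \<Longrightarrow> fps_to_fls d * g m = fps_to_fls (a m)"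
    by metis
  have "fps_to_fls (\<Sum>m\<in>B. a m * fps_const (mon c m)) = (\<Sum>m\<in>B. (fps_to_fls d * g m) * mon (\<lambda>i. fls_const (c i)) m)"
    using a(2) by (simp add: fps_to_fls_sum fls_times_fps_to_fls mon_const)
  also have "\<dots> = fps_to_fls d * (\<Sum>m\<in>B. g m * mon (\<lambda>i. fls_const (c i)) m)"
    by (simp add: sum_distrib_left mult_ac)
  finally have rel: "(\<Sum>m\<in>B. a m * fps_const (mon c m)) = 0"
    using g(2) by simp
  have "fps_nth (a m) i = 0" for i
  proof -
    have "(\<Sum>m\<in>B. fps_nth (a m) i * mon c m) = 0"
      using arg_cong[OF rel, of "\<lambda>x. fps_nth x i"] by (simp add: fps_sum_nth)
    moreover have "lin_indep_over k {m. keys m \<subseteq> I} (mon c)"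
      using assms by (simp add: alg_indep_iff[OF subfield_zero[OF k]])
    ultimately show ?thesis
      using B a(1) m lin_indep_overD[of k "{m. keys m \<subseteq> I}" "mon c" B "\<lambda>m. fps_nth (a m) i" m]
      by (simp add: fps_over_def)
  qed
  then have "a m = 0"
    by (simp add: fps_eq_iff)
  then show "g m = 0"
    using a(2)[OF m] d(1) by simp
qed

end

section \<open>The formal solution matrix\<close>

text \<open>
  Coefficients of the row \<open>\<zeta>\<close> with \<open>\<zeta>' = - \<zeta> A\<close> and initial value \<open>v\<close>.
\<close>

fun adjoint_coeff :: "nat \<Rightarrow> (nat \<Rightarrow> nat \<Rightarrow> 'a::field fps) \<Rightarrow> (nat \<Rightarrow> 'a) \<Rightarrow> nat \<Rightarrow> nat \<Rightarrow> 'a" where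
  "adjoint_coeff n A v 0 j = v j"
| "adjoint_coeff n A v (Suc m) j =
     - (\<Sum>l<n. \<Sum>a\<in>{0..m}. adjoint_coeff n A v a l * fps_nth (A l j) (m - a)) / of_nat (Suc m)"

lemma adjoint_system_solvable:
  fixes A :: "nat \<Rightarrow> nat \<Rightarrow> 'a::field_char_0 fps"
  assumes k: "is_subfield k" and A: "\<And>l j. A l j \<in> fps_over k" and v: "\<And>j. v j \<in> k"
  obtains \<zeta> where "\<And>j. \<zeta> j \<in> fps_over k" "\<And>j. fps_nth (\<zeta> j) 0 = v j"
    "\<And>j. fps_deriv (\<zeta> j) = - (\<Sum>l<n. \<zeta> l * A l j)"
proof -
  define \<zeta> where "\<zeta> j = Abs_fps (\<lambda>m. adjoint_coeff n A v m j)" for j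
  have "adjoint_coeff n A v m j \<in> k" for m j
  proof (induction m arbitrary: j rule: less_induct)
    case (less m)
    show ?case
    proof (cases m)
      case (Suc m')
      then show ?thesis
        using less A by (auto simp: fps_over_def simp del: of_nat_Suc intro!: subfield_divide[OF k] subfield_uminus[OF k]
            subfield_sum[OF k] subfield_mult[OF k] subfield_of_nat[OF k])
    qed (simp add: v)
  qed
  then have "\<zeta> j \<in> fps_over k" for j
    by (simp add: \<zeta>_def fps_over_def)
  moreover have "fps_deriv (\<zeta> j) = - (\<Sum>l<n. \<zeta> l * A l j)" for j
  proof (rule fps_ext)
    fix m
    have "fps_nth (fps_deriv (\<zeta> j)) m = of_nat (Suc m) * adjoint_coeff n A v (Suc m) j"
      by (simp add: \<zeta>_def)
    also have "\<dots> = - (\<Sum>l<n. \<Sum>a=0..m. adjoint_coeff n A v a l * fps_nth (A l j) (m - a))"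
      by (simp del: of_nat_Suc)
    also have "\<dots> = fps_nth (- (\<Sum>l<n. \<zeta> l * A l j)) m"
      by (simp add: \<zeta>_def fps_sum_nth fps_mult_nth)
    finally show "fps_nth (fps_deriv (\<zeta> j)) m = fps_nth (- (\<Sum>l<n. \<zeta> l * A l j)) m" .
  qed
  ultimately show ?thesis
    using that[of \<zeta>] by (simp add: \<zeta>_def)
qed

text \<open>
  If \<open>f' = A f\<close> and \<open>\<zeta>' = - \<zeta> A\<close>, then \<open>\<zeta> f\<close> is constant.
\<close>

theorem initial_values_as_combinations:
  fixes f :: "nat \<Rightarrow> 'a::field_char_0 fps"
  assumes k: "is_subfield k" and B: "\<And>j. j < n \<Longrightarrow> B j \<in> fps_over k"
    and deriv: "\<And>j. fps_deriv (f j) = f (Suc j)" and ode: "f n + (\<Sum>j<n. B j * f j) = 0" and i: "i < n"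
  obtains \<zeta> where "\<And>j. \<zeta> j \<in> fps_over k" "\<And>j. fps_nth (\<zeta> j) 0 = (if j = i then 1 else 0)"
    "fps_const (fps_nth (f i) 0) = (\<Sum>j<n. \<zeta> j * f j)"
proof -
  \<comment> \<open>the companion matrix\<close>
  define A where "A l j = (if Suc l < n then (if j = Suc l then 1 else 0) else if j < n then - B j else 0)" for l j
  have A: "A l j \<in> fps_over k" for l j
    using B by (auto simp: A_def intro: fps_over_one[OF k] fps_over_zero[OF k] fps_over_uminus[OF k])
  have system: "fps_deriv (f l) = (\<Sum>j<n. A l j * f j)" if "l < n" for l
  proof (cases "Suc l < n")
    case True
    have "(\<Sum>j<n. A l j * f j) = (\<Sum>j<n. if j = Suc l then f j else 0)"
      using True by (intro sum.cong) (auto simp: A_def)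
    then show ?thesis
      using True by (simp add: deriv)
  next
    case False
    then have "Suc l = n"
      using that by simp
    have "(\<Sum>j<n. A l j * f j) = - (\<Sum>j<n. B j * f j)"
      using False by (simp add: A_def sum_negf flip: sum_negf)
    also have "\<dots> = f n"
      by (rule minus_unique) (use ode in \<open>simp add: add.commute\<close>)
    finally show ?thesis
      using \<open>Suc l = n\<close> by (simp add: deriv)
  qed
  define v where "v j = (if j = i then 1 else 0 :: 'a)" for j
  have v: "v j \<in> k" for j
    by (simp add: v_def subfield_one[OF k] subfield_zero[OF k])
  obtain \<zeta> where \<zeta>: "\<And>j. \<zeta> j \<in> fps_over k" "\<And>j. fps_nth (\<zeta> j) 0 = v j"
    "\<And>j. fps_deriv (\<zeta> j) = - (\<Sum>l<n. \<zeta> l * A l j)"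
    by (rule adjoint_system_solvable[OF k A v, where n = n]) (rule that)
  have "fps_deriv (\<Sum>j<n. \<zeta> j * f j) = (\<Sum>j<n. fps_deriv (\<zeta> j) * f j) + (\<Sum>l<n. \<zeta> l * fps_deriv (f l))"
    by (simp add: fps_deriv_sum sum.distrib)
  also have "(\<Sum>l<n. \<zeta> l * fps_deriv (f l)) = (\<Sum>l<n. \<Sum>j<n. \<zeta> l * A l j * f j)"
    by (simp add: system sum_distrib_left mult.assoc)
  also have "(\<Sum>j<n. fps_deriv (\<zeta> j) * f j) = - (\<Sum>j<n. \<Sum>l<n. \<zeta> l * A l j * f j)"
    by (simp add: \<zeta>(3) sum_distrib_right sum_negf)
  also have "(\<Sum>j<n. \<Sum>l<n. \<zeta> l * A l j * f j) = (\<Sum>l<n. \<Sum>j<n. \<zeta> l * A l j * f j)"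
    by (rule sum.swap)
  finally have "fps_deriv (\<Sum>j<n. \<zeta> j * f j) = 0"
    by simp
  then have "(\<Sum>j<n. \<zeta> j * f j) = fps_const (fps_nth (\<Sum>j<n. \<zeta> j * f j) 0)"
    by (simp only: fps_deriv_eq_0_iff)
  also have "fps_nth (\<Sum>j<n. \<zeta> j * f j) 0 = (\<Sum>j<n. if j = i then fps_nth (f j) 0 else 0)"
    unfolding fps_sum_nth fps_mult_nth by (intro sum.cong) (auto simp: \<zeta>(2) v_def)
  also have "\<dots> = fps_nth (f i) 0"
    using i by simp
  finally show ?thesis
    using that[of \<zeta>] \<zeta>(1,2) by (simp add: v_def)
qed

section \<open>Algebraic numbers\<close>

text \<open>
  The algebraic elements are an intersection of fields of constants, so that no polynomial for a sum
  or a product has to be constructed.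
\<close>

lemma is_subfield_algebraic_closure:
  fixes M :: "'a::field_char_0 set"
  assumes M: "is_subfield M"
  shows "is_subfield {x. alg_over M x}"
proof -
  have "alg_over M x \<longleftrightarrow> (\<forall>D. derivation D \<longrightarrow> (\<forall>a\<in>M. D a = 0) \<longrightarrow> D x = 0)" for x
  proof
    assume "alg_over M x"
    then show "\<forall>D. derivation D \<longrightarrow> (\<forall>a\<in>M. D a = 0) \<longrightarrow> D x = 0"
      using derivation_algebraic_zero[OF _ M] by blast
  next
    assume R: "\<forall>D. derivation D \<longrightarrow> (\<forall>a\<in>M. D a = 0) \<longrightarrow> D x = 0"
    show "alg_over M x"
    proof (rule ccontr)
      assume "\<not> alg_over M x"
      then obtain D where "derivation D" "\<And>a. a \<in> M \<Longrightarrow> D a = 0" "D x = 1"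
        by (rule transcendental_derivation[OF M]) (rule that)
      then show False
        using R by (metis zero_neq_one)
    qed
  qed
  then have "{x. alg_over M x} = \<Inter>{{x. D x = 0} |D. derivation D \<and> (\<forall>a\<in>M. D a = 0)}"
    by auto
  also have "is_subfield \<dots>"
    using subfield_of_constants by (intro is_subfield_Inter) blast
  finally show ?thesis .
qed

lemma is_subfield_Qbar: "is_subfield Qbar"
proof -
  have "is_subfield (\<rat> :: complex set)"
    by (rule is_subfieldI) auto
  moreover have "Qbar = {x. alg_over \<rat> x}"
    by (auto simp: Qbar_def algebraic_altdef alg_over_def)
  ultimately show ?thesis
    using is_subfield_algebraic_closure by metis
qed

lemma fps_of_poly_over: "p \<in> Qbar_poly \<Longrightarrow> fps_of_poly p \<in> fps_over Qbar"
  by (simp add: Qbar_poly_def fps_over_def)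

lemma Qbar_poly_mult: "p \<in> Qbar_poly \<Longrightarrow> q \<in> Qbar_poly \<Longrightarrow> p * q \<in> Qbar_poly"
  by (auto simp: Qbar_poly_def coeff_mult intro!: subfield_sum[OF is_subfield_Qbar] subfield_mult[OF is_subfield_Qbar])

lemma Qbar_poly_diff: "p \<in> Qbar_poly \<Longrightarrow> q \<in> Qbar_poly \<Longrightarrow> p - q \<in> Qbar_poly"
  by (simp add: Qbar_poly_def subfield_diff[OF is_subfield_Qbar])

lemma Qbar_poly_add: "p \<in> Qbar_poly \<Longrightarrow> q \<in> Qbar_poly \<Longrightarrow> p + q \<in> Qbar_poly"
  by (simp add: Qbar_poly_def subfield_add[OF is_subfield_Qbar])

lemma Qbar_poly_const: "c \<in> Qbar \<Longrightarrow> [:c:] \<in> Qbar_poly"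
  by (auto simp: Qbar_poly_def coeff_pCons subfield_zero[OF is_subfield_Qbar] split: nat.split)

lemma Qbar_poly_zero: "0 \<in> Qbar_poly"
  by (simp add: Qbar_poly_def subfield_zero[OF is_subfield_Qbar])

lemma Qbar_poly_sum: "(\<And>i. i \<in> A \<Longrightarrow> g i \<in> Qbar_poly) \<Longrightarrow> sum g A \<in> Qbar_poly"
  by (induction A rule: infinite_finite_induct)
    (auto intro: Qbar_poly_add Qbar_poly_zero)

lemma Qbar_poly_pcompose:
  assumes "p \<in> Qbar_poly" "q \<in> Qbar_poly"
  shows "p \<circ>\<^sub>p q \<in> Qbar_poly"
  using assms(1)
proof (induction p)
  case (pCons a p)
  have "a \<in> Qbar" "p \<in> Qbar_poly"
    using pCons.prems by (auto simp: Qbar_poly_def coeff_pCons split: nat.splits)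
  then show ?case
    using pCons.IH assms(2) by (auto simp: pcompose_pCons intro!: Qbar_poly_add Qbar_poly_mult Qbar_poly_const)
qed (simp add: Qbar_poly_zero)

lemma Qbar_poly_truncate: "a \<in> fps_over Qbar \<Longrightarrow> truncate_fps n a \<in> Qbar_poly"
  by (simp add: Qbar_poly_def fps_over_def coeff_truncate_fps subfield_zero[OF is_subfield_Qbar])

lemma Qbar_poly_one: "1 \<in> Qbar_poly"
  using Qbar_poly_const[OF subfield_one[OF is_subfield_Qbar]] by (simp add: one_pCons)

lemma is_subfield_Qbar_ratfun: "is_subfield Qbar_ratfun"
  unfolding Qbar_ratfun_def
proof (rule is_subfield_fractions)
  show "fls_of_poly (p - q) = fls_of_poly p - fls_of_poly q" for p q
    by (simp add: fls_of_poly_def fps_of_poly_diff)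
  show "fls_of_poly 1 = 1"
    by (simp add: fls_of_poly_def)
qed (auto simp: fls_of_poly_mult fls_of_poly_eq_0_iff intro: Qbar_poly_one Qbar_poly_mult Qbar_poly_diff)

lemma Qbar_ratfun_subset_laurent_over: "Qbar_ratfun \<subseteq> laurent_over Qbar"
proof
  fix x
  assume "x \<in> Qbar_ratfun"
  then obtain p q where "p \<in> Qbar_poly" "q \<in> Qbar_poly" "q \<noteq> 0" "x = fls_of_poly p / fls_of_poly q"
    unfolding Qbar_ratfun_def by blast
  then show "x \<in> laurent_over Qbar"
    unfolding laurent_over_def fls_of_poly_def
    by (intro CollectI exI[of _ "fps_of_poly p"] exI[of _ "fps_of_poly q"])
      (use fps_of_poly_eq_iff[of q 0] in \<open>auto simp: fps_of_poly_over\<close>)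
qed

section \<open>Expansion at another point\<close>

definition taylor :: "complex \<Rightarrow> complex fps \<Rightarrow> complex fps" where
  "taylor \<xi> a = fps_expansion (\<lambda>t. eval_fps a (\<xi> + t)) 0"

definition conv_at :: "complex \<Rightarrow> complex fps set" where
  "conv_at \<xi> = {a. ereal (norm \<xi>) < fps_conv_radius a}"

lemma conv_at_nhd:
  assumes "a \<in> conv_at \<xi>"
  shows "open {t. ereal (norm (\<xi> + t)) < fps_conv_radius a}"
    "\<forall>\<^sub>F t in nhds 0. ereal (norm (\<xi> + t)) < fps_conv_radius a"
proof -
  have eq: "{t. ereal (norm (\<xi> + t)) < fps_conv_radius a} = (\<lambda>t. \<xi> + t) -` eball 0 (fps_conv_radius a)"
    by auto
  show op: "open {t. ereal (norm (\<xi> + t)) < fps_conv_radius a}"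
    unfolding eq by (intro open_vimage open_eball continuous_intros)
  then show "\<forall>\<^sub>F t in nhds 0. ereal (norm (\<xi> + t)) < fps_conv_radius a"
    using eventually_nhds_in_open[OF op, of 0] assms by (simp add: conv_at_def)
qed

lemma taylor_expansion:
  assumes "a \<in> conv_at \<xi>"
  shows "(\<lambda>t. eval_fps a (\<xi> + t)) has_fps_expansion taylor \<xi> a"
  unfolding taylor_def
proof (rule has_fps_expansion_fps_expansion[OF conv_at_nhd(1)[OF assms]])
  have "eval_fps a \<circ> (\<lambda>t. \<xi> + t) holomorphic_on {t. ereal (norm (\<xi> + t)) < fps_conv_radius a}"
    by (rule holomorphic_on_compose_gen[where t = "eball 0 (fps_conv_radius a)"])
      (auto intro!: holomorphic_intros)
  then show "(\<lambda>t. eval_fps a (\<xi> + t)) holomorphic_on {t. ereal (norm (\<xi> + t)) < fps_conv_radius a}"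
    by (simp add: o_def)
qed (use assms in \<open>simp add: conv_at_def\<close>)

lemma taylor_eqI:
  assumes "a \<in> conv_at \<xi>" "g has_fps_expansion b" "\<forall>\<^sub>F t in nhds 0. eval_fps a (\<xi> + t) = g t"
  shows "taylor \<xi> a = b"
  using taylor_expansion[OF assms(1)] assms(2) has_fps_expansion_cong[OF assms(3) refl]
    fps_expansion_unique_complex by blast

lemma conv_at_add: "a \<in> conv_at \<xi> \<Longrightarrow> b \<in> conv_at \<xi> \<Longrightarrow> a + b \<in> conv_at \<xi>"
  unfolding conv_at_def by simp (rule less_le_trans[OF _ fps_conv_radius_add], simp)

lemma conv_at_mult: "a \<in> conv_at \<xi> \<Longrightarrow> b \<in> conv_at \<xi> \<Longrightarrow> a * b \<in> conv_at \<xi>"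
  unfolding conv_at_def by simp (rule less_le_trans[OF _ fps_conv_radius_mult], simp)

lemma conv_at_uminus: "a \<in> conv_at \<xi> \<Longrightarrow> - a \<in> conv_at \<xi>"
  by (simp add: conv_at_def)

lemma conv_at_deriv: "a \<in> conv_at \<xi> \<Longrightarrow> fps_deriv a \<in> conv_at \<xi>"
  using fps_conv_radius_deriv[of a] by (auto simp: conv_at_def intro: less_le_trans)

lemma conv_at_poly: "fps_of_poly p \<in> conv_at \<xi>"
  by (simp add: conv_at_def)

lemma taylor_add:
  assumes "a \<in> conv_at \<xi>" "b \<in> conv_at \<xi>"
  shows "taylor \<xi> (a + b) = taylor \<xi> a + taylor \<xi> b"
proof (rule taylor_eqI[OF conv_at_add[OF assms]
      has_fps_expansion_add[OF taylor_expansion[OF assms(1)] taylor_expansion[OF assms(2)]]])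
  show "\<forall>\<^sub>F t in nhds 0. eval_fps (a + b) (\<xi> + t) = eval_fps a (\<xi> + t) + eval_fps b (\<xi> + t)"
    using conv_at_nhd(2)[OF assms(1)] conv_at_nhd(2)[OF assms(2)]
    by eventually_elim (simp add: eval_fps_add)
qed

lemma taylor_mult:
  assumes "a \<in> conv_at \<xi>" "b \<in> conv_at \<xi>"
  shows "taylor \<xi> (a * b) = taylor \<xi> a * taylor \<xi> b"
proof (rule taylor_eqI[OF conv_at_mult[OF assms]
      has_fps_expansion_mult[OF taylor_expansion[OF assms(1)] taylor_expansion[OF assms(2)]]])
  show "\<forall>\<^sub>F t in nhds 0. eval_fps (a * b) (\<xi> + t) = eval_fps a (\<xi> + t) * eval_fps b (\<xi> + t)"
    using conv_at_nhd(2)[OF assms(1)] conv_at_nhd(2)[OF assms(2)]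
    by eventually_elim (simp add: eval_fps_mult)
qed

lemma taylor_deriv:
  assumes "a \<in> conv_at \<xi>"
  shows "taylor \<xi> (fps_deriv a) = fps_deriv (taylor \<xi> a)"
proof (rule taylor_eqI[OF conv_at_deriv[OF assms] has_fps_expansion_deriv[OF taylor_expansion[OF assms]]])
  have "eval_fps (fps_deriv a) (\<xi> + t) = deriv (\<lambda>t. eval_fps a (\<xi> + t)) t"
    if "ereal (norm (\<xi> + t)) < fps_conv_radius a" for t
  proof -
    have "((\<lambda>t. eval_fps a (\<xi> + t)) has_field_derivative eval_fps (fps_deriv a) (\<xi> + t) * 1) (at t)"
      using that
      by (intro DERIV_chain2[of "eval_fps a"] has_field_derivative_eval_fps) (auto intro!: derivative_eq_intros)
    then show ?thesis
      by (simp add: DERIV_imp_deriv)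
  qed
  then show "\<forall>\<^sub>F t in nhds 0. eval_fps (fps_deriv a) (\<xi> + t) = deriv (\<lambda>t. eval_fps a (\<xi> + t)) t"
    by (rule eventually_mono[OF conv_at_nhd(2)[OF assms]])
qed

lemma taylor_nth_0: "a \<in> conv_at \<xi> \<Longrightarrow> fps_nth (taylor \<xi> a) 0 = eval_fps a \<xi>"
  using fps_nth_fps_expansion[OF taylor_expansion, of a \<xi> 0] by simp

lemma taylor_poly: "taylor \<xi> (fps_of_poly p) = fps_of_poly (p \<circ>\<^sub>p [:\<xi>, 1:])"
proof (rule taylor_eqI[OF conv_at_poly])
  show "eval_fps (fps_of_poly (p \<circ>\<^sub>p [:\<xi>, 1:])) has_fps_expansion fps_of_poly (p \<circ>\<^sub>p [:\<xi>, 1:])"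
    by (rule eval_fps_has_fps_expansion) simp
qed (simp add: poly_pcompose)

text \<open>The identity theorem on the disc of convergence.\<close>

lemma taylor_eq_0_iff:
  assumes a: "a \<in> conv_at \<xi>"
  shows "taylor \<xi> a = 0 \<longleftrightarrow> a = 0"
proof
  assume "taylor \<xi> a = 0"
  then have "\<forall>\<^sub>F t in nhds 0. eval_fps a (\<xi> + t) = 0"
  proof -
    have "\<forall>\<^sub>F t in nhds 0. eval_fps (taylor \<xi> a) t = eval_fps a (\<xi> + t)"
      using taylor_expansion[OF a] by (simp add: has_fps_expansion_def)
    then show ?thesis
      by (rule eventually_mono) (simp add: \<open>taylor \<xi> a = 0\<close>)
  qed
  with conv_at_nhd(2)[OF a]
  have "\<forall>\<^sub>F t in nhds 0. ereal (norm (\<xi> + t)) < fps_conv_radius a \<and> eval_fps a (\<xi> + t) = 0"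
    by (rule eventually_conj)
  then obtain S where S: "open S" "0 \<in> S"
    "\<And>t. t \<in> S \<Longrightarrow> ereal (norm (\<xi> + t)) < fps_conv_radius a \<and> eval_fps a (\<xi> + t) = 0"
    unfolding eventually_nhds by blast
  let ?U = "(\<lambda>t. \<xi> + t) ` S"
  have zero: "eval_fps a z = 0" if "z \<in> eball 0 (fps_conv_radius a)" for z
  proof (rule analytic_continuation_open[of ?U "eball 0 (fps_conv_radius a)" "eval_fps a" "\<lambda>_. 0" z])
    show "open ?U"
      using S(1) by (rule open_translation)
  qed (use S that in \<open>auto intro!: holomorphic_intros\<close>)
  have pos: "fps_conv_radius a > 0"
    using a by (auto simp: conv_at_def intro: le_less_trans[of 0 "ereal (norm \<xi>)"])
  then have "\<forall>\<^sub>F z in nhds 0. z \<in> eball 0 (fps_conv_radius a)"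
    by (intro eventually_nhds_in_open) (auto simp: zero_ereal_def)
  then have "\<forall>\<^sub>F z in nhds 0. eval_fps a z = eval_fps 0 z"
    by (rule eventually_mono) (use zero in auto)
  then show "a = 0"
    using pos by (intro eval_fps_eqD) auto
next
  assume "a = 0"
  then show "taylor \<xi> a = 0"
    using taylor_poly[of \<xi> 0] by simp
qed

subsection \<open>The change of base point as a homomorphism of fields\<close>

definition meromorphic_at :: "complex \<Rightarrow> complex fls set" where
  "meromorphic_at \<xi> = {fps_to_fls a / fps_to_fls b |a b. a \<in> conv_at \<xi> \<and> b \<in> conv_at \<xi> \<and> b \<noteq> 0}"

text \<open>
  Passing from the expansion at \<open>0\<close> to the expansion at \<open>\<xi>\<close>. The Laurent series of a quotient need
  not converge at \<open>\<xi>\<close>, so numerator and denominator are expanded separately.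
\<close>

definition rebase :: "complex \<Rightarrow> complex fls \<Rightarrow> complex fls" where
  "rebase \<xi> x = (THE x'. \<exists>a b. a \<in> conv_at \<xi> \<and> b \<in> conv_at \<xi> \<and> b \<noteq> 0 \<and>
     x = fps_to_fls a / fps_to_fls b \<and> x' = fps_to_fls (taylor \<xi> a) / fps_to_fls (taylor \<xi> b))"

lemma rebase_divide:
  assumes "a \<in> conv_at \<xi>" "b \<in> conv_at \<xi>" "b \<noteq> 0"
  shows "rebase \<xi> (fps_to_fls a / fps_to_fls b) = fps_to_fls (taylor \<xi> a) / fps_to_fls (taylor \<xi> b)"
  unfolding rebase_def
proof (rule the_equality)
  fix x'
  assume "\<exists>c d. c \<in> conv_at \<xi> \<and> d \<in> conv_at \<xi> \<and> d \<noteq> 0 \<and>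
     fps_to_fls a / fps_to_fls b = fps_to_fls c / fps_to_fls d \<and> x' = fps_to_fls (taylor \<xi> c) / fps_to_fls (taylor \<xi> d)"
  then obtain c d where *: "c \<in> conv_at \<xi>" "d \<in> conv_at \<xi>" "d \<noteq> 0"
    "fps_to_fls a / fps_to_fls b = fps_to_fls c / fps_to_fls d" "x' = fps_to_fls (taylor \<xi> c) / fps_to_fls (taylor \<xi> d)"
    by blast
  then have "fps_to_fls (a * d) = fps_to_fls (c * b)"
    using assms(3) by (simp add: frac_eq_eq fls_times_fps_to_fls)
  then have "a * d = c * b"
    by (simp only: fps_to_fls_eq_iff)
  then have "taylor \<xi> a * taylor \<xi> d = taylor \<xi> c * taylor \<xi> b"
    using assms * by (metis taylor_mult)
  then have "fps_to_fls (taylor \<xi> a) * fps_to_fls (taylor \<xi> d) = fps_to_fls (taylor \<xi> c) * fps_to_fls (taylor \<xi> b)"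
    by (simp flip: fls_times_fps_to_fls)
  then show "x' = fps_to_fls (taylor \<xi> a) / fps_to_fls (taylor \<xi> b)"
    using assms * by (simp add: frac_eq_eq taylor_eq_0_iff)
qed (use assms in blast)

lemma one_conv_at: "1 \<in> conv_at \<xi>" and taylor_one: "taylor \<xi> 1 = 1"
  using conv_at_poly[of 1 \<xi>] taylor_poly[of \<xi> 1] by (simp_all add: pcompose_1)

lemma meromorphic_atI: "a \<in> conv_at \<xi> \<Longrightarrow> fps_to_fls a \<in> meromorphic_at \<xi>"
  unfolding meromorphic_at_def using one_conv_at by (intro CollectI exI[of _ a] exI[of _ 1]) simp

lemma rebase_fps: "a \<in> conv_at \<xi> \<Longrightarrow> rebase \<xi> (fps_to_fls a) = fps_to_fls (taylor \<xi> a)"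
  using rebase_divide[of a \<xi> 1] one_conv_at taylor_one by simp

lemma is_subfield_meromorphic_at: "is_subfield (meromorphic_at \<xi>)"
  unfolding meromorphic_at_def
proof (rule is_subfield_fractions)
  show "a - b \<in> conv_at \<xi>" if "a \<in> conv_at \<xi>" "b \<in> conv_at \<xi>" for a b
    using conv_at_add[OF that(1) conv_at_uminus[OF that(2)]] by simp
qed (auto simp: fls_times_fps_to_fls intro: one_conv_at conv_at_mult)

lemma field_hom_rebase: "field_hom_on (meromorphic_at \<xi>) (rebase \<xi>)"
  unfolding field_hom_on_def
proof (intro conjI ballI)
  show "rebase \<xi> 1 = 1"
    using rebase_fps[OF one_conv_at[of \<xi>]] by (simp add: taylor_one)
  fix x y
  assume "x \<in> meromorphic_at \<xi>" "y \<in> meromorphic_at \<xi>"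
  then obtain a b c d where *: "a \<in> conv_at \<xi>" "b \<in> conv_at \<xi>" "b \<noteq> 0" "x = fps_to_fls a / fps_to_fls b"
    "c \<in> conv_at \<xi>" "d \<in> conv_at \<xi>" "d \<noteq> 0" "y = fps_to_fls c / fps_to_fls d"
    unfolding meromorphic_at_def by blast
  note mult = fls_times_fps_to_fls taylor_mult conv_at_mult
  have "x + y = fps_to_fls (a * d + c * b) / fps_to_fls (b * d)"
    using * by (simp add: add_frac_eq mult)
  then have "rebase \<xi> (x + y) = fps_to_fls (taylor \<xi> (a * d + c * b)) / fps_to_fls (taylor \<xi> (b * d))"
    using * by (simp only: rebase_divide conv_at_add conv_at_mult mult_eq_0_iff not_False_eq_True simp_thms)
  also have "\<dots> = rebase \<xi> x + rebase \<xi> y"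
    using * by (simp add: rebase_divide taylor_add mult add_frac_eq taylor_eq_0_iff)
  finally show "rebase \<xi> (x + y) = rebase \<xi> x + rebase \<xi> y" .
  have "x * y = fps_to_fls (a * c) / fps_to_fls (b * d)"
    using * by (simp add: mult)
  then have "rebase \<xi> (x * y) = fps_to_fls (taylor \<xi> (a * c)) / fps_to_fls (taylor \<xi> (b * d))"
    using * by (simp only: rebase_divide conv_at_mult mult_eq_0_iff not_False_eq_True simp_thms)
  also have "\<dots> = rebase \<xi> x * rebase \<xi> y"
    using * by (simp add: rebase_divide mult)
  finally show "rebase \<xi> (x * y) = rebase \<xi> x * rebase \<xi> y" .
qed

section \<open>Lifting relations between initial values\<close>

text \<open>
  \<open>forms_over k n f d\<close> is the \<open>k[[t]]\<close>-module spanned by the values of the forms of degree \<open>d\<close>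
  in \<open>f\<close>.
\<close>

inductive_set forms_over :: "'a::field set \<Rightarrow> nat \<Rightarrow> (nat \<Rightarrow> 'a fps) \<Rightarrow> nat \<Rightarrow> 'a fps set"
  for k n f d where
  forms_zero: "0 \<in> forms_over k n f d"
| forms_step: "w \<in> fps_over k \<Longrightarrow> keys m \<subseteq> {..<n} \<Longrightarrow> mdeg m = d \<Longrightarrow>
    v \<in> forms_over k n f d \<Longrightarrow> w * mon f m + v \<in> forms_over k n f d"

context
  fixes k :: "'a::field set" and n :: nat and f :: "nat \<Rightarrow> 'a fps"
  assumes k: "is_subfield k"
begin

lemma forms_single:
  assumes "w \<in> fps_over k" "keys m \<subseteq> {..<n}" "mdeg m = d"
  shows "w * mon f m \<in> forms_over k n f d"
  using forms_step[OF assms forms_zero] by simp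

lemma forms_mon: "keys m \<subseteq> {..<n} \<Longrightarrow> mon f m \<in> forms_over k n f (mdeg m)"
  using forms_single[OF fps_over_one[OF k]] by fastforce

lemma forms_add:
  assumes "v \<in> forms_over k n f d" "w \<in> forms_over k n f d"
  shows "v + w \<in> forms_over k n f d"
  using assms by induction (auto intro: forms_step simp: add.assoc)

lemma forms_sum: "(\<And>i. i \<in> A \<Longrightarrow> g i \<in> forms_over k n f d) \<Longrightarrow> sum g A \<in> forms_over k n f d"
  by (induction A rule: infinite_finite_induct) (auto intro: forms_add forms_zero)

lemma forms_mult_single:
  assumes w: "w \<in> fps_over k" "keys m \<subseteq> {..<n}" "mdeg m = d" and "v \<in> forms_over k n f e"
  shows "w * mon f m * v \<in> forms_over k n f (d + e)"
  using assms(4)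
proof induction
  case (forms_step w' m' v)
  have "w * mon f m * (w' * mon f m' + v) = w * w' * mon f (m + m') + w * mon f m * v"
    by (simp add: mon_add algebra_simps)
  also have "\<dots> \<in> forms_over k n f (d + e)"
    using forms_step w keys_add[of m m']
    by (intro forms_over.forms_step fps_over_mult[OF k]) (auto simp: mdeg_add)
  finally show ?case .
qed (simp add: forms_zero)

lemma forms_mult:
  assumes "v \<in> forms_over k n f d" "w \<in> forms_over k n f e"
  shows "v * w \<in> forms_over k n f (d + e)"
  using assms(1) by induction (auto simp: distrib_right intro: forms_zero forms_add forms_mult_single assms(2))

lemma forms_scale:
  assumes "w \<in> fps_over k" "v \<in> forms_over k n f d"
  shows "w * v \<in> forms_over k n f d"
  using forms_mult_single[of w 0 0 v d] assms by simp

lemma forms_coefficients: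
  assumes "v \<in> forms_over k n f d"
  shows "\<exists>P. P \<in> mpoly_ring (fps_over k) {..<n} \<and> homogeneous d P \<and> v = mpoly_eval f P"
  using assms
proof induction
  case forms_zero
  show ?case
    by (intro exI[of _ 0]) (simp add: mpoly_ring_def homogeneous_mdeg mpoly_eval_mon fps_over_zero[OF k])
next
  case (forms_step w m v)
  then obtain P where P: "P \<in> mpoly_ring (fps_over k) {..<n}" "homogeneous d P" "v = mpoly_eval f P"
    by blast
  let ?A = "insert m (keys P)"
  let ?P = "mpoly_of ?A (\<lambda>m'. lookup P m' + (if m' = m then w else 0))"
  have "v = (\<Sum>m'\<in>?A. lookup P m' * mon f m')"
    unfolding P(3) by (rule mpoly_eval_superset) auto
  moreover have "w * mon f m = (\<Sum>m'\<in>?A. if m' = m then w * mon f m' else 0)"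
    by simp
  ultimately have "w * mon f m + v = (\<Sum>m'\<in>?A. (lookup P m' + (if m' = m then w else 0)) * mon f m')"
    by (simp only: sum.distrib[symmetric]) (intro sum.cong, auto simp: algebra_simps)
  then have "w * mon f m + v = mpoly_eval f ?P"
    by (simp add: mpoly_eval_mpoly_of)
  moreover have "?P \<in> mpoly_ring (fps_over k) {..<n}"
    using P(1) forms_step.hyps
    by (intro mpoly_of_in_mpoly_ring)
      (auto simp: mpoly_ring_def fps_over_zero[OF k] intro!: fps_over_add[OF k])
  moreover have "homogeneous d ?P"
    using keys_mpoly_of[of ?A "\<lambda>m'. lookup P m' + (if m' = m then w else 0)"] P(2) forms_step.hyps
    by (auto simp: homogeneous_mdeg)
  ultimately show ?case
    by blast
qed

text \<open>
  Since \<open>f(0) = \<zeta> f\<close> with \<open>\<zeta>\<close> congruent to the unit matrix, \<open>m(f(0))\<close> and \<open>m(f)\<close> are congruent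
  modulo \<open>t\<close>, as \<open>k[[t]]\<close>-combinations of forms in \<open>f\<close>, for every monomial \<open>m\<close>.
\<close>

lemma mon_initial_values:
  assumes \<zeta>: "\<And>i. i < n \<Longrightarrow> \<exists>\<zeta>. (\<forall>j. \<zeta> j \<in> fps_over k \<and> fps_nth (\<zeta> j) 0 = (if j = i then 1 else 0)) \<and>
        fps_const (fps_nth (f i) 0) = (\<Sum>j<n. \<zeta> j * f j)"
    and m: "keys m \<subseteq> {..<n}"
  shows "\<exists>v\<in>forms_over k n f (mdeg m).
    fps_const (mon (\<lambda>i. fps_nth (f i) 0) m) = mon f m + fps_X * v"
  using m
proof (induction "mdeg m" arbitrary: m)
  case 0
  then have "m = 0"
    by (intro poly_mapping_eqI) (auto simp: mdeg_def in_keys_iff)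
  then show ?case
    by (intro bexI[of _ 0]) (simp_all add: forms_zero)
next
  case (Suc d)
  have "m \<noteq> 0"
    using Suc.hyps(2) by auto
  then have "keys m \<noteq> {}"
    by simp
  then obtain i where i: "i \<in> keys m"
    by blast
  define m' where "m' = m - single i 1"
  have m_eq: "m = m' + single i 1"
    using i by (intro poly_mapping_eqI)
      (auto simp: m'_def lookup_add lookup_minus lookup_single when_def in_keys_iff)
  have keys_m': "keys m' \<subseteq> {..<n}"
  proof -
    have "keys m' \<subseteq> keys m"
      by (auto simp: m'_def in_keys_iff lookup_minus)
    then show ?thesis
      using Suc.prems by blast
  qed
  have i_n: "i < n"
    using i Suc.prems by blast
  have d: "d = mdeg m'"
    using Suc.hyps(2) by (subst (asm) m_eq) (simp add: mdeg_add)
  obtain v where v: "v \<in> forms_over k n f d"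
    "fps_const (mon (\<lambda>i. fps_nth (f i) 0) m') = mon f m' + fps_X * v"
    using Suc.hyps(1)[OF d keys_m'] d by blast
  obtain \<zeta> where \<zeta>: "\<And>j. \<zeta> j \<in> fps_over k" "\<And>j. fps_nth (\<zeta> j) 0 = (if j = i then 1 else 0)"
    "fps_const (fps_nth (f i) 0) = (\<Sum>j<n. \<zeta> j * f j)"
    using assms(1)[OF i_n] by blast
  define w where "w = (\<Sum>j<n. fps_shift 1 (\<zeta> j) * f j)"
  have f_form: "f j \<in> forms_over k n f 1" if "j < n" for j
    using forms_mon[of "single j 1"] that by simp
  have w: "w \<in> forms_over k n f 1"
    unfolding w_def using \<zeta>(1) f_form
    by (intro forms_sum forms_scale) (auto simp: fps_over_def)
  have split: "\<zeta> j = fps_const (if j = i then 1 else 0) + fps_X * fps_shift 1 (\<zeta> j)" for j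
    by (rule fps_ext) (auto simp: \<zeta>(2) fps_X_mult_nth simp del: fps_const_0_eq_0 fps_const_1_eq_1)
  have "\<zeta> j * f j = (if j = i then f j else 0) + fps_X * (fps_shift 1 (\<zeta> j) * f j)" for j
    by (subst split[of j]) (simp add: distrib_right mult.assoc)
  then have ci: "fps_const (fps_nth (f i) 0) = f i + fps_X * w"
    using \<zeta>(3) i_n by (simp add: sum.distrib w_def sum_distrib_left)
  define u where "u = v * f i + mon f m' * w + fps_X * (v * w)"
  have fX: "fps_X \<in> fps_over k"
    by (auto simp: fps_over_def fps_X_def subfield_one[OF k] subfield_zero[OF k])
  have "u \<in> forms_over k n f (d + 1)"
    unfolding u_def using v(1) w f_form[OF i_n] forms_mon[OF keys_m'] d fX
    by (intro forms_add forms_scale forms_mult) auto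
  moreover have "fps_const (mon (\<lambda>i. fps_nth (f i) 0) m) = mon f m + fps_X * u"
  proof -
    have "fps_const (mon (\<lambda>i. fps_nth (f i) 0) m)
      = fps_const (mon (\<lambda>i. fps_nth (f i) 0) m') * fps_const (fps_nth (f i) 0)"
      by (subst m_eq) (simp add: mon_add)
    also have "\<dots> = (mon f m' + fps_X * v) * (f i + fps_X * w)"
      by (simp only: v(2) ci)
    also have "\<dots> = mon f m' * f i + fps_X * u"
      by (simp add: u_def algebra_simps)
    also have "mon f m' * f i = mon f m"
      using arg_cong[OF m_eq, of "mon f"] by (simp add: mon_add)
    finally show ?thesis .
  qed
  ultimately show ?case
    using Suc.hyps(2) by auto
qed

text \<open>
  Replacing each monomial in \<open>f(0)\<close> by the congruent combination of forms of the same degree in \<open>f\<close>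
  leaves the constant terms of the coefficients unchanged.
\<close>

lemma relation_of_initial_values:
  assumes \<zeta>: "\<And>i. i < n \<Longrightarrow> \<exists>\<zeta>. (\<forall>j. \<zeta> j \<in> fps_over k \<and> fps_nth (\<zeta> j) 0 = (if j = i then 1 else 0)) \<and>
        fps_const (fps_nth (f i) 0) = (\<Sum>j<n. \<zeta> j * f j)"
    and Q: "Q \<in> poly_relations k {..<n} (\<lambda>i. fps_nth (f i) 0)"
  obtains A g where "finite A" "keys Q \<subseteq> A"
    "\<And>m. m \<in> A \<Longrightarrow> keys m \<subseteq> {..<n} \<and> mdeg m \<in> mdeg ` keys Q"
    "\<And>m. g m \<in> fps_over k" "\<And>m. fps_nth (g m) 0 = lookup Q m"
    "(\<Sum>m\<in>A. g m * mon f m) = 0"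
proof -
  let ?c = "\<lambda>i. fps_nth (f i) 0" and ?Q = "keys Q" and ?q = "\<lambda>m. fps_const (lookup Q m)"
  have keys: "keys m \<subseteq> {..<n}" if "m \<in> ?Q" for m
    using Q that by (auto simp: poly_relations_def mpoly_ring_def)
  have q: "?q m \<in> fps_over k" for m
    using Q by (intro fps_over_const[OF k]) (auto simp: poly_relations_def mpoly_ring_def)
  have "\<forall>m\<in>?Q. \<exists>v. v \<in> forms_over k n f (mdeg m) \<and> fps_const (mon ?c m) = mon f m + fps_X * v"
    using mon_initial_values[OF \<zeta> keys] by blast
  then obtain v where "\<forall>m\<in>?Q. v m \<in> forms_over k n f (mdeg m) \<and> fps_const (mon ?c m) = mon f m + fps_X * v m"
    by (rule bchoice[THEN exE])
  then have v: "v m \<in> forms_over k n f (mdeg m)" "fps_const (mon ?c m) = mon f m + fps_X * v m" if "m \<in> ?Q" for m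
    using that by blast+
  have "\<forall>m\<in>?Q. \<exists>W. W \<in> mpoly_ring (fps_over k) {..<n} \<and> homogeneous (mdeg m) W \<and> v m = mpoly_eval f W"
    using forms_coefficients[OF v(1)] by blast
  then obtain W where "\<forall>m\<in>?Q. W m \<in> mpoly_ring (fps_over k) {..<n} \<and> homogeneous (mdeg m) (W m) \<and> v m = mpoly_eval f (W m)"
    by (rule bchoice[THEN exE])
  then have W: "W m \<in> mpoly_ring (fps_over k) {..<n}" "homogeneous (mdeg m) (W m)" "v m = mpoly_eval f (W m)"
    if "m \<in> ?Q" for m
    using that by blast+
  define A where "A = ?Q \<union> (\<Union>m\<in>?Q. keys (W m))"
  define g where "g m' = ?q m' + fps_X * (\<Sum>m\<in>?Q. ?q m * lookup (W m) m')" for m'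
  have fX: "fps_X \<in> fps_over k"
    by (auto simp: fps_over_def fps_X_def subfield_one[OF k] subfield_zero[OF k])
  have finA: "finite A"
    by (simp add: A_def)
  have v_A: "v m = (\<Sum>m'\<in>A. lookup (W m) m' * mon f m')" if "m \<in> ?Q" for m
    unfolding W(3)[OF that] using that finA by (intro mpoly_eval_superset) (auto simp: A_def)
  show thesis
  proof (rule that[of A g])
    show "finite A" by fact
    show "?Q \<subseteq> A"
      by (simp add: A_def)
    show "keys m \<subseteq> {..<n} \<and> mdeg m \<in> mdeg ` ?Q" if "m \<in> A" for m
    proof (cases "m \<in> ?Q")
      case False
      then obtain m0 where m0: "m0 \<in> ?Q" "m \<in> keys (W m0)"
        using \<open>m \<in> A\<close> by (auto simp: A_def)
      then have "keys m \<subseteq> {..<n}" "mdeg m = mdeg m0"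
        using W(1,2)[OF m0(1)] by (auto simp: mpoly_ring_def homogeneous_mdeg)
      then show ?thesis
        using m0(1) by simp
    qed (use keys in blast)
    show "g m \<in> fps_over k" for m
      unfolding g_def using q fX W(1)
      by (intro fps_over_add[OF k] fps_over_mult[OF k] fps_over_sum[OF k]) (auto simp: mpoly_ring_def)
    show "fps_nth (g m) 0 = lookup Q m" for m
      by (simp add: g_def)
    have "(\<Sum>m\<in>A. g m * mon f m) = (\<Sum>m\<in>A. ?q m * mon f m) + fps_X * (\<Sum>m'\<in>A. \<Sum>m\<in>?Q. ?q m * lookup (W m) m' * mon f m')"
      by (simp add: g_def distrib_right sum.distrib sum_distrib_left sum_distrib_right mult.assoc)
    also have "(\<Sum>m'\<in>A. \<Sum>m\<in>?Q. ?q m * lookup (W m) m' * mon f m') = (\<Sum>m\<in>?Q. ?q m * v m)"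
      by (subst sum.swap) (simp add: v_A sum_distrib_left mult.assoc)
    also have "(\<Sum>m\<in>A. ?q m * mon f m) = (\<Sum>m\<in>?Q. ?q m * mon f m)"
      using finA by (intro sum.mono_neutral_right) (auto simp: A_def in_keys_iff)
    also have "(\<Sum>m\<in>?Q. ?q m * mon f m) + fps_X * (\<Sum>m\<in>?Q. ?q m * v m) = (\<Sum>m\<in>?Q. ?q m * (mon f m + fps_X * v m))"
      by (simp add: distrib_left sum.distrib sum_distrib_left mult_ac)
    also have "\<dots> = (\<Sum>m\<in>?Q. ?q m * fps_const (mon ?c m))"
      using v(2) by simp
    also have "\<dots> = fps_const (mpoly_eval ?c Q)"
    proof -
      have "fps_const (sum h B) = (\<Sum>m\<in>B. fps_const (h m))" for h :: "(nat \<Rightarrow>\<^sub>0 nat) \<Rightarrow> 'a" and B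
        by (induction B rule: infinite_finite_induct) (simp_all flip: fps_const_add)
      then show ?thesis
        by (simp add: mpoly_eval_mon)
    qed
    also have "\<dots> = 0"
      using Q by (simp add: poly_relations_def)
    finally show "(\<Sum>m\<in>A. g m * mon f m) = 0" .
  qed
qed

end

text \<open>
  If a relation over \<open>k[[t]]\<close> is a combination of relations over \<open>k(t)\<close>, then truncating the
  coefficients of the combination gives a relation over \<open>k[t]\<close> with the same constant terms. The
  order of truncation has to exceed the order \<open>N\<close> at \<open>0\<close> of a common denominator, because the
  truncated relation is finally divided by the leading term of this denominator.
\<close>

lemma truncated_relation:
  fixes v :: "'m \<Rightarrow> complex fls"
  assumes A: "finite A" and g: "\<And>m. g m \<in> fps_over Qbar" and J: "J \<subseteq> A"
    and w: "\<And>j m. j \<in> J \<Longrightarrow> m \<in> A \<Longrightarrow> w j m \<in> Qbar_ratfun"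
    and gw: "\<And>m. m \<in> A \<Longrightarrow> fps_to_fls (g m) = (\<Sum>j\<in>J. fps_to_fls (g j) * w j m)"
    and rel: "\<And>j. j \<in> J \<Longrightarrow> (\<Sum>m\<in>A. w j m * v m) = 0"
  obtains p where "\<And>m. p m \<in> Qbar_poly" "\<And>m. m \<in> A \<Longrightarrow> coeff (p m) 0 = fps_nth (g m) 0"
    "(\<Sum>m\<in>A. fls_of_poly (p m) * v m) = 0"
proof -
  let ?W = "(\<lambda>(j, m). w j m) ` (J \<times> A)"
  have "finite J"
    using A J finite_subset by blast
  have "\<exists>q\<in>Qbar_poly. q \<noteq> 0 \<and> (\<forall>s\<in>?W. \<exists>r\<in>Qbar_poly. fls_of_poly q * s = fls_of_poly r)"
  proof (rule common_denominator)
    show "?W \<subseteq> {fls_of_poly a / fls_of_poly b |a b. a \<in> Qbar_poly \<and> b \<in> Qbar_poly \<and> b \<noteq> 0}"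
      unfolding Qbar_ratfun_def[symmetric] using w by auto
  qed (use A \<open>finite J\<close> in \<open>auto simp: fls_of_poly_mult fls_of_poly_eq_0_iff intro: Qbar_poly_one Qbar_poly_mult\<close>)
  then obtain q where q: "q \<in> Qbar_poly" "q \<noteq> 0"
    "\<And>s. s \<in> ?W \<Longrightarrow> \<exists>r\<in>Qbar_poly. fls_of_poly q * s = fls_of_poly r"
    by blast
  let ?d = "fls_of_poly q"
  have "\<forall>jm\<in>J \<times> A. \<exists>r. r \<in> Qbar_poly \<and> ?d * w (fst jm) (snd jm) = fls_of_poly r"
    using q(3) by fastforce
  then obtain r where "\<forall>jm\<in>J \<times> A. r jm \<in> Qbar_poly \<and> ?d * w (fst jm) (snd jm) = fls_of_poly (r jm)"
    by (rule bchoice[THEN exE])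
  then have r: "r (j, m) \<in> Qbar_poly" "fls_of_poly (r (j, m)) = ?d * w j m" if "j \<in> J" "m \<in> A" for j m
    using that by force+
  define N where "N = subdegree (fps_of_poly q)"
  have q0: "fps_of_poly q \<noteq> 0"
    using q(2) fps_of_poly_eq_iff[of q 0] by simp
  have qN: "coeff q N \<noteq> 0"
    using nth_subdegree_nonzero[OF q0] by (simp add: N_def)
  have q_less: "coeff q i = 0" if "i < N" for i
    using nth_less_subdegree_zero[of i "fps_of_poly q"] that by (simp add: N_def)
  define P where "P m = (if m \<in> A then \<Sum>j\<in>J. truncate_fps (Suc N) (g j) * r (j, m) else 0)" for m
  have P: "P m \<in> Qbar_poly" for m
    using g r(1) by (auto simp: P_def intro!: Qbar_poly_sum Qbar_poly_mult Qbar_poly_truncate Qbar_poly_zero)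
  have qg: "fps_of_poly q * g m = (\<Sum>j\<in>J. g j * fps_of_poly (r (j, m)))" if "m \<in> A" for m
  proof -
    have "fps_to_fls (fps_of_poly q * g m) = (\<Sum>j\<in>J. fps_to_fls (g j) * (?d * w j m))"
      using gw[OF that] by (simp add: fls_times_fps_to_fls fls_of_poly_def sum_distrib_left mult_ac)
    also have "\<dots> = (\<Sum>j\<in>J. fps_to_fls (g j) * fls_of_poly (r (j, m)))"
      using r(2) that by simp
    also have "\<dots> = fps_to_fls (\<Sum>j\<in>J. g j * fps_of_poly (r (j, m)))"
      by (simp add: fps_to_fls_sum fls_times_fps_to_fls fls_of_poly_def)
    finally show ?thesis
      by (simp only: fps_to_fls_eq_iff)
  qed
  have coeff_P: "coeff (P m) i = fps_nth (fps_of_poly q * g m) i" if "m \<in> A" "i \<le> N" for m i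
  proof -
    have "coeff (P m) i = (\<Sum>j\<in>J. \<Sum>l\<le>i. coeff (truncate_fps (Suc N) (g j)) l * coeff (r (j, m)) (i - l))"
      using that(1) by (simp add: P_def coeff_sum coeff_mult)
    also have "\<dots> = (\<Sum>j\<in>J. \<Sum>l\<le>i. fps_nth (g j) l * coeff (r (j, m)) (i - l))"
      using that(2) by (intro sum.cong) (auto simp: coeff_truncate_fps)
    also have "\<dots> = fps_nth (fps_of_poly q * g m) i"
      by (simp add: qg[OF that(1)] fps_sum_nth fps_mult_nth atLeast0AtMost)
    finally show ?thesis .
  qed
  define p where "p m = smult (inverse (coeff q N)) (poly_shift N (P m))" for m
  have "p m \<in> Qbar_poly" for m
    using P[of m] q(1)
    by (auto simp: p_def Qbar_poly_def coeff_poly_shift intro!: subfield_mult[OF is_subfield_Qbar] subfield_inverse[OF is_subfield_Qbar])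
  moreover have "coeff (p m) 0 = fps_nth (g m) 0" if "m \<in> A" for m
  proof -
    have "coeff (P m) N = (\<Sum>l=0..N. coeff q l * fps_nth (g m) (N - l))"
      using coeff_P[OF that] by (simp add: fps_mult_nth)
    also have "\<dots> = (\<Sum>l\<in>{N}. coeff q l * fps_nth (g m) (N - l))"
      using q_less by (intro sum.mono_neutral_right) auto
    finally show ?thesis
      using qN by (simp add: p_def coeff_poly_shift)
  qed
  moreover have "(\<Sum>m\<in>A. fls_of_poly (p m) * v m) = 0"
  proof -
    have P_eq: "P m = smult (coeff q N) (monom 1 N * p m)" if "m \<in> A" for m
    proof (rule poly_eqI)
      fix i
      have "coeff (P m) i = 0" if "i < N"
      proof -
        have "coeff (P m) i = (\<Sum>l=0..i. coeff q l * fps_nth (g m) (i - l))"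
          using coeff_P[OF \<open>m \<in> A\<close>, of i] that by (simp add: fps_mult_nth)
        also have "\<dots> = 0"
          using q_less that by (intro sum.neutral) auto
        finally show ?thesis .
      qed
      then show "coeff (P m) i = coeff (smult (coeff q N) (monom 1 N * p m)) i"
        using qN by (auto simp: coeff_monom_mult p_def coeff_poly_shift)
    qed
    have "(\<Sum>m\<in>A. fls_of_poly (P m) * v m) = (\<Sum>m\<in>A. \<Sum>j\<in>J. fls_of_poly (truncate_fps (Suc N) (g j)) * (?d * w j m) * v m)"
    proof (rule sum.cong)
      fix m
      assume m: "m \<in> A"
      have "fls_of_poly (P m) = (\<Sum>j\<in>J. fls_of_poly (truncate_fps (Suc N) (g j)) * fls_of_poly (r (j, m)))"
        using m by (simp add: P_def fls_of_poly_def fps_of_poly_sum fps_to_fls_sum fps_of_poly_mult fls_times_fps_to_fls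
            del: fps_of_poly_truncate)
      then show "fls_of_poly (P m) * v m = (\<Sum>j\<in>J. fls_of_poly (truncate_fps (Suc N) (g j)) * (?d * w j m) * v m)"
        using r(2) m by (simp add: sum_distrib_right)
    qed simp
    also have "\<dots> = (\<Sum>j\<in>J. fls_of_poly (truncate_fps (Suc N) (g j)) * ?d * (\<Sum>m\<in>A. w j m * v m))"
      by (subst sum.swap) (simp add: sum_distrib_left mult.assoc)
    also have "\<dots> = 0"
      using rel by simp
    finally have "0 = (\<Sum>m\<in>A. fls_of_poly (P m) * v m)" ..
    also have "\<dots> = (\<Sum>m\<in>A. fls_of_poly (smult (coeff q N) (monom 1 N)) * (fls_of_poly (p m) * v m))"
      using P_eq by (intro sum.cong) (simp_all add: fls_of_poly_mult mult.assoc flip: mult_smult_left)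
    finally have "fls_of_poly (smult (coeff q N) (monom 1 N)) * (\<Sum>m\<in>A. fls_of_poly (p m) * v m) = 0"
      by (simp add: sum_distrib_left)
    moreover have "fls_of_poly (smult (coeff q N) (monom 1 N)) \<noteq> 0"
      using qN by (simp add: fls_of_poly_eq_0_iff)
    ultimately show ?thesis
      by simp
  qed
  ultimately show ?thesis
    using that by blast
qed

text \<open>
  The monomials in \<open>f\<close> are required to lie in \<open>L\<close> only up to a common factor \<open>u\<close>: this covers the
  forms of degree \<open>d\<close> with \<open>u = f\<^sub>a\<^sup>d\<close> and \<open>L\<close> generated by the quotients \<open>f\<^sub>i / f\<^sub>a\<close>.
\<close>

theorem lift_relation:
  fixes f :: "nat \<Rightarrow> complex fps"
  assumes \<zeta>: "\<And>i. i < n \<Longrightarrow> \<exists>\<zeta>. (\<forall>j. \<zeta> j \<in> fps_over Qbar \<and> fps_nth (\<zeta> j) 0 = (if j = i then 1 else 0)) \<and>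
        fps_const (fps_nth (f i) 0) = (\<Sum>j<n. \<zeta> j * f j)"
    and Q: "Q \<in> poly_relations Qbar {..<n} (\<lambda>i. fps_nth (f i) 0)"
    and L: "is_subfield L" "Qbar_ratfun \<subseteq> L"
    and disj: "\<And>(A :: (nat \<Rightarrow>\<^sub>0 nat) set) e. e ` A \<subseteq> laurent_over Qbar \<Longrightarrow>
        lin_indep_over Qbar_ratfun A e \<Longrightarrow> lin_indep_over L A e"
    and u: "u \<noteq> 0" and mon_L: "\<And>m. keys m \<subseteq> {..<n} \<Longrightarrow> mdeg m \<in> mdeg ` keys Q \<Longrightarrow>
        mon (\<lambda>i. fps_to_fls (f i)) m / u \<in> L"
  obtains A p where "finite A" "keys Q \<subseteq> A"
    "\<And>m. m \<in> A \<Longrightarrow> keys m \<subseteq> {..<n} \<and> mdeg m \<in> mdeg ` keys Q"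
    "\<And>m. p m \<in> Qbar_poly" "\<And>m. m \<in> A \<Longrightarrow> coeff (p m) 0 = lookup Q m"
    "(\<Sum>m\<in>A. fls_of_poly (p m) * mon (\<lambda>i. fps_to_fls (f i)) m) = 0"
proof -
  obtain A g where A: "finite A" "keys Q \<subseteq> A"
    "\<And>m. m \<in> A \<Longrightarrow> keys m \<subseteq> {..<n} \<and> mdeg m \<in> mdeg ` keys Q"
    and g: "\<And>m. g m \<in> fps_over Qbar" "\<And>m. fps_nth (g m) 0 = lookup Q m"
    and rel: "(\<Sum>m\<in>A. g m * mon f m) = 0"
    by (rule relation_of_initial_values[OF is_subfield_Qbar \<zeta> Q]) (assumption, rule that)
  let ?v = "\<lambda>m. mon (\<lambda>i. fps_to_fls (f i)) m / u"
  have mon_f: "mon (\<lambda>i. fps_to_fls (f i)) m = fps_to_fls (mon f m)" for m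
  proof -
    have "(\<Prod>i\<in>B. fps_to_fls (f i) ^ e i) = fps_to_fls (\<Prod>i\<in>B. f i ^ e i)" for B and e :: "nat \<Rightarrow> nat"
      by (induction B rule: infinite_finite_induct) (simp_all add: fls_times_fps_to_fls fps_to_fls_power)
    then show ?thesis
      by (simp add: mon_def)
  qed
  have "(\<Sum>m\<in>A. fps_to_fls (g m) * ?v m) = fps_to_fls (\<Sum>m\<in>A. g m * mon f m) / u"
    by (simp add: mon_f fps_to_fls_sum fls_times_fps_to_fls sum_divide_distrib)
  then have rel': "(\<Sum>m\<in>A. fps_to_fls (g m) * ?v m) = 0"
    using rel by simp
  obtain J w where J: "J \<subseteq> A" "\<And>j m. j \<in> J \<Longrightarrow> m \<in> A \<Longrightarrow> w j m \<in> Qbar_ratfun"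
    "\<And>m. m \<in> A \<Longrightarrow> fps_to_fls (g m) = (\<Sum>j\<in>J. fps_to_fls (g j) * w j m)"
    "\<And>j. j \<in> J \<Longrightarrow> (\<Sum>m\<in>A. w j m * ?v m) = 0"
  proof (rule relation_descent[OF is_subfield_Qbar_ratfun A(1) _ L _ rel'])
    show "lin_indep_over L J (\<lambda>m. fps_to_fls (g m))"
      if "lin_indep_over Qbar_ratfun J (\<lambda>m. fps_to_fls (g m))" for J
      using that g(1) fps_over_imp_laurent_over[OF is_subfield_Qbar] by (intro disj) auto
    show "?v m \<in> L" if "m \<in> A" for m
      using A(3)[OF that] mon_L by blast
  qed (rule that)
  obtain p where p: "\<And>m. p m \<in> Qbar_poly" "\<And>m. m \<in> A \<Longrightarrow> coeff (p m) 0 = fps_nth (g m) 0"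
    "(\<Sum>m\<in>A. fls_of_poly (p m) * ?v m) = 0"
    by (rule truncated_relation[OF A(1) g(1) J]) (assumption+, rule that)
  have "(\<Sum>m\<in>A. fls_of_poly (p m) * mon (\<lambda>i. fps_to_fls (f i)) m) = u * (\<Sum>m\<in>A. fls_of_poly (p m) * ?v m)"
    using u by (simp add: sum_distrib_left)
  then show ?thesis
    using that[of A p] A p g(2) by simp
qed

section \<open>Linear disjointness from the transcendence degree of the values\<close>

text \<open>
  Independent constants \<open>z\<close> have dual derivations over \<open>laurent_over k\<close>. By exchange these can be
  combined to derivations dual to the \<open>g\<^sub>j\<close> with \<open>j\<close> in \<open>J\<close>, as required by the criterion. The
  assumption on \<open>D\<close> says that the constants \<open>z\<close> are algebraic over the field generated by
  \<open>laurent_over k\<close> and \<open>g\<close>.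
\<close>

theorem linearly_disjoint_of_values:
  fixes g :: "'n \<Rightarrow> 'a::field_char_0 fls" and z :: "'s \<Rightarrow> 'a"
  assumes k: "is_subfield k" and K: "is_subfield K" "K \<subseteq> laurent_over k"
    and closed: "\<And>u. u \<in> is_subfield hull (K \<union> g ` N) \<Longrightarrow> alg_over K u \<Longrightarrow> u \<in> K"
    and J: "J \<subseteq> N" "finite J" and alg: "\<And>i. i \<in> N \<Longrightarrow> alg_over (is_subfield hull (K \<union> g ` J)) (g i)"
    and z: "finite S" "alg_indep k S z" and card: "card J \<le> card S"
    and det: "\<And>D s. derivation D \<Longrightarrow> \<forall>a\<in>laurent_over k. D a = 0 \<Longrightarrow> \<forall>i\<in>N. D (g i) = 0 \<Longrightarrow> s \<in> S \<Longrightarrow>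
        D (fls_const (z s)) = 0"
    and e: "e ` A \<subseteq> laurent_over k" "lin_indep_over K A e"
  shows "lin_indep_over (is_subfield hull (K \<union> g ` N)) A e"
proof -
  let ?L = "is_subfield hull (K \<union> g ` N)" and ?M = "is_subfield hull (K \<union> g ` J)"
  have "alg_indep (laurent_over k) S (\<lambda>s. fls_const (z s))"
    by (rule alg_indep_constants[OF k z(2)])
  then obtain E where E: "dual_derivations (laurent_over k) S (\<lambda>s. fls_const (z s)) E"
    using alg_indep_iff_dual_derivations[OF is_subfield_laurent_over[OF k] z(1)] by blast
  have "\<exists>E. dual_derivations (laurent_over k) J g E"
  proof (rule dual_derivations_exchange[OF J(2) z(1) card E])
    fix D s
    assume D: "derivation D" "\<forall>a\<in>laurent_over k. D a = 0" "\<forall>i\<in>J. D (g i) = 0" and s: "s \<in> S"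
    have "?M \<subseteq> {x. D x = 0}"
      using D K(2) subfield_of_constants[OF D(1)] by (intro hull_minimal) auto
    then have "\<forall>i\<in>N. D (g i) = 0"
      using derivation_algebraic_zero[OF D(1) is_subfield_hull _ alg] by blast
    then show "D (fls_const (z s)) = 0"
      using det D(1,2) s by blast
  qed
  then obtain E' where E': "dual_derivations (laurent_over k) J g E'" ..
  have "g ` J \<subseteq> ?L"
    using J(1) hull_subset[of "K \<union> g ` N" is_subfield] by blast
  then show ?thesis
    using alg by (intro linearly_disjoint_criterion[OF K refl refl _ _ J(2) E' closed e]) auto
qed

section \<open>Transcendence degrees\<close>

text \<open>
  Some independent set has more elements than any bound strictly below the supremum, here \<open>r - 1\<close>;
  this is why \<open>r = 0\<close> is separate.
\<close>

lemma trdeg_geE: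
  assumes "enat r \<le> trdeg k B"
  obtains S where "finite S" "S \<subseteq> B" "alg_indep k S (\<lambda>x. x)" "r \<le> card S" | "r = 0"
proof (cases r)
  case (Suc r')
  then have "enat r' < trdeg k B"
    using assms by (metis enat_ord_simps(2) lessI less_le_trans)
  then obtain S where "finite S" "S \<subseteq> B" "alg_indep k S (\<lambda>x. x)" "r' < card S"
    unfolding trdeg_def less_SUP_iff by auto
  then show ?thesis
    using that(1) Suc by simp
qed (use that(2) in blast)

lemma card_le_trdeg:
  fixes f :: "'v \<Rightarrow> 'a::field_char_0"
  assumes k: "is_subfield k" and J: "finite J" "J \<subseteq> N" "alg_indep k J f"
  shows "enat (card J) \<le> trdeg k (adjoin_ring k N f)"
proof -
  have "f ` J \<in> {S. finite S \<and> S \<subseteq> adjoin_ring k N f \<and> alg_indep k S (\<lambda>x. x)}"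
  proof (intro CollectI conjI)
    show "f ` J \<subseteq> adjoin_ring k N f"
    proof safe
      fix j
      assume "j \<in> J"
      then show "f j \<in> adjoin_ring k N f"
        using J(2) by (intro adjoin_ring_gen[OF k]) blast
    qed
  qed (use J(1) alg_indep_image(1)[OF k J(1,3)] in simp_all)
  then have "enat (card (f ` J)) \<le> trdeg k (adjoin_ring k N f)"
    unfolding trdeg_def by (rule SUP_upper)
  then show ?thesis
    using card_image[OF alg_indep_image(2)[OF k J(1,3)]] by simp
qed

lemma hom_alg_indep_empty:
  assumes "is_subfield k"
  shows "hom_alg_indep k {} f"
  using alg_indep_empty[OF assms, of f] by (simp add: hom_alg_indep_def alg_indep_def)

lemma hom_trdeg_attained:
  assumes "is_subfield k"
  obtains J where "J \<subseteq> {..<n}" "hom_alg_indep k J f" "card J = hom_trdeg k n f"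
    "\<And>H. H \<subseteq> {..<n} \<Longrightarrow> hom_alg_indep k H f \<Longrightarrow> card H \<le> card J"
proof -
  let ?S = "{card J |J. J \<subseteq> {..<n} \<and> hom_alg_indep k J f}"
  have "?S \<subseteq> card ` Pow {..<n}"
    by blast
  then have fin: "finite ?S"
    by (rule finite_subset) simp
  moreover have "0 \<in> ?S"
    using hom_alg_indep_empty[OF assms, of f] by (intro CollectI exI[of _ "{}"]) simp
  ultimately have "Max ?S \<in> ?S"
    by (intro Max_in) auto
  then obtain J where J: "J \<subseteq> {..<n}" "hom_alg_indep k J f" "card J = hom_trdeg k n f"
    unfolding hom_trdeg_def by auto
  have "card H \<le> card J" if "H \<subseteq> {..<n}" "hom_alg_indep k H f" for H
    unfolding J(3) hom_trdeg_def using that fin by (intro Max_ge) auto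
  then show ?thesis
    using that J by blast
qed

lemma hom_alg_indep_nonzero:
  assumes k: "is_subfield k" and ind: "hom_alg_indep k J f" and a: "a \<in> J"
  shows "f a \<noteq> 0"
proof
  assume "f a = 0"
  let ?m = "single a 1 :: 'b \<Rightarrow>\<^sub>0 nat"
  have "lin_indep_over k {m. keys m \<subseteq> J \<and> mdeg m = 1} (mon f)"
    using ind by (simp add: hom_alg_indep_iff[OF subfield_zero[OF k]])
  then have "(1 :: 'a) = 0"
    by (rule lin_indep_overD[where B = "{?m}" and c = "\<lambda>_. 1" and i = ?m])
      (use a \<open>f a = 0\<close> subfield_one[OF k] in auto)
  then show False
    by simp
qed

lemma hom_alg_indep_singleton:
  assumes k: "is_subfield k" and a: "f a \<noteq> 0"
  shows "hom_alg_indep k {a} f"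
  using hom_alg_indep_iff_quotients[OF subfield_zero[OF k], of a "{a}" f] alg_indep_empty[OF k] a
  by simp

section \<open>Solutions of linear differential equations\<close>

context
  fixes T :: "complex poly" and y :: "complex fps" and n :: nat
    and b :: "nat \<Rightarrow> complex fls" and \<xi> :: complex
  assumes T: "T \<in> Qbar_poly" "T \<noteq> 0"
    and b: "\<And>i. i < n \<Longrightarrow> b i \<in> Qbar_poly_inv T"
    and ode: "deriv_fls y n + (\<Sum>i<n. b i * deriv_fls y i) = 0"
    and closed: "algebraically_closed_in Qbar_ratfun (adjoin_field Qbar_ratfun {..<n} (deriv_fls y))"
    and \<xi>: "\<xi> \<in> Qbar"
    and conv: "ereal (norm \<xi>) < fps_conv_radius y"
    and T_\<xi>: "poly T \<xi> \<noteq> 0"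
begin

abbreviation (input) "F \<equiv> \<lambda>i. taylor \<xi> (fps_nth_deriv i y)"

abbreviation (input) "f \<equiv> \<lambda>i. fps_to_fls (F i)"

abbreviation (input) "c \<equiv> deriv_value y \<xi>"

lemmas rebase_hom = is_subfield_meromorphic_at[of \<xi>] field_hom_rebase[of \<xi>]

lemma nth_deriv_conv_at: "fps_nth_deriv i y \<in> conv_at \<xi>"
proof (induction i)
  case (Suc i)
  then show ?case
    unfolding fps_nth_deriv_commute by (rule conv_at_deriv)
qed (use conv in \<open>simp add: conv_at_def\<close>)

lemma deriv_F: "fps_deriv (F i) = F (Suc i)"
  unfolding fps_nth_deriv_commute by (rule taylor_deriv[OF nth_deriv_conv_at, symmetric])

lemma F_nth_0: "fps_nth (F i) 0 = c i"
  by (simp add: taylor_nth_0 nth_deriv_conv_at deriv_value_def)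

lemma F_nth_0': "(\<lambda>i. fps_nth (F i) 0) = c"
  by (simp add: F_nth_0 fun_eq_iff)

lemma rebase_deriv_fls: "rebase \<xi> (deriv_fls y i) = f i"
  by (simp add: deriv_fls_def rebase_fps nth_deriv_conv_at)

lemma deriv_fls_meromorphic: "deriv_fls y i \<in> meromorphic_at \<xi>"
  unfolding deriv_fls_def by (rule meromorphic_atI[OF nth_deriv_conv_at])

lemma rebase_poly: "rebase \<xi> (fls_of_poly p) = fls_of_poly (p \<circ>\<^sub>p [:\<xi>, 1:])"
  by (simp add: fls_of_poly_def rebase_fps conv_at_poly taylor_poly)

lemma fls_of_poly_meromorphic: "fls_of_poly p \<in> meromorphic_at \<xi>"
  unfolding fls_of_poly_def by (rule meromorphic_atI[OF conv_at_poly])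

lemma translation_Qbar: "[:\<xi>, 1:] \<in> Qbar_poly" "[:- \<xi>, 1:] \<in> Qbar_poly"
  using \<xi> subfield_uminus[OF is_subfield_Qbar] subfield_one[OF is_subfield_Qbar] subfield_zero[OF is_subfield_Qbar]
  by (auto simp: Qbar_poly_def coeff_pCons split: nat.split)

lemma translate_back: "p \<circ>\<^sub>p [:- \<xi>, 1:] \<circ>\<^sub>p [:\<xi>, 1:] = p"
proof -
  have "[:- \<xi>, 1:] \<circ>\<^sub>p [:\<xi>, 1:] = [:0, 1:]"
    by (simp add: pcompose_pCons)
  then show ?thesis
    by (simp flip: pcompose_assoc)
qed

lemma ratfun_meromorphic: "Qbar_ratfun \<subseteq> meromorphic_at \<xi>"
  using subfield_divide[OF is_subfield_meromorphic_at] fls_of_poly_meromorphic by (auto simp: Qbar_ratfun_def)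

lemma rebase_ratfun: "rebase \<xi> ` Qbar_ratfun = Qbar_ratfun"
proof -
  have div: "rebase \<xi> (fls_of_poly p / fls_of_poly q)
      = fls_of_poly (p \<circ>\<^sub>p [:\<xi>, 1:]) / fls_of_poly (q \<circ>\<^sub>p [:\<xi>, 1:])" for p q
    using field_hom_mult[OF rebase_hom, of "fls_of_poly p" "inverse (fls_of_poly q)"]
      field_hom_inverse[OF rebase_hom, of "fls_of_poly q"]
      fls_of_poly_meromorphic subfield_inverse[OF is_subfield_meromorphic_at]
    by (simp add: divide_inverse rebase_poly)
  show ?thesis
  proof
    show "rebase \<xi> ` Qbar_ratfun \<subseteq> Qbar_ratfun"
    proof safe
      fix x
      assume "x \<in> Qbar_ratfun"
      then obtain p q where pq: "p \<in> Qbar_poly" "q \<in> Qbar_poly" "q \<noteq> 0" "x = fls_of_poly p / fls_of_poly q"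
        unfolding Qbar_ratfun_def by blast
      have "q \<circ>\<^sub>p [:\<xi>, 1:] \<noteq> 0"
        using pq(3) by (simp add: pcompose_eq_0_iff)
      then show "rebase \<xi> x \<in> Qbar_ratfun"
        unfolding pq(4) div Qbar_ratfun_def using pq(1,2) Qbar_poly_pcompose translation_Qbar by blast
    qed
    show "Qbar_ratfun \<subseteq> rebase \<xi> ` Qbar_ratfun"
    proof
      fix x
      assume "x \<in> Qbar_ratfun"
      then obtain p q where pq: "p \<in> Qbar_poly" "q \<in> Qbar_poly" "q \<noteq> 0" "x = fls_of_poly p / fls_of_poly q"
        unfolding Qbar_ratfun_def by blast
      have "q \<circ>\<^sub>p [:- \<xi>, 1:] \<noteq> 0"
        using pq(3) by (simp add: pcompose_eq_0_iff)
      then have "fls_of_poly (p \<circ>\<^sub>p [:- \<xi>, 1:]) / fls_of_poly (q \<circ>\<^sub>p [:- \<xi>, 1:]) \<in> Qbar_ratfun"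
        unfolding Qbar_ratfun_def using pq(1,2) Qbar_poly_pcompose translation_Qbar by blast
      moreover have "x = rebase \<xi> (fls_of_poly (p \<circ>\<^sub>p [:- \<xi>, 1:]) / fls_of_poly (q \<circ>\<^sub>p [:- \<xi>, 1:]))"
        unfolding div translate_back by (rule pq(4))
      ultimately show "x \<in> rebase \<xi> ` Qbar_ratfun"
        by blast
    qed
  qed
qed

lemma alg_indep_rebase: "alg_indep Qbar_ratfun J f \<longleftrightarrow> alg_indep Qbar_ratfun J (deriv_fls y)"
proof -
  note zero = subfield_zero[OF is_subfield_Qbar_ratfun]
  show ?thesis
    unfolding alg_indep_iff[OF zero]
    using field_hom_lin_indep_over_mon[OF rebase_hom deriv_fls_meromorphic ratfun_meromorphic, of _ J]
    by (simp add: rebase_ratfun rebase_deriv_fls)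
qed

lemma hom_alg_indep_rebase: "hom_alg_indep Qbar_ratfun J f \<longleftrightarrow> hom_alg_indep Qbar_ratfun J (deriv_fls y)"
proof -
  note zero = subfield_zero[OF is_subfield_Qbar_ratfun]
  have "lin_indep_over (rebase \<xi> ` Qbar_ratfun) A (mon (\<lambda>i. rebase \<xi> (deriv_fls y i)))
      \<longleftrightarrow> lin_indep_over Qbar_ratfun A (mon (deriv_fls y))" for A
    using field_hom_lin_indep_over_mon[OF rebase_hom deriv_fls_meromorphic ratfun_meromorphic, where I = UNIV]
    by simp
  then show ?thesis
    unfolding hom_alg_indep_iff[OF zero] by (simp add: rebase_ratfun rebase_deriv_fls)
qed

lemma hom_trdeg_rebase: "hom_trdeg Qbar_ratfun n f = hom_trdeg Qbar_ratfun n (deriv_fls y)"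
  unfolding hom_trdeg_def hom_alg_indep_rebase ..

text \<open>
  The hypothesis concerns expansions at \<open>0\<close>; the change of base point maps the field generated by them
  onto the one generated by the expansions at \<open>\<xi>\<close>.
\<close>

lemma ratfun_closed_rebase:
  assumes "u \<in> is_subfield hull (Qbar_ratfun \<union> f ` {..<n})" "alg_over Qbar_ratfun u"
  shows "u \<in> Qbar_ratfun"
proof -
  let ?L = "adjoin_field Qbar_ratfun {..<n} (deriv_fls y)"
  have L: "?L = is_subfield hull (Qbar_ratfun \<union> deriv_fls y ` {..<n})"
    by (rule adjoin_field_eq_hull[OF is_subfield_Qbar_ratfun])
  have sub: "Qbar_ratfun \<union> deriv_fls y ` {..<n} \<subseteq> ?L"
    unfolding L by (rule hull_subset)
  have L_mero: "?L \<subseteq> meromorphic_at \<xi>"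
    unfolding L using ratfun_meromorphic deriv_fls_meromorphic is_subfield_meromorphic_at
    by (intro hull_minimal) auto
  have sL: "is_subfield ?L"
    unfolding L by (rule is_subfield_hull)
  have "is_subfield hull (Qbar_ratfun \<union> f ` {..<n}) \<subseteq> rebase \<xi> ` ?L"
  proof (rule hull_minimal)
    show "is_subfield (rebase \<xi> ` ?L)"
      by (rule field_hom_image_subfield[OF rebase_hom sL L_mero])
    have "rebase \<xi> ` (Qbar_ratfun \<union> deriv_fls y ` {..<n}) \<subseteq> rebase \<xi> ` ?L"
      by (rule image_mono[OF sub])
    then show "Qbar_ratfun \<union> f ` {..<n} \<subseteq> rebase \<xi> ` ?L"
      by (simp add: image_Un image_image rebase_ratfun rebase_deriv_fls)
  qed
  then have "u \<in> rebase \<xi> ` Qbar_ratfun"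
    using assms sub subfield_zero[OF is_subfield_Qbar_ratfun]
    by (intro field_hom_alg_closed[OF rebase_hom _ _ L_mero closed]) (auto simp: rebase_ratfun)
  then show ?thesis
    by (simp add: rebase_ratfun)
qed

text \<open>
  The denominator is a power of \<open>T\<close>, whose expansion at \<open>\<xi>\<close> is a unit.
\<close>

lemma rebase_coefficient:
  assumes "r \<in> Qbar_poly_inv T"
  obtains B where "B \<in> fps_over Qbar" "rebase \<xi> r = fps_to_fls B" "r \<in> meromorphic_at \<xi>"
proof -
  obtain p j where p: "p \<in> Qbar_poly" "r = fls_of_poly p / fls_of_poly T ^ j"
    using assms by (auto simp: Qbar_poly_inv_def)
  let ?p = "fps_of_poly (p \<circ>\<^sub>p [:\<xi>, 1:])" and ?q = "fps_of_poly (T \<circ>\<^sub>p [:\<xi>, 1:]) ^ j"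
  note inv = subfield_inverse[OF is_subfield_meromorphic_at] and pow = subfield_power[OF is_subfield_meromorphic_at]
  have "fps_nth (fps_of_poly (T \<circ>\<^sub>p [:\<xi>, 1:])) 0 = poly T \<xi>"
    by (simp add: coeff_pcompose_0)
  then have q0: "fps_nth ?q 0 \<noteq> 0"
    using T_\<xi> by (simp add: fps_power_zeroth)
  have "rebase \<xi> r = rebase \<xi> (fls_of_poly p) * inverse (rebase \<xi> (fls_of_poly T) ^ j)"
    unfolding p(2) divide_inverse
    by (simp add: field_hom_mult[OF rebase_hom] field_hom_inverse[OF rebase_hom] field_hom_power[OF rebase_hom]
        fls_of_poly_meromorphic inv pow)
  also have "\<dots> = fps_to_fls ?p * inverse (fps_to_fls ?q)"
    by (simp add: rebase_poly) (simp add: fls_of_poly_def fps_to_fls_power)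
  also have "\<dots> = fps_to_fls (?p * inverse ?q)"
    by (simp only: fls_inverse_fps_to_fls[OF subdegree_eq_0[OF q0]] fls_times_fps_to_fls)
  finally have "rebase \<xi> r = fps_to_fls (?p * inverse ?q)" .
  moreover have "?p * inverse ?q \<in> fps_over Qbar"
    using p(1) T(1) q0 Qbar_poly_pcompose translation_Qbar
    by (intro fps_over_mult[OF is_subfield_Qbar] fps_over_inverse[OF is_subfield_Qbar]
        fps_over_power[OF is_subfield_Qbar] fps_of_poly_over) auto
  moreover have "r \<in> meromorphic_at \<xi>"
    unfolding p(2) by (intro subfield_divide[OF is_subfield_meromorphic_at] pow fls_of_poly_meromorphic)
  ultimately show ?thesis
    using that by blast
qed

lemma initial_values:
  assumes "i < n"
  shows "\<exists>\<zeta>. (\<forall>j. \<zeta> j \<in> fps_over Qbar \<and> fps_nth (\<zeta> j) 0 = (if j = i then 1 else 0)) \<and>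
    fps_const (fps_nth (F i) 0) = (\<Sum>j<n. \<zeta> j * F j)"
proof -
  have "\<forall>i\<in>{..<n}. \<exists>B. B \<in> fps_over Qbar \<and> rebase \<xi> (b i) = fps_to_fls B \<and> b i \<in> meromorphic_at \<xi>"
    using rebase_coefficient[OF b] by (metis lessThan_iff)
  then obtain B where "\<forall>i\<in>{..<n}. B i \<in> fps_over Qbar \<and> rebase \<xi> (b i) = fps_to_fls (B i) \<and> b i \<in> meromorphic_at \<xi>"
    by (rule bchoice[THEN exE])
  then have B: "B i \<in> fps_over Qbar" "rebase \<xi> (b i) = fps_to_fls (B i)" "b i \<in> meromorphic_at \<xi>" if "i < n" for i
    using that by simp_all
  note mult = subfield_mult[OF is_subfield_meromorphic_at]
  have "0 = rebase \<xi> (deriv_fls y n + (\<Sum>i<n. b i * deriv_fls y i))"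
    by (simp only: ode field_hom_zero[OF rebase_hom])
  also have "\<dots> = rebase \<xi> (deriv_fls y n) + rebase \<xi> (\<Sum>i<n. b i * deriv_fls y i)"
    using B(3) by (intro field_hom_add[OF rebase_hom] subfield_sum[OF is_subfield_meromorphic_at] mult deriv_fls_meromorphic) auto
  also have "rebase \<xi> (\<Sum>i<n. b i * deriv_fls y i) = (\<Sum>i<n. rebase \<xi> (b i * deriv_fls y i))"
    using B(3) by (intro field_hom_sum[OF rebase_hom] mult deriv_fls_meromorphic) auto
  also have "\<dots> = (\<Sum>i<n. fps_to_fls (B i) * f i)"
    using B(2,3) by (intro sum.cong) (simp_all add: field_hom_mult[OF rebase_hom] deriv_fls_meromorphic rebase_deriv_fls)
  finally have "fps_to_fls (F n + (\<Sum>i<n. B i * F i)) = 0"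
    by (simp add: rebase_deriv_fls fps_to_fls_sum fls_times_fps_to_fls)
  then have eq: "F n + (\<Sum>i<n. B i * F i) = 0"
    by (simp only: fps_to_fls_eq_0_iff)
  show ?thesis
    by (rule initial_values_as_combinations[where f = F, OF is_subfield_Qbar B(1) deriv_F eq assms])
      (assumption, blast)
qed

lemma value_combination:
  assumes "i < n"
  obtains \<zeta> where "\<And>j. \<zeta> j \<in> laurent_over Qbar" "fls_const (c i) = (\<Sum>j<n. \<zeta> j * f j)"
proof -
  obtain \<zeta> where \<zeta>: "\<And>j. \<zeta> j \<in> fps_over Qbar" "fps_const (fps_nth (F i) 0) = (\<Sum>j<n. \<zeta> j * F j)"
    using initial_values[OF assms] by blast
  have "fls_const (c i) = fps_to_fls (fps_const (fps_nth (F i) 0))"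
    by (simp add: F_nth_0)
  also have "\<dots> = (\<Sum>j<n. fps_to_fls (\<zeta> j) * f j)"
    by (simp add: \<zeta>(2) fps_to_fls_sum fls_times_fps_to_fls)
  finally show ?thesis
    using that[of "\<lambda>j. fps_to_fls (\<zeta> j)"] fps_over_imp_laurent_over[OF is_subfield_Qbar \<zeta>(1)] by simp
qed

text \<open>
  The lifted relation has polynomial coefficients in \<open>t\<close>; substituting \<open>t = z - \<xi>\<close> turns constant
  terms into values at \<open>\<xi>\<close>, and the relation carries over to the expansions at \<open>0\<close>.
\<close>

lemma lift_to_functions:
  assumes Q: "Q \<in> poly_relations Qbar {..<n} c"
    and L: "is_subfield L" "Qbar_ratfun \<subseteq> L"
    and disj: "\<And>(A :: (nat \<Rightarrow>\<^sub>0 nat) set) e. e ` A \<subseteq> laurent_over Qbar \<Longrightarrow>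
        lin_indep_over Qbar_ratfun A e \<Longrightarrow> lin_indep_over L A e"
    and u: "u \<noteq> 0" "\<And>m. keys m \<subseteq> {..<n} \<Longrightarrow> mdeg m \<in> mdeg ` keys Q \<Longrightarrow> mon f m / u \<in> L"
  shows "\<exists>P\<in>poly_relations (Qbar_poly_inv T) {..<n} (deriv_fls y). Q = mpoly_specialize \<xi> P \<and>
    mdeg ` keys P \<subseteq> mdeg ` keys Q"
proof -
  have Q': "Q \<in> poly_relations Qbar {..<n} (\<lambda>i. fps_nth (F i) 0)"
    using Q by (simp only: F_nth_0')
  obtain A p where A: "finite A" "keys Q \<subseteq> A"
    "\<And>m. m \<in> A \<Longrightarrow> keys m \<subseteq> {..<n} \<and> mdeg m \<in> mdeg ` keys Q"
    and p: "\<And>m. p m \<in> Qbar_poly" "\<And>m. m \<in> A \<Longrightarrow> coeff (p m) 0 = lookup Q m"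
    "(\<Sum>m\<in>A. fls_of_poly (p m) * mon f m) = 0"
    by (rule lift_relation[where f = F and Q = Q and L = L and u = u and n = n,
          OF initial_values Q' L disj u]) (assumption+, rule that)
  define q where "q m = p m \<circ>\<^sub>p [:- \<xi>, 1:]" for m
  have q: "q m \<in> Qbar_poly" for m
    unfolding q_def by (rule Qbar_poly_pcompose[OF p(1) translation_Qbar(2)])
  have poly_q: "poly (q m) \<xi> = coeff (p m) 0" for m
    by (simp add: q_def poly_pcompose poly_0_coeff_0)
  have "(\<Sum>m\<in>A. rebase \<xi> (fls_of_poly (q m)) * mon (\<lambda>i. rebase \<xi> (deriv_fls y i)) m) = 0"
    using p(3) by (simp add: rebase_poly q_def translate_back rebase_deriv_fls)
  moreover have "(\<Sum>m\<in>A. rebase \<xi> (fls_of_poly (q m)) * mon (\<lambda>i. rebase \<xi> (deriv_fls y i)) m) = 0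
      \<longleftrightarrow> (\<Sum>m\<in>A. fls_of_poly (q m) * mon (deriv_fls y) m) = 0"
    by (rule field_hom_relation[OF rebase_hom, where I = UNIV])
      (auto intro: deriv_fls_meromorphic fls_of_poly_meromorphic)
  ultimately have rel: "(\<Sum>m\<in>A. fls_of_poly (q m) * mon (deriv_fls y) m) = 0"
    by blast
  define P where "P = mpoly_of A (\<lambda>m. fls_of_poly (q m))"
  have inv: "fls_of_poly r \<in> Qbar_poly_inv T" if "r \<in> Qbar_poly" for r
    unfolding Qbar_poly_inv_def using that by (intro CollectI exI[of _ r] exI[of _ 0]) simp
  have zero: "fls_of_poly 0 = 0"
    by (simp add: fls_of_poly_def)
  have "P \<in> poly_relations (Qbar_poly_inv T) {..<n} (deriv_fls y)"
    unfolding P_def poly_relations_def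
    using A(3) rel q inv[OF Qbar_poly_zero] inv[OF q]
    by (auto simp: mpoly_eval_mpoly_of[OF A(1)] zero intro!: mpoly_of_in_mpoly_ring[OF A(1)])
  moreover have "Q = mpoly_specialize \<xi> P"
  proof (rule poly_mapping_eqI)
    fix m
    have eval: "ratfun_eval \<xi> (fls_of_poly r) = poly r \<xi>" for r
      using ratfun_eval_divide[of 1 \<xi> r] by (simp add: fls_of_poly_def)
    show "lookup Q m = lookup (mpoly_specialize \<xi> P) m"
      using A(2) p(2) eval[of 0]
      by (auto simp: lookup_mpoly_specialize P_def lookup_mpoly_of[OF A(1)] eval poly_q zero in_keys_iff)
  qed
  moreover have "mdeg ` keys P \<subseteq> mdeg ` keys Q"
    using keys_mpoly_of[OF A(1), of "\<lambda>m. fls_of_poly (q m)"] A(3) unfolding P_def by blast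
  ultimately show ?thesis
    by blast
qed

text \<open>
  A transcendence basis \<open>J\<close> among the functions has at most as many members as some independent set
  \<open>S\<close> of polynomials in the values, by equality of the transcendence degrees.
\<close>

lemma lift_affine:
  assumes td: "trdeg Qbar (adjoin_ring Qbar {..<n} c) = trdeg Qbar_ratfun (adjoin_ring Qbar_ratfun {..<n} (deriv_fls y))"
    and Q: "Q \<in> poly_relations Qbar {..<n} c"
  shows "\<exists>P\<in>poly_relations (Qbar_poly_inv T) {..<n} (deriv_fls y). Q = mpoly_specialize \<xi> P \<and>
    mdeg ` keys P \<subseteq> mdeg ` keys Q"
proof -
  let ?K = Qbar_ratfun and ?N = "{..<n}"
  let ?L = "is_subfield hull (?K \<union> f ` ?N)"
  note sK = is_subfield_Qbar_ratfun
  obtain J where J: "J \<subseteq> ?N" "alg_indep ?K J f" "\<And>i. i \<in> ?N \<Longrightarrow> alg_over (is_subfield hull (?K \<union> f ` J)) (f i)"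
    by (rule transcendence_basis_exists[OF sK, of ?N f]) (simp, rule that)
  have finJ: "finite J"
    using J(1) finite_subset by blast
  have "enat (card J) \<le> trdeg ?K (adjoin_ring ?K ?N (deriv_fls y))"
    using card_le_trdeg[OF sK finJ J(1)] J(2) alg_indep_rebase by blast
  then have "enat (card J) \<le> trdeg Qbar (adjoin_ring Qbar ?N c)"
    by (simp only: td)
  then obtain S where S: "finite S" "S \<subseteq> adjoin_ring Qbar ?N c" "alg_indep Qbar S (\<lambda>x. x)" "card J \<le> card S"
  proof (rule trdeg_geE)
    assume "card J = 0"
    then show thesis
      using that[of "{}"] alg_indep_empty[OF is_subfield_Qbar, of "\<lambda>x. x"] by simp
  qed (rule that)
  have det: "D (fls_const s) = 0"
    if D: "derivation D" "\<forall>a\<in>laurent_over Qbar. D a = 0" "\<forall>i\<in>?N. D (f i) = 0" and s: "s \<in> S" for D s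
  proof -
    have "is_subfield {x. D (fls_const x) = 0}"
    proof (rule is_subfieldI)
      show "1 \<in> {x. D (fls_const x) = 0}"
        using derivation_one[OF D(1)] by simp
      show "inverse x \<in> {x. D (fls_const x) = 0}" if "x \<in> {x. D (fls_const x) = 0}" for x
        using that field_hom_inverse[OF is_subfield_UNIV field_hom_fls_const, of x]
        by (simp add: derivation_inverse[OF D(1)])
      show "x - y \<in> {x. D (fls_const x) = 0}" "x * y \<in> {x. D (fls_const x) = 0}"
        if "x \<in> {x. D (fls_const x) = 0}" "y \<in> {x. D (fls_const x) = 0}" for x y
        using that field_hom_diff[OF is_subfield_UNIV field_hom_fls_const, of x y]
          field_hom_mult[OF is_subfield_UNIV field_hom_fls_const, of x y]
        by (simp_all add: derivation_diff[OF D(1)] derivation_mult[OF D(1)] del: fls_const_mult_const)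
    qed
    moreover have "D (fls_const (c i)) = 0" if i: "i \<in> ?N" for i
    proof -
      obtain \<zeta> where \<zeta>: "\<And>j. \<zeta> j \<in> laurent_over Qbar" "fls_const (c i) = (\<Sum>j<n. \<zeta> j * f j)"
        using value_combination i by (metis lessThan_iff)
      show ?thesis
        unfolding \<zeta>(2) derivation_sum[OF D(1)] using D(2,3) \<zeta>(1) by (intro sum.neutral) (simp add: derivation_mult[OF D(1)])
    qed
    moreover have "D (fls_const a) = 0" if "a \<in> Qbar" for a
      using D(2) fps_over_imp_laurent_over[OF is_subfield_Qbar fps_over_const[OF is_subfield_Qbar that]] by simp
    ultimately have "is_subfield hull (Qbar \<union> c ` ?N) \<subseteq> {x. D (fls_const x) = 0}"
      by (intro hull_minimal) auto
    moreover have "s \<in> adjoin_field Qbar ?N c"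
      using s S(2) adjoin_ring_coeff[OF is_subfield_Qbar subfield_one[OF is_subfield_Qbar], of ?N c]
      unfolding adjoin_field_def by (intro CollectI exI[of _ s] exI[of _ 1]) auto
    ultimately show ?thesis
      unfolding adjoin_field_eq_hull[OF is_subfield_Qbar] by blast
  qed
  have sL: "is_subfield ?L" and sub: "?K \<union> f ` ?N \<subseteq> ?L"
    by (rule is_subfield_hull, rule hull_subset)
  show ?thesis
  proof (rule lift_to_functions[OF Q sL, where u = 1])
    show "lin_indep_over ?L A e" if e: "e ` A \<subseteq> laurent_over Qbar" "lin_indep_over ?K A e"
      for A :: "(nat \<Rightarrow>\<^sub>0 nat) set" and e
    proof (rule linearly_disjoint_of_values[where k = Qbar and J = J and S = S and z = "\<lambda>x. x"])
      show "u \<in> ?K" if "u \<in> ?L" "alg_over ?K u" for u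
        by (rule ratfun_closed_rebase[OF that])
      show "alg_over (is_subfield hull (?K \<union> f ` J)) (f i)" if "i \<in> ?N" for i
        by (rule J(3)[OF that])
      show "D (fls_const s) = 0" if "derivation D" "\<forall>a\<in>laurent_over Qbar. D a = 0" "\<forall>i\<in>?N. D (f i) = 0" "s \<in> S" for D s
        by (rule det[OF that])
    qed (fact is_subfield_Qbar sK Qbar_ratfun_subset_laurent_over J finJ S e)+
    show "mon f m / 1 \<in> ?L" if "keys m \<subseteq> ?N" for m
      unfolding mon_def using sub that by (auto intro!: subfield_prod[OF sL] subfield_power[OF sL])
  qed (use sub in auto)
qed

text \<open>
  Maximal independent parts \<open>J\<close> of the functions and \<open>J'\<close> of the values have the same size, and remain
  so after one member of each is used as a denominator. If all functions vanish there is no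
  denominator, but then all forms have values in the field of rational functions.
\<close>

lemma lift_homogeneous:
  assumes td: "hom_trdeg Qbar n c = hom_trdeg Qbar_ratfun n (deriv_fls y)"
    and Q: "Q \<in> poly_relations Qbar {..<n} c" "homogeneous d Q"
  shows "\<exists>P\<in>poly_relations (Qbar_poly_inv T) {..<n} (deriv_fls y). Q = mpoly_specialize \<xi> P \<and>
    mdeg ` keys P \<subseteq> mdeg ` keys Q"
proof -
  let ?K = Qbar_ratfun and ?N = "{..<n}"
  note sK = is_subfield_Qbar_ratfun and zK = subfield_zero[OF is_subfield_Qbar_ratfun]
    and zQ = subfield_zero[OF is_subfield_Qbar]
  have deg: "mdeg m = d" if "mdeg m \<in> mdeg ` keys Q" for m :: "nat \<Rightarrow>\<^sub>0 nat"
    using that Q(2) by (auto simp: homogeneous_mdeg)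
  show ?thesis
  proof (cases "\<forall>i<n. f i = 0")
    case True
    show ?thesis
    proof (rule lift_to_functions[OF Q(1) sK order.refl, where u = 1])
      show "mon f m / 1 \<in> ?K" if "keys m \<subseteq> ?N" for m
        unfolding mon_def using that True subfield_power[OF sK zK]
        by (auto intro!: subfield_prod[OF sK])
    qed auto
  next
    case False
    obtain J where J: "J \<subseteq> ?N" "hom_alg_indep ?K J f" "card J = hom_trdeg ?K n f"
      "\<And>H. H \<subseteq> ?N \<Longrightarrow> hom_alg_indep ?K H f \<Longrightarrow> card H \<le> card J"
      by (rule hom_trdeg_attained[OF sK, of n f]) (rule that)
    obtain J' where J': "J' \<subseteq> ?N" "hom_alg_indep Qbar J' c" "card J' = hom_trdeg Qbar n c"
      by (rule hom_trdeg_attained[OF is_subfield_Qbar, of n c]) (rule that)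
    have fin: "finite J" "finite J'"
      using J(1) J'(1) finite_subset by blast+
    have card: "card J = card J'"
      using J(3) J'(3) td hom_trdeg_rebase by simp
    obtain i0 where i0: "i0 < n" "f i0 \<noteq> 0"
      using False by blast
    have "card {i0} \<le> card J"
      using i0 by (intro J(4) hom_alg_indep_singleton[OF sK]) auto
    then have "J \<noteq> {}" "J' \<noteq> {}"
      using card by auto
    then obtain a a' where a: "a \<in> J" "a' \<in> J'"
      by blast
    have nz: "f a \<noteq> 0" "c a' \<noteq> 0"
      using hom_alg_indep_nonzero[OF sK J(2) a(1)] hom_alg_indep_nonzero[OF is_subfield_Qbar J'(2) a(2)] by auto
    define g where "g i = f i / f a" for i
    define z where "z i = c i / c a'" for i
    let ?L = "is_subfield hull (?K \<union> g ` ?N)" and ?J = "J - {a}"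
    have sL: "is_subfield ?L" and sub: "?K \<union> g ` ?N \<subseteq> ?L"
      by (rule is_subfield_hull, rule hull_subset)
    have ind: "alg_indep ?K ?J g"
      using J(2) hom_alg_indep_iff_quotients[where f = f and b = a, OF zK a(1) nz(1)] by (simp add: g_def[abs_def])
    have z: "alg_indep Qbar (J' - {a'}) z"
      using J'(2) hom_alg_indep_iff_quotients[where f = c and b = a', OF zQ a(2) nz(2)] by (simp add: z_def[abs_def])
    have alg: "alg_over (is_subfield hull (?K \<union> g ` ?J)) (g i)" if i: "i \<in> ?N" for i
    proof -
      let ?M = "is_subfield hull (?K \<union> g ` ?J)"
      have M: "is_subfield ?M" "?K \<union> g ` ?J \<subseteq> ?M"
        by (rule is_subfield_hull, rule hull_subset)
      consider "i = a" | "i \<in> ?J" | "i \<notin> J"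
        by blast
      then show ?thesis
      proof cases
        case 1
        then have "g i = 1"
          using nz(1) by (simp add: g_def)
        then show ?thesis
          using alg_over_self[OF M(1) subfield_one[OF M(1)]] by simp
      next
        case 2
        then show ?thesis
          using M by (intro alg_over_self) auto
      next
        case 3
        have "\<not> card (insert i J) \<le> card J"
          using 3 fin(1) by simp
        then have "\<not> hom_alg_indep ?K (insert i J) f"
          using J(1) J(4)[of "insert i J"] i by blast
        moreover have "a \<in> insert i J"
          using a(1) by simp
        ultimately have "\<not> alg_indep ?K (insert i J - {a}) g"
          using hom_alg_indep_iff_quotients[where f = f and b = a and J = "insert i J", OF zK _ nz(1)] by (simp add: g_def[abs_def])
        moreover have "insert i J - {a} = insert i ?J"
          using 3 a(1) by blast
        ultimately show ?thesis
          using not_alg_indep_insert_imp_algebraic[OF sK ind] by simp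
      qed
    qed
    have closed': "u \<in> ?K" if "u \<in> ?L" "alg_over ?K u" for u
    proof (rule ratfun_closed_rebase[OF _ that(2)])
      let ?H = "is_subfield hull (?K \<union> f ` ?N)"
      have H: "is_subfield ?H" "?K \<union> f ` ?N \<subseteq> ?H"
        by (rule is_subfield_hull, rule hull_subset)
      have "g i \<in> ?H" if "i \<in> ?N" for i
        unfolding g_def using that a(1) J(1) H(2) by (intro subfield_divide[OF H(1)]) blast+
      then have "?L \<subseteq> ?H"
        using H by (intro hull_minimal) auto
      then show "u \<in> ?H"
        using that(1) by blast
    qed
    have det: "D (fls_const (z s)) = 0"
      if D: "derivation D" "\<forall>x\<in>laurent_over Qbar. D x = 0" "\<forall>i\<in>?N. D (g i) = 0" and s: "s \<in> J' - {a'}" for D s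
    proof -
      note sub_const = subfield_of_constants[OF D(1)]
      have const: "D (fls_const (c i) / f a) = 0" if i: "i \<in> ?N" for i
      proof -
        obtain \<zeta> where \<zeta>: "\<And>j. \<zeta> j \<in> laurent_over Qbar" "fls_const (c i) = (\<Sum>j<n. \<zeta> j * f j)"
          using value_combination i by (metis lessThan_iff)
        have "fls_const (c i) / f a = (\<Sum>j<n. \<zeta> j * g j)"
          unfolding \<zeta>(2) by (simp add: g_def sum_divide_distrib)
        also have "D \<dots> = 0"
          unfolding derivation_sum[OF D(1)] using D(2,3) \<zeta>(1)
          by (intro sum.neutral) (simp add: derivation_mult[OF D(1)])
        finally show ?thesis .
      qed
      have "fls_const (z s) = fls_const (c s) / fls_const (c a')"
        using field_hom_mult[OF is_subfield_UNIV field_hom_fls_const, of "c s" "inverse (c a')"]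
          field_hom_inverse[OF is_subfield_UNIV field_hom_fls_const, of "c a'"]
        by (simp add: z_def divide_inverse)
      also have "\<dots> = (fls_const (c s) / f a) / (fls_const (c a') / f a)"
        using nz(1) by simp
      finally have eq: "fls_const (z s) = (fls_const (c s) / f a) / (fls_const (c a') / f a)" .
      have "(fls_const (c s) / f a) / (fls_const (c a') / f a) \<in> {x. D x = 0}"
      proof (rule subfield_divide[OF sub_const])
        show "fls_const (c s) / f a \<in> {x. D x = 0}" "fls_const (c a') / f a \<in> {x. D x = 0}"
          using const s J'(1) a(2) by blast+
      qed
      then show ?thesis
        unfolding eq by blast
    qed
    have J_sub: "?J \<subseteq> ?N" "finite ?J" "finite (J' - {a'})"
      using J(1) fin by auto
    have cards: "card ?J \<le> card (J' - {a'})"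
      using card fin a by simp
    show ?thesis
    proof (rule lift_to_functions[OF Q(1) sL, where u = "f a ^ d"])
      show "lin_indep_over ?L A e" if e: "e ` A \<subseteq> laurent_over Qbar" "lin_indep_over ?K A e"
        for A :: "(nat \<Rightarrow>\<^sub>0 nat) set" and e
      proof (rule linearly_disjoint_of_values[where k = Qbar and J = ?J and S = "J' - {a'}" and z = z])
        show "u \<in> ?K" if "u \<in> ?L" "alg_over ?K u" for u
          by (rule closed'[OF that])
        show "alg_over (is_subfield hull (?K \<union> g ` ?J)) (g i)" if "i \<in> ?N" for i
          by (rule alg[OF that])
        show "D (fls_const (z s)) = 0" if "derivation D" "\<forall>x\<in>laurent_over Qbar. D x = 0" "\<forall>i\<in>?N. D (g i) = 0"
          "s \<in> J' - {a'}" for D s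
          by (rule det[OF that])
      qed (fact is_subfield_Qbar sK Qbar_ratfun_subset_laurent_over J_sub z cards e)+
      show "mon f m / f a ^ d \<in> ?L"
        if m: "keys m \<subseteq> ?N" "mdeg m \<in> mdeg ` keys Q" for m
      proof -
        have "mon f m / f a ^ d = mon g m"
          using deg[OF m(2)] mon_scale[of f "f a" m] by (simp add: g_def[abs_def])
        also have "\<dots> \<in> ?L"
          unfolding mon_def using sub m(1) by (auto intro!: subfield_prod[OF sL] subfield_power[OF sL])
        finally show ?thesis .
      qed
    qed (use sub nz in auto)
  qed
qed

text \<open>
  A linear relation is homogeneous of degree \<open>1\<close>, and so is its lift.
\<close>

lemma values_lin_indep:
  assumes lift: "\<And>Q. Q \<in> poly_relations Qbar {..<n} c \<Longrightarrow> homogeneous 1 Q \<Longrightarrow>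
      \<exists>P\<in>poly_relations (Qbar_poly_inv T) {..<n} (deriv_fls y). Q = mpoly_specialize \<xi> P \<and>
        mdeg ` keys P \<subseteq> mdeg ` keys Q"
    and ind: "lin_indep Qbar_ratfun n (deriv_fls y)"
  shows "lin_indep Qbar n c"
  unfolding lin_indep_def
proof (intro allI impI, elim conjE)
  fix a i
  assume a: "\<forall>i<n. a i \<in> Qbar" "(\<Sum>i<n. a i * c i) = 0" and i: "i < n"
  let ?X = "\<lambda>i. single i 1 :: nat \<Rightarrow>\<^sub>0 nat"
  have inj: "inj_on ?X {..<n}"
    by (rule inj_onI) (metis keys_single singleton_inject zero_neq_one)
  let ?A = "?X ` {..<n}"
  define Q where "Q = mpoly_of ?A (\<lambda>m. a (the_inv_into {..<n} ?X m))"
  have fin: "finite ?A"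
    by simp
  have lookup_Q: "lookup Q (?X j) = a j" if "j < n" for j
    using that by (simp add: Q_def lookup_mpoly_of[OF fin] the_inv_into_f_f[OF inj] del: One_nat_def)
  have keys_Q: "keys Q \<subseteq> ?A"
    unfolding Q_def by (rule keys_mpoly_of[OF fin])
  have "mpoly_eval c Q = (\<Sum>j<n. lookup Q (?X j) * mon c (?X j))"
    using mpoly_eval_superset[OF fin keys_Q] inj by (simp add: sum.reindex)
  also have "\<dots> = 0"
    using a(2) lookup_Q by simp
  finally have "mpoly_eval c Q = 0" .
  moreover have "Q \<in> mpoly_ring Qbar {..<n}"
    unfolding Q_def using a(1)
    by (intro mpoly_of_in_mpoly_ring[OF fin] subfield_zero[OF is_subfield_Qbar]) (auto simp: the_inv_into_f_f[OF inj] simp del: One_nat_def)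
  ultimately have "Q \<in> poly_relations Qbar {..<n} c"
    by (simp add: poly_relations_def)
  moreover have "homogeneous 1 Q"
    using keys_Q by (auto simp: homogeneous_mdeg)
  ultimately obtain P where P: "P \<in> poly_relations (Qbar_poly_inv T) {..<n} (deriv_fls y)" "Q = mpoly_specialize \<xi> P"
    "mdeg ` keys P \<subseteq> mdeg ` keys Q"
    using lift by blast
  have keys_P: "keys P \<subseteq> ?A"
  proof
    fix m
    assume m: "m \<in> keys P"
    then have "mdeg m \<in> mdeg ` ?A"
      using P(3) keys_Q by blast
    then have deg: "mdeg m = 1"
      by auto
    have sub: "keys m \<subseteq> {..<n}"
      using P(1) m by (auto simp: poly_relations_def mpoly_ring_def)
    have "m \<noteq> 0"
      using deg by auto
    then have "keys m \<noteq> {}"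
      by simp
    then obtain j where j: "j \<in> keys m"
      by blast
    let ?r = "m - single j (lookup m j)"
    have "mdeg m = mdeg ?r + lookup m j"
      by (subst split_variable[of m j]) (simp only: mdeg_add mdeg_single)
    moreover have "lookup m j \<noteq> 0"
      using j by (simp add: in_keys_iff)
    ultimately have lj: "lookup m j = 1" and r: "mdeg ?r = 0"
      using deg by auto
    have "?r = 0"
      using r by (intro poly_mapping_eqI) (auto simp: mdeg_def in_keys_iff)
    then have "m = ?X j"
      using split_variable[of m j] lj by simp
    then show "m \<in> ?A"
      using j sub by blast
  qed
  have inv_ratfun: "Qbar_poly_inv T \<subseteq> Qbar_ratfun"
  proof
    fix x
    assume "x \<in> Qbar_poly_inv T"
    then obtain p j where p: "p \<in> Qbar_poly" "x = fls_of_poly p / fls_of_poly T ^ j"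
      by (auto simp: Qbar_poly_inv_def)
    have "T ^ j \<in> Qbar_poly"
      using T(1) by (induction j) (auto intro: Qbar_poly_one Qbar_poly_mult)
    then show "x \<in> Qbar_ratfun"
      unfolding Qbar_ratfun_def p(2) fls_of_poly_power[symmetric] using p(1) T(2)
      by (intro CollectI exI[of _ p] exI[of _ "T ^ j"]) simp
  qed
  have "(\<Sum>j<n. lookup P (?X j) * deriv_fls y j) = mpoly_eval (deriv_fls y) P"
    using mpoly_eval_superset[OF fin keys_P] inj by (simp add: sum.reindex)
  also have "\<dots> = 0"
    using P(1) by (simp add: poly_relations_def)
  finally have "(\<Sum>j<n. lookup P (?X j) * deriv_fls y j) = 0" .
  moreover have "\<forall>j<n. lookup P (?X j) \<in> Qbar_ratfun"
    using P(1) inv_ratfun by (auto simp: poly_relations_def mpoly_ring_def)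
  ultimately have "lookup P (?X i) = 0"
    using ind[unfolded lin_indep_def, THEN spec, of "\<lambda>j. lookup P (?X j)"] i by blast
  then have "lookup Q (?X i) = ratfun_eval \<xi> 0"
    by (simp add: P(2) lookup_mpoly_specialize)
  also have "\<dots> = 0"
    using ratfun_eval_divide[of 1 \<xi> 0] by (simp add: fls_of_poly_def)
  finally show "a i = 0"
    using lookup_Q[OF i] by simp
qed

end

theorem corollary1p7p1:
  fixes T :: "complex poly" and y :: "complex fps" and n :: nat
    and b :: "nat \<Rightarrow> complex fls" and \<xi> :: complex
  assumes "T \<in> Qbar_poly" and "T \<noteq> 0"
    and "\<And>m. fps_nth y m \<in> Qbar"
    and "\<And>i. i < n \<Longrightarrow> b i \<in> Qbar_poly_inv T"
    and "deriv_fls y n + (\<Sum>i<n. b i * deriv_fls y i) = 0"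
    and "algebraically_closed_in Qbar_ratfun (adjoin_field Qbar_ratfun {..<n} (deriv_fls y))"
    and "\<xi> \<in> Qbar" and "\<xi> \<noteq> 0"
    and "ereal (norm \<xi>) < fps_conv_radius y"
    and "poly T \<xi> \<noteq> 0"
  shows
    "(trdeg Qbar (adjoin_ring Qbar {..<n} (deriv_value y \<xi>)) =
        trdeg Qbar_ratfun (adjoin_ring Qbar_ratfun {..<n} (deriv_fls y)) \<longrightarrow>
      (\<forall>Q\<in>poly_relations Qbar {..<n} (deriv_value y \<xi>).
        \<exists>P\<in>poly_relations (Qbar_poly_inv T) {..<n} (deriv_fls y).
          Q = mpoly_specialize \<xi> P)) \<and>
     (hom_trdeg Qbar n (deriv_value y \<xi>) = hom_trdeg Qbar_ratfun n (deriv_fls y) \<longrightarrow>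
      (\<forall>d. \<forall>Q\<in>poly_relations Qbar {..<n} (deriv_value y \<xi>). homogeneous d Q \<longrightarrow>
        (\<exists>P\<in>poly_relations (Qbar_poly_inv T) {..<n} (deriv_fls y).
          homogeneous d P \<and> Q = mpoly_specialize \<xi> P))) \<and>
     (trdeg Qbar (adjoin_ring Qbar {..<n} (deriv_value y \<xi>)) =
        trdeg Qbar_ratfun (adjoin_ring Qbar_ratfun {..<n} (deriv_fls y)) \<or>
      hom_trdeg Qbar n (deriv_value y \<xi>) = hom_trdeg Qbar_ratfun n (deriv_fls y) \<longrightarrow>
      lin_indep Qbar_ratfun n (deriv_fls y) \<longrightarrow>
      lin_indep Qbar n (deriv_value y \<xi>))"
proof (intro conjI impI allI ballI)
  note hyps = assms(1,2,4-7,9,10)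
  fix Q
  assume "trdeg Qbar (adjoin_ring Qbar {..<n} (deriv_value y \<xi>)) =
      trdeg Qbar_ratfun (adjoin_ring Qbar_ratfun {..<n} (deriv_fls y))"
    "Q \<in> poly_relations Qbar {..<n} (deriv_value y \<xi>)"
  from lift_affine[OF hyps this]
  show "\<exists>P\<in>poly_relations (Qbar_poly_inv T) {..<n} (deriv_fls y). Q = mpoly_specialize \<xi> P"
    by blast
next
  note hyps = assms(1,2,4-7,9,10)
  fix d Q
  assume *: "hom_trdeg Qbar n (deriv_value y \<xi>) = hom_trdeg Qbar_ratfun n (deriv_fls y)"
    "Q \<in> poly_relations Qbar {..<n} (deriv_value y \<xi>)" "homogeneous d Q"
  obtain P where P: "P \<in> poly_relations (Qbar_poly_inv T) {..<n} (deriv_fls y)" "Q = mpoly_specialize \<xi> P"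
    "mdeg ` keys P \<subseteq> mdeg ` keys Q"
    by (rule lift_homogeneous[OF hyps *, THEN bexE]) (assumption, elim conjE, rule that)
  have "homogeneous d P"
    unfolding homogeneous_mdeg
  proof
    fix m
    assume "m \<in> keys P"
    then have "mdeg m \<in> mdeg ` keys Q"
      using P(3) by blast
    then show "mdeg m = d"
      using *(3) by (auto simp: homogeneous_mdeg)
  qed
  then show "\<exists>P\<in>poly_relations (Qbar_poly_inv T) {..<n} (deriv_fls y). homogeneous d P \<and> Q = mpoly_specialize \<xi> P"
    using P(1,2) by (intro bexI[of _ P] conjI)
next
  note hyps = assms(1,2,4-7,9,10)
  assume cases: "trdeg Qbar (adjoin_ring Qbar {..<n} (deriv_value y \<xi>)) =
        trdeg Qbar_ratfun (adjoin_ring Qbar_ratfun {..<n} (deriv_fls y)) \<or>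
      hom_trdeg Qbar n (deriv_value y \<xi>) = hom_trdeg Qbar_ratfun n (deriv_fls y)"
    and ind: "lin_indep Qbar_ratfun n (deriv_fls y)"
  from cases show "lin_indep Qbar n (deriv_value y \<xi>)"
  proof
    assume td: "trdeg Qbar (adjoin_ring Qbar {..<n} (deriv_value y \<xi>)) =
        trdeg Qbar_ratfun (adjoin_ring Qbar_ratfun {..<n} (deriv_fls y))"
    show ?thesis
      by (rule values_lin_indep[OF hyps _ ind]) (assumption, rule lift_affine[OF hyps td], assumption+)
  next
    assume td: "hom_trdeg Qbar n (deriv_value y \<xi>) = hom_trdeg Qbar_ratfun n (deriv_fls y)"
    show ?thesis
      by (rule values_lin_indep[OF hyps _ ind]) (assumption, rule lift_homogeneous[OF hyps td], assumption+)
  qed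
qed

end
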